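(* Let $\lambda$ be a regular cardinal. If $\mathcal{K}$ is a strongly $\lambda$-combinatorial model category, then its homotopy category $\mathrm{Ho}\,\mathcal{K}$ is well $\lambda$-generated.
   Context: A model category is combinatorial if it is cofibrantly generated and its underlying category is locally presentable. For a model category $\mathcal{K}$, the homotopy category $\mathrm{Ho}\,\mathcal{K}$ is the quotient of the full subcategory $\mathcal{K}_{cf}$ of objects that are both fibrant and cofibrant by the homotopy relation on morphisms. A fibrant replacement functor $R_f$ is a functor with fibrant values equipped with a natural trivial cofibration $X\to R_fX$; a cofibrant replacement functor $R_c$ is a functor with cofibrant values equipped with a natural trivial fibration $R_cX\to X$. A small full subcategory $\mathcal{A}$ of a category $\mathcal{C}$ is a weak generator of $\mathcal{C}$ if an object $X$ of $\mathcal{C}$ is terminal whenever $\mathcal{C}(A,X)$ is a one-element set for every $A\in\mathcal{A}$. For a regular cardinal $\lambda$, a combinatorial model category $\mathcal{K}$ is strongly $\lambda$-combinatorial if: (1) $\mathcal{K}$ is locally $\lambda$-presentable; (2) there is a small weak generator of $\mathrm{Ho}\,\mathcal{K}$ consisting of objects that are $\lambda$-presentable in $\mathcal{K}$; (3) there are fibrant and cofibrant replacement functors $R_f$ and $R_c$ on $\mathcal{K}$ that preserve $\lambda$-filtered colimits and $\lambda$-presentable objects. Let $\mathcal{C}$ be a category with coproducts. An object $S$ of $\mathcal{C}$ is $\lambda$-small if for every morphism $f\colon S\to\coprod_{i\in I}X_i$ there is a subset $J\subseteq I$ of cardinality less than $\lambda$ such that $f$ factorizes as $S\to\coprod_{j\in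 J}X_j\to\coprod_{i\in I}X_i$, where the second morphism is the subcoproduct injection. Consider classes $\mathcal{S}$ of $\lambda$-small objects of $\mathcal{C}$ such that for every morphism $f\colon S\to\coprod_{i\in I}X_i$ with $S\in\mathcal{S}$ there exist morphisms $g_i\colon S_i\to X_i$ with $S_i\in\mathcal{S}$ for all $i\in I$ such that $f$ factorizes through $\coprod_{i\in I}g_i\colon\coprod_{i\in I}S_i\to\coprod_{i\in I}X_i$. The collection of such classes is closed under unions, so there is a greatest one; its objects are called $\lambda$-compact. A category with coproducts is well $\lambda$-generated if it has a small weak generator consisting of $\lambda$-compact objects. *)

theory Defs
  imports Main "HOL-Library.FuncSet"
begin

unbundle cardinal_syntax

section \<open>Size\<close>

text \<open>
  Size is handled by a Grothendieck universe. The universe is given by a type \<open>'u\<close> whose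
  cardinality is strongly inaccessible: ``small'' means ``of cardinality less than \<open>|'u|\<close>'',
  a class is an arbitrary set. Up to bijection, every small set is a subset of \<open>'u\<close>, so small
  index sets, small diagram shapes and small cardinals can be taken to live on \<open>'u\<close>.
\<close>

definition inaccessible_universe :: "'u itself \<Rightarrow> bool" where
  "inaccessible_universe U \<longleftrightarrow>
     natLeq <o |UNIV :: 'u set| \<and>
     regularCard |UNIV :: 'u set| \<and>
     (\<forall>A :: 'u set. |A| <o |UNIV :: 'u set| \<longrightarrow> |Pow A| <o |UNIV :: 'u set| )"

definition small :: "'u itself \<Rightarrow> 'a set \<Rightarrow> bool" where
  "small U A \<longleftrightarrow> |A| <o |UNIV :: 'u set|"

definition regular_cardinal :: "'u rel \<Rightarrow> bool" where
  "regular_cardinal \<kappa> \<longleftrightarrow>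
     Card_order \<kappa> \<and> cinfinite \<kappa> \<and> regularCard \<kappa> \<and> small TYPE('u) (Field \<kappa>)"


section \<open>Categories, functors, colimits\<close>

record ('o, 'm) cat =
  Obj :: "'o set"
  Arr :: "'m set"
  Dom :: "'m \<Rightarrow> 'o"
  Cod :: "'m \<Rightarrow> 'o"
  Ident :: "'o \<Rightarrow> 'm"
  Comp :: "'m \<Rightarrow> 'm \<Rightarrow> 'm"  \<comment> \<open>\<open>Comp C g f\<close> is \<open>g\<close> after \<open>f\<close>\<close>

definition hom :: "('o, 'm, 'x) cat_scheme \<Rightarrow> 'o \<Rightarrow> 'o \<Rightarrow> 'm set" where
  "hom C X Y = {f \<in> Arr C. Dom C f = X \<and> Cod C f = Y}"

locale category =
  fixes C :: "('o, 'm, 'x) cat_scheme"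
  assumes dom_obj: "f \<in> Arr C \<Longrightarrow> Dom C f \<in> Obj C"
    and cod_obj: "f \<in> Arr C \<Longrightarrow> Cod C f \<in> Obj C"
    and ident: "X \<in> Obj C \<Longrightarrow> Ident C X \<in> hom C X X"
    and comp: "f \<in> hom C X Y \<Longrightarrow> g \<in> hom C Y Z \<Longrightarrow> Comp C g f \<in> hom C X Z"
    and ident_left: "f \<in> hom C X Y \<Longrightarrow> Comp C (Ident C Y) f = f"
    and ident_right: "f \<in> hom C X Y \<Longrightarrow> Comp C f (Ident C X) = f"
    and assoc: "f \<in> hom C X Y \<Longrightarrow> g \<in> hom C Y Z \<Longrightarrow> h \<in> hom C Z W \<Longrightarrow>
      Comp C h (Comp C g f) = Comp C (Comp C h g) f"

definition locally_small_category :: "'u itself \<Rightarrow> ('o, 'm, 'x) cat_scheme \<Rightarrow> bool" where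
  "locally_small_category U C \<longleftrightarrow>
     category C \<and> (\<forall>X \<in> Obj C. \<forall>Y \<in> Obj C. small U (hom C X Y))"

definition small_category :: "'u itself \<Rightarrow> ('o, 'm, 'x) cat_scheme \<Rightarrow> bool" where
  "small_category U C \<longleftrightarrow> category C \<and> small U (Obj C) \<and> small U (Arr C)"

definition op_cat :: "('o, 'm, 'x) cat_scheme \<Rightarrow> ('o, 'm, 'x) cat_scheme" where
  "op_cat C = C\<lparr>Dom := Cod C, Cod := Dom C, Comp := (\<lambda>g f. Comp C f g)\<rparr>"

definition initial :: "('o, 'm, 'x) cat_scheme \<Rightarrow> 'o \<Rightarrow> bool" where
  "initial C X \<longleftrightarrow> X \<in> Obj C \<and> (\<forall>Y \<in> Obj C. \<exists>!f. f \<in> hom C X Y)"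

definition terminal :: "('o, 'm, 'x) cat_scheme \<Rightarrow> 'o \<Rightarrow> bool" where
  "terminal C X \<longleftrightarrow> X \<in> Obj C \<and> (\<forall>Y \<in> Obj C. \<exists>!f. f \<in> hom C Y X)"

record ('a, 'b, 'c, 'd) functor_data =
  fobj :: "'a \<Rightarrow> 'c"
  farr :: "'b \<Rightarrow> 'd"

definition is_functor ::
  "('a, 'b, 'x) cat_scheme \<Rightarrow> ('c, 'd, 'y) cat_scheme \<Rightarrow> ('a, 'b, 'c, 'd) functor_data \<Rightarrow> bool"
  where
  "is_functor A B F \<longleftrightarrow> category A \<and> category B \<and>
     (\<forall>X \<in> Obj A. fobj F X \<in> Obj B \<and> farr F (Ident A X) = Ident B (fobj F X)) \<and>
     (\<forall>f \<in> Arr A. farr F f \<in> hom B (fobj F (Dom A f)) (fobj F (Cod A f))) \<and>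
     (\<forall>f \<in> Arr A. \<forall>g \<in> Arr A. Dom A g = Cod A f \<longrightarrow>
        farr F (Comp A g f) = Comp B (farr F g) (farr F f))"

definition functor_comp ::
  "('c, 'd, 'e, 'f) functor_data \<Rightarrow> ('a, 'b, 'c, 'd) functor_data \<Rightarrow> ('a, 'b, 'e, 'f) functor_data"
  where
  "functor_comp G F = \<lparr>fobj = fobj G \<circ> fobj F, farr = farr G \<circ> farr F\<rparr>"

definition is_cocone ::
  "('o, 'm, 'x) cat_scheme \<Rightarrow> ('i, 'j, 'y) cat_scheme \<Rightarrow> ('i, 'j, 'o, 'm) functor_data \<Rightarrow>
   'o \<Rightarrow> ('i \<Rightarrow> 'm) \<Rightarrow> bool" where
  "is_cocone C J D X c \<longleftrightarrow> X \<in> Obj C \<and>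
     (\<forall>j \<in> Obj J. c j \<in> hom C (fobj D j) X) \<and>
     (\<forall>a \<in> Arr J. Comp C (c (Cod J a)) (farr D a) = c (Dom J a))"

definition is_colimit ::
  "('o, 'm, 'x) cat_scheme \<Rightarrow> ('i, 'j, 'y) cat_scheme \<Rightarrow> ('i, 'j, 'o, 'm) functor_data \<Rightarrow>
   'o \<Rightarrow> ('i \<Rightarrow> 'm) \<Rightarrow> bool" where
  "is_colimit C J D X c \<longleftrightarrow> is_cocone C J D X c \<and>
     (\<forall>Y d. is_cocone C J D Y d \<longrightarrow>
        (\<exists>!h. h \<in> hom C X Y \<and> (\<forall>j \<in> Obj J. Comp C h (c j) = d j)))"

definition cocomplete :: "'u itself \<Rightarrow> ('o, 'm, 'x) cat_scheme \<Rightarrow> bool" where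
  "cocomplete U C \<longleftrightarrow>
     (\<forall>(J :: ('u, 'u) cat) D. small_category U J \<and> is_functor J C D \<longrightarrow>
        (\<exists>X c. is_colimit C J D X c))"

text \<open>Limits of shape \<open>J\<close> in \<open>C\<close> are colimits of shape \<open>op_cat J\<close> in \<open>op_cat C\<close>.\<close>

definition complete :: "'u itself \<Rightarrow> ('o, 'm, 'x) cat_scheme \<Rightarrow> bool" where
  "complete U C \<longleftrightarrow> cocomplete U (op_cat C)"

definition is_coproduct ::
  "('o, 'm, 'x) cat_scheme \<Rightarrow> 'i set \<Rightarrow> ('i \<Rightarrow> 'o) \<Rightarrow> 'o \<Rightarrow> ('i \<Rightarrow> 'm) \<Rightarrow> bool" where
  "is_coproduct C I X P \<iota> \<longleftrightarrow> P \<in> Obj C \<and> (\<forall>i \<in> I. \<iota> i \<in> hom C (X i) P) \<and>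
     (\<forall>Y f. Y \<in> Obj C \<and> (\<forall>i \<in> I. f i \<in> hom C (X i) Y) \<longrightarrow>
        (\<exists>!h. h \<in> hom C P Y \<and> (\<forall>i \<in> I. Comp C h (\<iota> i) = f i)))"

definition has_coproducts :: "'u itself \<Rightarrow> ('o, 'm, 'x) cat_scheme \<Rightarrow> bool" where
  "has_coproducts U C \<longleftrightarrow>
     (\<forall>(I :: 'u set) X. small U I \<and> (\<forall>i \<in> I. X i \<in> Obj C) \<longrightarrow>
        (\<exists>P \<iota>. is_coproduct C I X P \<iota>))"

text \<open>The cobase change \<open>f'\<close> of \<open>f\<close> along \<open>g\<close>; the square is \<open>f' g = g' f\<close>.\<close>

definition is_pushout ::
  "('o, 'm, 'x) cat_scheme \<Rightarrow> 'm \<Rightarrow> 'm \<Rightarrow> 'm \<Rightarrow> 'm \<Rightarrow> bool" where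
  "is_pushout C f g f' g' \<longleftrightarrow>
     f \<in> Arr C \<and> g \<in> Arr C \<and> Dom C f = Dom C g \<and>
     f' \<in> Arr C \<and> Dom C f' = Cod C g \<and> g' \<in> hom C (Cod C f) (Cod C f') \<and>
     Comp C f' g = Comp C g' f \<and>
     (\<forall>Y u v. u \<in> hom C (Cod C g) Y \<and> v \<in> hom C (Cod C f) Y \<and> Comp C u g = Comp C v f \<longrightarrow>
        (\<exists>!h. h \<in> hom C (Cod C f') Y \<and> Comp C h f' = u \<and> Comp C h g' = v))"


section \<open>Locally presentable categories\<close>

definition filtered :: "'u rel \<Rightarrow> ('u, 'u) cat \<Rightarrow> bool" where
  "filtered \<kappa> J \<longleftrightarrow> small_category TYPE('u) J \<and> Obj J \<noteq> {} \<and>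
     (\<forall>S. S \<subseteq> Obj J \<and> |S| <o \<kappa> \<longrightarrow> (\<exists>z \<in> Obj J. \<forall>x \<in> S. hom J x z \<noteq> {})) \<and>
     (\<forall>x \<in> Obj J. \<forall>y \<in> Obj J. \<forall>S. S \<subseteq> hom J x y \<and> |S| <o \<kappa> \<longrightarrow>
        (\<exists>z \<in> Obj J. \<exists>h \<in> hom J y z. \<forall>f \<in> S. \<forall>g \<in> S. Comp J h f = Comp J h g))"

definition preserves_filtered_colimits ::
  "'u rel \<Rightarrow> ('a, 'b, 'x) cat_scheme \<Rightarrow> ('c, 'd, 'y) cat_scheme \<Rightarrow>
   ('a, 'b, 'c, 'd) functor_data \<Rightarrow> bool" where
  "preserves_filtered_colimits \<kappa> A B F \<longleftrightarrow>
     (\<forall>(J :: ('u, 'u) cat) D X c.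
        filtered \<kappa> J \<and> is_functor J A D \<and> is_colimit A J D X c \<longrightarrow>
        is_colimit B J (functor_comp F D) (fobj F X) (\<lambda>j. farr F (c j)))"

text \<open>
  The functor \<open>hom(A, -)\<close> sends the colimit cocone \<open>c : D \<Rightarrow> X\<close> to a colimit cocone in the category
  of small sets. The universal property is spelled out with the sets \<open>hom(A, D j)\<close> on the type of
  arrows and the test sets \<open>T\<close> on \<open>'u\<close>, so that \<open>T\<close> ranges over all small sets up to bijection.
  A map out of \<open>hom(A, X)\<close> is an extensional function.
\<close>

definition hom_preserves_colimit ::
  "'u itself \<Rightarrow> ('o, 'm, 'x) cat_scheme \<Rightarrow> 'o \<Rightarrow> ('i, 'j, 'y) cat_scheme \<Rightarrow>
   ('i, 'j, 'o, 'm) functor_data \<Rightarrow> 'o \<Rightarrow> ('i \<Rightarrow> 'm) \<Rightarrow> bool" where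
  "hom_preserves_colimit U C A J D X c \<longleftrightarrow>
     (\<forall>(T :: 'u set) t. small U T \<and>
        (\<forall>j \<in> Obj J. t j \<in> hom C A (fobj D j) \<rightarrow> T) \<and>
        (\<forall>a \<in> Arr J. \<forall>g \<in> hom C A (fobj D (Dom J a)).
           t (Cod J a) (Comp C (farr D a) g) = t (Dom J a) g) \<longrightarrow>
        (\<exists>!h. h \<in> hom C A X \<rightarrow>\<^sub>E T \<and>
           (\<forall>j \<in> Obj J. \<forall>g \<in> hom C A (fobj D j). h (Comp C (c j) g) = t j g)))"

definition presentable :: "'u rel \<Rightarrow> ('o, 'm, 'x) cat_scheme \<Rightarrow> 'o \<Rightarrow> bool" where
  "presentable \<kappa> C A \<longleftrightarrow> A \<in> Obj C \<and>
     (\<forall>(J :: ('u, 'u) cat) D X c.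
        filtered \<kappa> J \<and> is_functor J C D \<and> is_colimit C J D X c \<longrightarrow>
        hom_preserves_colimit TYPE('u) C A J D X c)"

definition locally_presentable_at :: "'u rel \<Rightarrow> ('o, 'm, 'x) cat_scheme \<Rightarrow> bool" where
  "locally_presentable_at \<kappa> C \<longleftrightarrow>
     regular_cardinal \<kappa> \<and> locally_small_category TYPE('u) C \<and> cocomplete TYPE('u) C \<and>
     (\<exists>\<A> \<subseteq> Obj C. small TYPE('u) \<A> \<and> (\<forall>A \<in> \<A>. presentable \<kappa> C A) \<and>
        (\<forall>X \<in> Obj C. \<exists>(J :: ('u, 'u) cat) D c.
           filtered \<kappa> J \<and> is_functor J C D \<and> fobj D ` Obj J \<subseteq> \<A> \<and> is_colimit C J D X c))"

definition locally_presentable :: "'u itself \<Rightarrow> ('o, 'm, 'x) cat_scheme \<Rightarrow> bool" where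
  "locally_presentable U C \<longleftrightarrow> (\<exists>\<kappa> :: 'u rel. locally_presentable_at \<kappa> C)"


section \<open>Model categories\<close>

record ('o, 'm) model_cat = "('o, 'm) cat" +
  weq :: "'m set"
  cof :: "'m set"
  fib :: "'m set"

definition op_model :: "('o, 'm, 'x) model_cat_scheme \<Rightarrow> ('o, 'm, 'x) model_cat_scheme" where
  "op_model K = (op_cat K)\<lparr>cof := fib K, fib := cof K\<rparr>"

definition lifts :: "('o, 'm, 'x) cat_scheme \<Rightarrow> 'm \<Rightarrow> 'm \<Rightarrow> bool" where
  "lifts C i p \<longleftrightarrow>
     (\<forall>u v. u \<in> hom C (Dom C i) (Dom C p) \<and> v \<in> hom C (Cod C i) (Cod C p) \<and>
        Comp C p u = Comp C v i \<longrightarrow>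
        (\<exists>d \<in> hom C (Cod C i) (Dom C p). Comp C d i = u \<and> Comp C p d = v))"

definition is_retract :: "('o, 'm, 'x) cat_scheme \<Rightarrow> 'm \<Rightarrow> 'm \<Rightarrow> bool" where
  "is_retract C f g \<longleftrightarrow>
     (\<exists>i \<in> hom C (Dom C f) (Dom C g). \<exists>r \<in> hom C (Dom C g) (Dom C f).
      \<exists>j \<in> hom C (Cod C f) (Cod C g). \<exists>s \<in> hom C (Cod C g) (Cod C f).
        Comp C r i = Ident C (Dom C f) \<and> Comp C s j = Ident C (Cod C f) \<and>
        Comp C g i = Comp C j f \<and> Comp C f r = Comp C s g)"

definition retract_closed :: "('o, 'm, 'x) cat_scheme \<Rightarrow> 'm set \<Rightarrow> bool" where
  "retract_closed C W \<longleftrightarrow> (\<forall>f \<in> Arr C. \<forall>g \<in> W. is_retract C f g \<longrightarrow> f \<in> W)"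

definition two_of_three :: "('o, 'm, 'x) cat_scheme \<Rightarrow> 'm set \<Rightarrow> bool" where
  "two_of_three C W \<longleftrightarrow>
     (\<forall>f \<in> Arr C. \<forall>g \<in> Arr C. Dom C g = Cod C f \<longrightarrow>
        (f \<in> W \<and> g \<in> W \<longrightarrow> Comp C g f \<in> W) \<and>
        (f \<in> W \<and> Comp C g f \<in> W \<longrightarrow> g \<in> W) \<and>
        (g \<in> W \<and> Comp C g f \<in> W \<longrightarrow> f \<in> W))"

definition factorizes :: "('o, 'm, 'x) cat_scheme \<Rightarrow> 'm set \<Rightarrow> 'm set \<Rightarrow> bool" where
  "factorizes C L R \<longleftrightarrow>
     (\<forall>f \<in> Arr C. \<exists>i \<in> L. \<exists>p \<in> R. Dom C i = Dom C f \<and> Cod C i = Dom C p \<and>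
        Cod C p = Cod C f \<and> Comp C p i = f)"

definition model_category :: "'u itself \<Rightarrow> ('o, 'm, 'x) model_cat_scheme \<Rightarrow> bool" where
  "model_category U K \<longleftrightarrow>
     locally_small_category U K \<and> complete U K \<and> cocomplete U K \<and>
     weq K \<subseteq> Arr K \<and> cof K \<subseteq> Arr K \<and> fib K \<subseteq> Arr K \<and>
     two_of_three K (weq K) \<and>
     retract_closed K (weq K) \<and> retract_closed K (cof K) \<and> retract_closed K (fib K) \<and>
     (\<forall>i \<in> cof K \<inter> weq K. \<forall>p \<in> fib K. lifts K i p) \<and>
     (\<forall>i \<in> cof K. \<forall>p \<in> fib K \<inter> weq K. lifts K i p) \<and>
     factorizes K (cof K \<inter> weq K) (fib K) \<and> factorizes K (cof K) (fib K \<inter> weq K)"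

definition cofibrant :: "('o, 'm, 'x) model_cat_scheme \<Rightarrow> 'o \<Rightarrow> bool" where
  "cofibrant K X \<longleftrightarrow> X \<in> Obj K \<and> (\<exists>Z. initial K Z \<and> (\<exists>f \<in> hom K Z X. f \<in> cof K))"

definition fibrant :: "('o, 'm, 'x) model_cat_scheme \<Rightarrow> 'o \<Rightarrow> bool" where
  "fibrant K X \<longleftrightarrow> X \<in> Obj K \<and> (\<exists>Z. terminal K Z \<and> (\<exists>f \<in> hom K X Z. f \<in> fib K))"

definition fibrant_replacement ::
  "('o, 'm, 'x) model_cat_scheme \<Rightarrow> ('o, 'm, 'o, 'm) functor_data \<Rightarrow> bool" where
  "fibrant_replacement K R \<longleftrightarrow> is_functor K K R \<and> (\<forall>X \<in> Obj K. fibrant K (fobj R X)) \<and>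
     (\<exists>\<eta>. (\<forall>X \<in> Obj K. \<eta> X \<in> hom K X (fobj R X) \<inter> cof K \<inter> weq K) \<and>
        (\<forall>f \<in> Arr K. Comp K (farr R f) (\<eta> (Dom K f)) = Comp K (\<eta> (Cod K f)) f))"

definition cofibrant_replacement ::
  "('o, 'm, 'x) model_cat_scheme \<Rightarrow> ('o, 'm, 'o, 'm) functor_data \<Rightarrow> bool" where
  "cofibrant_replacement K R \<longleftrightarrow> is_functor K K R \<and> (\<forall>X \<in> Obj K. cofibrant K (fobj R X)) \<and>
     (\<exists>\<epsilon>. (\<forall>X \<in> Obj K. \<epsilon> X \<in> hom K (fobj R X) X \<inter> fib K \<inter> weq K) \<and>
        (\<forall>f \<in> Arr K. Comp K (\<epsilon> (Cod K f)) (farr R f) = Comp K f (\<epsilon> (Dom K f))))"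


section \<open>The homotopy category\<close>

text \<open>
  A left homotopy is a map \<open>H\<close> out of a cylinder object \<open>Z\<close>, that is, a factorization of the fold map
  \<open>P = X + X \<rightarrow> X\<close> into a cofibration \<open>i : P \<rightarrow> Z\<close> and a weak equivalence \<open>s : Z \<rightarrow> X\<close>.
\<close>

definition left_homotopic :: "('o, 'm, 'x) model_cat_scheme \<Rightarrow> 'm \<Rightarrow> 'm \<Rightarrow> bool" where
  "left_homotopic K f g \<longleftrightarrow>
     f \<in> Arr K \<and> g \<in> Arr K \<and> Dom K f = Dom K g \<and> Cod K f = Cod K g \<and>
     (\<exists>P \<iota> Z i s H.
        is_coproduct K (UNIV :: bool set) (\<lambda>_. Dom K f) P \<iota> \<and>
        i \<in> hom K P Z \<inter> cof K \<and> s \<in> hom K Z (Dom K f) \<inter> weq K \<and>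
        (\<forall>b. Comp K (Comp K s i) (\<iota> b) = Ident K (Dom K f)) \<and>
        H \<in> hom K Z (Cod K f) \<and>
        Comp K (Comp K H i) (\<iota> False) = f \<and> Comp K (Comp K H i) (\<iota> True) = g)"

definition right_homotopic :: "('o, 'm, 'x) model_cat_scheme \<Rightarrow> 'm \<Rightarrow> 'm \<Rightarrow> bool" where
  "right_homotopic K f g \<longleftrightarrow> left_homotopic (op_model K) f g"

definition homotopic :: "('o, 'm, 'x) model_cat_scheme \<Rightarrow> 'm \<Rightarrow> 'm \<Rightarrow> bool" where
  "homotopic K f g \<longleftrightarrow> left_homotopic K f g \<and> right_homotopic K f g"

definition homotopy_class :: "('o, 'm, 'x) model_cat_scheme \<Rightarrow> 'm \<Rightarrow> 'm set" where
  "homotopy_class K f = {g. homotopic K f g}"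

text \<open>The structure maps of the quotient are defined by choosing representatives.\<close>

definition Ho :: "('o, 'm, 'x) model_cat_scheme \<Rightarrow> ('o, 'm set) cat" where
  "Ho K = \<lparr>
     Obj = {X. cofibrant K X \<and> fibrant K X},
     Arr = {homotopy_class K f | f. f \<in> Arr K \<and>
              cofibrant K (Dom K f) \<and> fibrant K (Dom K f) \<and>
              cofibrant K (Cod K f) \<and> fibrant K (Cod K f)},
     Dom = (\<lambda>F. Dom K (SOME f. f \<in> F)),
     Cod = (\<lambda>F. Cod K (SOME f. f \<in> F)),
     Ident = (\<lambda>X. homotopy_class K (Ident K X)),
     Comp = (\<lambda>G F. homotopy_class K (Comp K (SOME g. g \<in> G) (SOME f. f \<in> F)))\<rparr>"


section \<open>Cofibrantly generated and combinatorial model categories\<close>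

text \<open>
  Transfinite sequences are indexed by well-orders \<open>r\<close> with small field, regarded as posets.
\<close>

definition poset_cat :: "'u rel \<Rightarrow> ('u, 'u \<times> 'u) cat" where
  "poset_cat r = \<lparr>Obj = Field r, Arr = r, Dom = fst, Cod = snd,
     Ident = (\<lambda>x. (x, x)), Comp = (\<lambda>g f. (fst f, snd g))\<rparr>"

definition limit_element :: "'u rel \<Rightarrow> 'u \<Rightarrow> bool" where
  "limit_element r b \<longleftrightarrow> b \<in> Field r \<and> underS r b \<noteq> {} \<and>
     (\<forall>a \<in> underS r b. \<exists>a' \<in> underS r b. a \<in> underS r a')"

definition successor_element :: "'u rel \<Rightarrow> 'u \<Rightarrow> 'u \<Rightarrow> bool" where
  "successor_element r a b \<longleftrightarrow> a \<in> underS r b \<and> \<not> (\<exists>x. a \<in> underS r x \<and> x \<in> underS r b)"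

definition is_sequence ::
  "('o, 'm, 'x) cat_scheme \<Rightarrow> 'm set \<Rightarrow> 'u rel \<Rightarrow> ('u, 'u \<times> 'u, 'o, 'm) functor_data \<Rightarrow> bool"
  where
  "is_sequence C \<D> r D \<longleftrightarrow> Well_order r \<and> small TYPE('u) (Field r) \<and>
     is_functor (poset_cat r) C D \<and>
     (\<forall>a b. successor_element r a b \<longrightarrow> farr D (a, b) \<in> \<D>) \<and>
     (\<forall>b. limit_element r b \<longrightarrow>
        is_colimit C (poset_cat (Restr r (underS r b))) D (fobj D b) (\<lambda>a. farr D (a, b)))"

definition rel_cell :: "'u itself \<Rightarrow> ('o, 'm, 'x) cat_scheme \<Rightarrow> 'm set \<Rightarrow> 'm set" where
  "rel_cell U C I =
     {f. \<exists>(r :: 'u rel) D X c z.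
        is_sequence C {h. \<exists>e \<in> I. \<exists>g g'. is_pushout C e g h g'} r D \<and>
        is_colimit C (poset_cat r) D X c \<and>
        z \<in> Field r \<and> (\<forall>b \<in> Field r. (z, b) \<in> r) \<and> f = c z}"

definition small_relative ::
  "'u itself \<Rightarrow> ('o, 'm, 'x) cat_scheme \<Rightarrow> 'm set \<Rightarrow> 'o \<Rightarrow> bool" where
  "small_relative U C \<D> A \<longleftrightarrow>
     (\<exists>\<kappa> :: 'u rel. Card_order \<kappa> \<and> small U (Field \<kappa>) \<and>
        (\<forall>(\<mu> :: 'u rel) D X c. regular_cardinal \<mu> \<and> \<kappa> \<le>o \<mu> \<and> is_sequence C \<D> \<mu> D \<and>
           is_colimit C (poset_cat \<mu>) D X c \<longrightarrow>
           hom_preserves_colimit U C A (poset_cat \<mu>) D X c))"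

definition permits_small_object_argument ::
  "'u itself \<Rightarrow> ('o, 'm, 'x) cat_scheme \<Rightarrow> 'm set \<Rightarrow> bool" where
  "permits_small_object_argument U C I \<longleftrightarrow>
     (\<forall>f \<in> I. small_relative U C (rel_cell U C I) (Dom C f))"

definition right_lifting_class :: "('o, 'm, 'x) cat_scheme \<Rightarrow> 'm set \<Rightarrow> 'm set" where
  "right_lifting_class C I = {p \<in> Arr C. \<forall>i \<in> I. lifts C i p}"

definition cofibrantly_generated :: "'u itself \<Rightarrow> ('o, 'm, 'x) model_cat_scheme \<Rightarrow> bool" where
  "cofibrantly_generated U K \<longleftrightarrow>
     (\<exists>I J. I \<subseteq> Arr K \<and> J \<subseteq> Arr K \<and> small U I \<and> small U J \<and>
        permits_small_object_argument U K I \<and> permits_small_object_argument U K J \<and>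
        fib K = right_lifting_class K J \<and> fib K \<inter> weq K = right_lifting_class K I)"

definition combinatorial :: "'u itself \<Rightarrow> ('o, 'm, 'x) model_cat_scheme \<Rightarrow> bool" where
  "combinatorial U K \<longleftrightarrow>
     model_category U K \<and> cofibrantly_generated U K \<and> locally_presentable U K"

text \<open>A full subcategory is identified with its set of objects.\<close>

definition weak_generator :: "'u itself \<Rightarrow> ('o, 'm, 'x) cat_scheme \<Rightarrow> 'o set \<Rightarrow> bool" where
  "weak_generator U C \<A> \<longleftrightarrow> \<A> \<subseteq> Obj C \<and> small U \<A> \<and>
     (\<forall>X \<in> Obj C. (\<forall>A \<in> \<A>. \<exists>!f. f \<in> hom C A X) \<longrightarrow> terminal C X)"

definition strongly_combinatorial :: "'u rel \<Rightarrow> ('o, 'm, 'x) model_cat_scheme \<Rightarrow> bool" where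
  "strongly_combinatorial \<kappa> K \<longleftrightarrow>
     combinatorial TYPE('u) K \<and>
     locally_presentable_at \<kappa> K \<and>
     (\<exists>\<A>. weak_generator TYPE('u) (Ho K) \<A> \<and> (\<forall>A \<in> \<A>. presentable \<kappa> K A)) \<and>
     (\<exists>R\<^sub>f R\<^sub>c. fibrant_replacement K R\<^sub>f \<and> cofibrant_replacement K R\<^sub>c \<and>
        preserves_filtered_colimits \<kappa> K K R\<^sub>f \<and> preserves_filtered_colimits \<kappa> K K R\<^sub>c \<and>
        (\<forall>A. presentable \<kappa> K A \<longrightarrow>
           presentable \<kappa> K (fobj R\<^sub>f A) \<and> presentable \<kappa> K (fobj R\<^sub>c A)))"


section \<open>Well generated categories\<close>

definition small_object :: "'u rel \<Rightarrow> ('o, 'm, 'x) cat_scheme \<Rightarrow> 'o \<Rightarrow> bool" where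
  "small_object \<kappa> C S \<longleftrightarrow> S \<in> Obj C \<and>
     (\<forall>(I :: 'u set) X P \<iota> f. small TYPE('u) I \<and> (\<forall>i \<in> I. X i \<in> Obj C) \<and>
        is_coproduct C I X P \<iota> \<and> f \<in> hom C S P \<longrightarrow>
        (\<exists>J \<subseteq> I. |J| <o \<kappa> \<and>
           (\<exists>Q \<iota>' s g. is_coproduct C J X Q \<iota>' \<and> s \<in> hom C Q P \<and>
              (\<forall>j \<in> J. Comp C s (\<iota>' j) = \<iota> j) \<and> g \<in> hom C S Q \<and> f = Comp C s g)))"

text \<open>The classes of which the class of compact objects is the greatest.\<close>

definition compact_class :: "'u rel \<Rightarrow> ('o, 'm, 'x) cat_scheme \<Rightarrow> 'o set \<Rightarrow> bool" where
  "compact_class \<kappa> C \<S> \<longleftrightarrow> (\<forall>S \<in> \<S>. small_object \<kappa> C S) \<and>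
     (\<forall>S \<in> \<S>. \<forall>(I :: 'u set) X P \<iota> f. small TYPE('u) I \<and> (\<forall>i \<in> I. X i \<in> Obj C) \<and>
        is_coproduct C I X P \<iota> \<and> f \<in> hom C S P \<longrightarrow>
        (\<exists>T g. (\<forall>i \<in> I. T i \<in> \<S> \<and> g i \<in> hom C (T i) (X i)) \<and>
           (\<exists>Q \<iota>' m h. is_coproduct C I T Q \<iota>' \<and> m \<in> hom C Q P \<and>
              (\<forall>i \<in> I. Comp C m (\<iota>' i) = Comp C (\<iota> i) (g i)) \<and>
              h \<in> hom C S Q \<and> f = Comp C m h)))"

definition compact_objects :: "'u rel \<Rightarrow> ('o, 'm, 'x) cat_scheme \<Rightarrow> 'o set" where
  "compact_objects \<kappa> C = \<Union> {\<S>. compact_class \<kappa> C \<S>}"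

lemma compact_class_compact_objects:
  fixes \<kappa> :: "'u rel"
  shows "compact_class \<kappa> C (compact_objects \<kappa> C)"
  unfolding compact_class_def[of \<kappa> C "compact_objects \<kappa> C"]
proof (intro conjI ballI allI impI)
  fix S assume "S \<in> compact_objects \<kappa> C"
  then obtain \<S> where \<S>: "compact_class \<kappa> C \<S>" "S \<in> \<S>"
    unfolding compact_objects_def by blast
  show "small_object \<kappa> C S"
    by (rule bspec[OF conjunct1[OF \<S>(1)[unfolded compact_class_def]] \<S>(2)])
next
  fix S X P \<iota> f and I :: "'u set"
  assume "S \<in> compact_objects \<kappa> C"
  then obtain \<S> where \<S>: "compact_class \<kappa> C \<S>" "S \<in> \<S>"
    unfolding compact_objects_def by blast
  assume A: "small TYPE('u) I \<and> (\<forall>i \<in> I. X i \<in> Obj C) \<and> is_coproduct C I X P \<iota> \<and> f \<in> hom C S P"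
  have sub: "\<S> \<subseteq> compact_objects \<kappa> C"
    using \<S>(1) unfolding compact_objects_def by blast
  note B = conjunct2[OF \<S>(1)[unfolded compact_class_def], THEN bspec, OF \<S>(2),
    THEN spec, THEN spec, THEN spec, THEN spec, THEN spec, THEN mp, OF A]
  then obtain T g where T: "\<forall>i \<in> I. T i \<in> \<S> \<and> g i \<in> hom C (T i) (X i)" and
    Q: "\<exists>Q \<iota>' m h. is_coproduct C I T Q \<iota>' \<and> m \<in> hom C Q P \<and>
          (\<forall>i \<in> I. Comp C m (\<iota>' i) = Comp C (\<iota> i) (g i)) \<and> h \<in> hom C S Q \<and> f = Comp C m h"
    by - (erule exE, erule exE, erule conjE, rule that, assumption+)
  have T': "\<forall>i \<in> I. T i \<in> compact_objects \<kappa> C \<and> g i \<in> hom C (T i) (X i)"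
    using T sub by blast
  show "\<exists>T g. (\<forall>i \<in> I. T i \<in> compact_objects \<kappa> C \<and> g i \<in> hom C (T i) (X i)) \<and>
    (\<exists>Q \<iota>' m h. is_coproduct C I T Q \<iota>' \<and> m \<in> hom C Q P \<and>
          (\<forall>i \<in> I. Comp C m (\<iota>' i) = Comp C (\<iota> i) (g i)) \<and> h \<in> hom C S Q \<and> f = Comp C m h)"
    by (rule exI[of _ T], rule exI[of _ g], rule conjI[OF T' Q])
qed

lemma compact_objects_greatest:
  "compact_class \<kappa> C \<S> \<Longrightarrow> \<S> \<subseteq> compact_objects \<kappa> C"
  by (auto simp: compact_objects_def)

definition well_generated :: "'u rel \<Rightarrow> ('o, 'm, 'x) cat_scheme \<Rightarrow> bool" where
  "well_generated \<kappa> C \<longleftrightarrow>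
     locally_small_category TYPE('u) C \<and> has_coproducts TYPE('u) C \<and>
     (\<exists>\<A>. weak_generator TYPE('u) C \<A> \<and> \<A> \<subseteq> compact_objects \<kappa> C)"

end

(*
  A left homotopy from f to g and a right homotopy from g to h combine by a single lift of the
  inclusion of one end of the cylinder, an acyclic cofibration, against the path fibration to a right
  homotopy from f to h. This gives at once the equality of left and right homotopy between bifibrant
  objects and transitivity, without gluing cylinders. A coproduct in Ho K of bifibrant objects X_i is
  R_f applied to their coproduct in K; uniqueness holds because right homotopies into a fixed path
  object assemble over a coproduct and extend along the acyclic cofibration into R_f.

  The compact class consists of the bifibrant objects that are presentable in K. A map from such an S
  to R_f(coprod X_i) factors through R_f(coprod over J of X_j) with J of size less than the cardinal,
  since the latter form a filtered diagram that R_f preserves. For the second condition, coprod R_c X_i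
  is the colimit, over the product of the filtered diagrams of presentable objects A_(i,j) with
  colimits X_i, of the coproducts of the R_c A_(i,j_i); so S maps to one of these, and the
  S_i = R_f R_c A_(i,j_i) are again bifibrant and presentable.
*)

theory Submission
  imports Defs
begin

section \<open>Categories\<close>

text \<open>Homotopy is kept away from the size arguments: every factorization claimed in Ho K is
  first obtained as an equality of arrows of K between values of R_f, and homotopy classes are taken
  last. The two halves of bifibrancy of the X_i have separate uses in this. Cofibrancy gives
  sections of R_c X_i -> X_i, so that coprod X_i is a strict retract of coprod R_c X_i; fibrancy
  lets arrows R_c A_(i,j_i) -> X_i extend to R_f R_c A_(i,j_i). R_c is applied because presentable
  objects need not be cofibrant, and R_f because the S_i have to be objects of Ho K. Two further
  obstacles shape the text. Presentability speaks only of index categories on the universe type,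
  whereas subsets of an index set and tuples of indices live on other types; hence the relabelling
  of categories. And the homotopies on all summands of a coproduct must share one path object, so
  homotopies are always produced in a path object fixed beforehand.\<close>

lemma homI: "f \<in> Arr C \<Longrightarrow> Dom C f = X \<Longrightarrow> Cod C f = Y \<Longrightarrow> f \<in> hom C X Y"
  by (simp add: hom_def)

lemma homD:
  assumes "f \<in> hom C X Y"
  shows "f \<in> Arr C" "Dom C f = X" "Cod C f = Y"
  using assms by (simp_all add: hom_def)

context category
begin

lemma comp_arr:
  assumes "f \<in> Arr C" "g \<in> Arr C" "Dom C g = Cod C f"
  shows "Comp C g f \<in> Arr C" "Dom C (Comp C g f) = Dom C f" "Cod C (Comp C g f) = Cod C g"
  using comp[of f "Dom C f" "Cod C f" g "Cod C g"] assms by (simp_all add: hom_def)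

lemma comp_assoc:
  assumes "f \<in> Arr C" "g \<in> Arr C" "h \<in> Arr C" "Dom C g = Cod C f" "Dom C h = Cod C g"
  shows "Comp C (Comp C h g) f = Comp C h (Comp C g f)"
  using assoc[of f "Dom C f" "Cod C f" g "Cod C g" h "Cod C h"] assms by (simp add: hom_def)

lemma ident_arr:
  assumes "X \<in> Obj C"
  shows "Ident C X \<in> Arr C" "Dom C (Ident C X) = X" "Cod C (Ident C X) = X"
  using ident[OF assms] by (simp_all add: hom_def)

lemma comp_ident_left: "f \<in> Arr C \<Longrightarrow> Cod C f = Y \<Longrightarrow> Comp C (Ident C Y) f = f"
  by (rule ident_left[of _ "Dom C f"]) (simp add: hom_def)

lemma comp_ident_right: "f \<in> Arr C \<Longrightarrow> Dom C f = Y \<Longrightarrow> Comp C f (Ident C Y) = f"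
  by (rule ident_right[of _ _ "Cod C f"]) (simp add: hom_def)

lemmas cat_simps = comp_arr comp_assoc ident_arr comp_ident_left comp_ident_right dom_obj cod_obj

lemma hom_obj: "f \<in> hom C X Y \<Longrightarrow> X \<in> Obj C" "f \<in> hom C X Y \<Longrightarrow> Y \<in> Obj C"
  using dom_obj cod_obj by (auto simp: hom_def)

end

section \<open>Duality: the opposite category and the opposite model category\<close>

lemma category_op: "category C \<Longrightarrow> category (op_cat C)"
  by (auto simp: category_def op_cat_def hom_def)

lemma op_op: "op_model (op_model K) = K"
  by (cases K) (simp add: op_model_def op_cat_def)

lemma op_model_simps [simp]:
  "Obj (op_model K) = Obj K" "Arr (op_model K) = Arr K" "Dom (op_model K) = Cod K"
  "Cod (op_model K) = Dom K" "Ident (op_model K) = Ident K"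
  "Comp (op_model K) g f = Comp K f g" "weq (op_model K) = weq K"
  "cof (op_model K) = fib K" "fib (op_model K) = cof K"
  by (simp_all add: op_model_def op_cat_def)

lemma hom_op [simp]: "hom (op_model K) X Y = hom K Y X"
  by (auto simp: hom_def)

lemma op_cat_simps:
  "Obj (op_cat K) = Obj K" "Arr (op_cat K) = Arr K" "Dom (op_cat K) = Cod K"
  "Cod (op_cat K) = Dom K" "Ident (op_cat K) = Ident K" "Comp (op_cat K) g f = Comp K f g"
  "hom (op_cat K) X Y = hom K Y X"
  by (auto simp: op_cat_def hom_def)

lemma initial_op: "initial (op_model K) X = terminal K X" "terminal (op_model K) X = initial K X"
  by (simp_all add: initial_def terminal_def)

lemma cofibrant_op: "cofibrant (op_model K) X = fibrant K X" "fibrant (op_model K) X = cofibrant K X"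
  by (simp_all add: cofibrant_def fibrant_def initial_op)

lemma lifts_op: "lifts (op_model K) i p = lifts K p i"
  unfolding lifts_def by (auto; metis)

lemma factorizes_op: "factorizes (op_model K) L R = factorizes K R L"
  unfolding factorizes_def by (auto; metis)

lemma two_of_three_op: "two_of_three (op_model K) W = two_of_three K W"
  unfolding two_of_three_def by (auto; metis)

lemma is_retract_op: "is_retract (op_model K) f g = is_retract K f g"
  unfolding is_retract_def by (auto; metis)

lemma retract_closed_op: "retract_closed (op_model K) W = retract_closed K W"
  by (simp add: retract_closed_def is_retract_op)

lemma left_homotopic_op: "left_homotopic (op_model K) f g = right_homotopic K f g"
  "right_homotopic (op_model K) f g = left_homotopic K f g"
  by (simp_all add: right_homotopic_def op_op)

lemma homotopic_op: "homotopic (op_model K) f g = homotopic K f g"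
  by (auto simp: homotopic_def left_homotopic_op)


section \<open>Coproducts\<close>

definition discrete_cat :: "'u set \<Rightarrow> ('u, 'u) cat" where
  "discrete_cat I = \<lparr>Obj = I, Arr = I, Dom = id, Cod = id, Ident = id, Comp = (\<lambda>g f. g)\<rparr>"

lemma category_discrete: "category (discrete_cat I)"
  by (auto simp: category_def discrete_cat_def hom_def)

text \<open>A cocone on a discrete diagram is just a family of arrows: compatibility with an
  identity arrow is the unit law.\<close>

lemma cocomplete_coproduct:
  assumes C: "category C" and cc: "cocomplete TYPE('u) C"
    and I: "small TYPE('u) (I :: 'u set)" and X: "\<And>i. i \<in> I \<Longrightarrow> X i \<in> Obj C"
  shows "\<exists>P \<iota>. is_coproduct C I X P \<iota>"
proof -
  interpret category C by (rule C)
  define D where "D = \<lparr>fobj = X, farr = \<lambda>i. Ident C (X i)\<rparr>"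
  have D: "is_functor (discrete_cat I) C D"
    using X C category_discrete ident
    by (auto simp: is_functor_def D_def discrete_cat_def ident_arr comp_ident_left)
  have "small_category TYPE('u) (discrete_cat I)"
    using I category_discrete by (auto simp: small_category_def discrete_cat_def)
  then obtain P c where "is_colimit C (discrete_cat I) D P c"
    using cc D unfolding cocomplete_def by blast
  moreover have "is_cocone C (discrete_cat I) D Y f \<longleftrightarrow>
      Y \<in> Obj C \<and> (\<forall>i \<in> I. f i \<in> hom C (X i) Y)" for Y f
    using ident_right X by (auto simp: is_cocone_def discrete_cat_def D_def)
  ultimately show ?thesis
    unfolding is_coproduct_def is_colimit_def
    by (intro exI[of _ P] exI[of _ c]) (auto simp: discrete_cat_def)
qed

lemma coproduct_ex1:
  assumes "is_coproduct C I X P \<iota>" "Y \<in> Obj C" "\<And>i. i \<in> I \<Longrightarrow> f i \<in> hom C (X i) Y"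
  shows "\<exists>!h. h \<in> hom C P Y \<and> (\<forall>i \<in> I. Comp C h (\<iota> i) = f i)"
  using assms unfolding is_coproduct_def by blast

lemma coproduct_obj: "is_coproduct C I X P \<iota> \<Longrightarrow> P \<in> Obj C"
  by (simp add: is_coproduct_def)

lemma coproduct_inj: "is_coproduct C I X P \<iota> \<Longrightarrow> i \<in> I \<Longrightarrow> \<iota> i \<in> hom C (X i) P"
  by (simp add: is_coproduct_def)

lemma coproduct_desc:
  assumes "is_coproduct C I X P \<iota>" "Y \<in> Obj C" "\<And>i. i \<in> I \<Longrightarrow> f i \<in> hom C (X i) Y"
  obtains h where "h \<in> hom C P Y" "\<And>i. i \<in> I \<Longrightarrow> Comp C h (\<iota> i) = f i"
  using coproduct_ex1[OF assms] by blast

lemma (in category) coproduct_eq: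
  assumes P: "is_coproduct C I X P \<iota>" and "h \<in> hom C P Y" "h' \<in> hom C P Y"
    "\<And>i. i \<in> I \<Longrightarrow> Comp C h (\<iota> i) = Comp C h' (\<iota> i)"
  shows "h = h'"
proof -
  have "\<exists>!k. k \<in> hom C P Y \<and> (\<forall>i \<in> I. Comp C k (\<iota> i) = Comp C h (\<iota> i))"
    using assms(2) by (intro coproduct_ex1[OF P])
      (auto intro: hom_obj comp coproduct_inj[OF P])
  then show ?thesis using assms by metis
qed

text \<open>Used for two changes of index set: from a two-element subset of the universe to
  \<open>bool\<close>, and the swap of the two ends of a cylinder.\<close>

lemma coproduct_reindex:
  assumes P: "is_coproduct C I (\<lambda>_. X) P \<iota>" and b: "bij_betw b J I"
  shows "is_coproduct C J (\<lambda>_. X) P (\<iota> \<circ> b)"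
  unfolding is_coproduct_def
proof (intro conjI allI impI ballI)
  have bI: "b i \<in> I" if "i \<in> J" for i using b that by (auto simp: bij_betw_def)
  show "P \<in> Obj C" using P by (rule coproduct_obj)
  show "(\<iota> \<circ> b) i \<in> hom C X P" if "i \<in> J" for i
    using coproduct_inj[OF P bI[OF that]] by simp
  fix Y f assume f: "Y \<in> Obj C \<and> (\<forall>i \<in> J. f i \<in> hom C X Y)"
  define f' where "f' = f \<circ> inv_into J b"
  have f': "f' i \<in> hom C X Y" if "i \<in> I" for i
    using f b that inv_into_into[of i b J] unfolding f'_def bij_betw_def by auto
  have eq: "(\<forall>i \<in> I. Comp C h (\<iota> i) = f' i) \<longleftrightarrow> (\<forall>i \<in> J. Comp C h ((\<iota> \<circ> b) i) = f i)" for h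
    using b by (auto simp: f'_def bij_betw_def)
  show "\<exists>!h. h \<in> hom C P Y \<and> (\<forall>i \<in> J. Comp C h ((\<iota> \<circ> b) i) = f i)"
    using coproduct_ex1[OF P, of Y f'] f f' unfolding eq by blast
qed

lemma coproduct_empty_initial: "is_coproduct C {} X P \<iota> \<Longrightarrow> initial C P"
  by (auto simp: is_coproduct_def initial_def)

lemma is_coproduct_op_model: "is_coproduct (op_model K) I X P \<iota> = is_coproduct (op_cat K) I X P \<iota>"
  by (simp add: is_coproduct_def op_cat_simps)

lemma initial_op_model: "initial (op_model K) P = initial (op_cat K) P"
  by (simp add: initial_def op_cat_simps)

lemma inaccessible_infinite: "inaccessible_universe TYPE('u) \<Longrightarrow> infinite (UNIV :: 'u set)"
  using card_of_ordIso_finite_Field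
  by (metis inaccessible_universe_def infinite_iff_natLeq_ordLeq ordLess_imp_ordLeq)

lemma small_finite:
  assumes "inaccessible_universe TYPE('u)" "finite A"
  shows "small TYPE('u) A"
  unfolding small_def using inaccessible_infinite[OF assms(1)] assms(2)
  by (intro finite_ordLess_infinite) (auto simp: card_of_well_order_on Field_card_of)

section \<open>Model categories\<close>

text \<open>
  A self-dual set of axioms, strong enough for the construction of the homotopy category: instead
  of all small limits and colimits it only asks for the ones that occur in homotopies.
\<close>

locale homotopical = category K for K :: "('o, 'm, 'x) model_cat_scheme" +
  assumes weq_arr: "weq K \<subseteq> Arr K" and cof_arr: "cof K \<subseteq> Arr K" and fib_arr: "fib K \<subseteq> Arr K"
    and two_of_three: "two_of_three K (weq K)"
    and retract_cof: "retract_closed K (cof K)" and retract_fib: "retract_closed K (fib K)"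
    and lift_acyclic_cof: "i \<in> cof K \<inter> weq K \<Longrightarrow> p \<in> fib K \<Longrightarrow> lifts K i p"
    and lift_acyclic_fib: "i \<in> cof K \<Longrightarrow> p \<in> fib K \<inter> weq K \<Longrightarrow> lifts K i p"
    and factorizes_acyclic_cof: "factorizes K (cof K \<inter> weq K) (fib K)"
    and factorizes_acyclic_fib: "factorizes K (cof K) (fib K \<inter> weq K)"
    and ex_initial: "\<exists>Z. initial K Z" and ex_terminal: "\<exists>Z. terminal K Z"
    and ex_copower: "X \<in> Obj K \<Longrightarrow> \<exists>P \<iota>. is_coproduct K (UNIV :: bool set) (\<lambda>_. X) P \<iota>"
    and ex_power: "X \<in> Obj K \<Longrightarrow>
      \<exists>P \<pi>. is_coproduct (op_model K) (UNIV :: bool set) (\<lambda>_. X) P \<pi>"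

lemma category_op_model: "category K \<Longrightarrow> category (op_model K)"
  unfolding category_def by (simp add: hom_def)

text \<open>Makes each result proved in \<open>homotopical\<close> available for
  \<open>op_model K\<close>, with cylinders read as path objects and cofibrant read as
  fibrant.\<close>

lemma homotopical_op:
  assumes "homotopical K"
  shows "homotopical (op_model K)"
proof -
  interpret homotopical K by (rule assms)
  show ?thesis
    using weq_arr cof_arr fib_arr two_of_three retract_cof retract_fib lift_acyclic_cof
      lift_acyclic_fib factorizes_acyclic_cof factorizes_acyclic_fib ex_initial ex_terminal
      ex_copower ex_power
    by (intro homotopical.intro homotopical_axioms.intro category_op_model category_axioms)
      (simp_all add: op_op two_of_three_op retract_closed_op lifts_op factorizes_op initial_op)
qed

text \<open>Cocompleteness speaks only about shapes on the universe type, so \<open>bool\<close> is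
  first replaced by two distinct elements of that type and the coproduct is then reindexed.\<close>

lemma cocomplete_copower:
  assumes U: "inaccessible_universe TYPE('u)" and C: "category C" "cocomplete TYPE('u) C"
    and X: "X \<in> Obj C"
  shows "\<exists>P \<iota>. is_coproduct C (UNIV :: bool set) (\<lambda>_. X) P \<iota>"
proof -
  obtain a b :: 'u where ab: "a \<noteq> b"
    using ex_new_if_finite[OF inaccessible_infinite[OF U], of "{undefined}"] by auto
  have e: "bij_betw (\<lambda>x. if x then a else b) UNIV {a, b}"
    using ab unfolding bij_betw_def inj_on_def by (auto simp: image_iff split: if_splits)
  have "small TYPE('u) {a, b}" by (rule small_finite[OF U]) simp
  from cocomplete_coproduct[OF C this, of "\<lambda>_. X"] X
  obtain P \<iota> where "is_coproduct C {a, b} (\<lambda>_. X) P \<iota>" by blast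
  from coproduct_reindex[OF this e] show ?thesis by blast
qed

lemma cocomplete_initial:
  assumes U: "inaccessible_universe TYPE('u)" and C: "category C" "cocomplete TYPE('u) C"
  shows "\<exists>P. initial C P"
proof -
  have "small TYPE('u) ({} :: 'u set)" by (rule small_finite[OF U]) simp
  from cocomplete_coproduct[OF C this, of "\<lambda>_. undefined"]
  show ?thesis by (blast dest: coproduct_empty_initial)
qed

lemma model_category_homotopical:
  assumes U: "inaccessible_universe TYPE('u)" and K: "model_category TYPE('u) K"
  shows "homotopical K"
proof -
  have cat: "category K" and cc: "cocomplete TYPE('u) K" and c: "cocomplete TYPE('u) (op_cat K)"
    using K by (auto simp: model_category_def locally_small_category_def complete_def)
  have "\<exists>Z. terminal K Z"
    using cocomplete_initial[OF U category_op[OF cat] c]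
    by (simp add: initial_op_model[symmetric] initial_op)
  moreover have "\<exists>P \<pi>. is_coproduct (op_model K) (UNIV :: bool set) (\<lambda>_. X) P \<pi>"
    if "X \<in> Obj K" for X
    using cocomplete_copower[OF U category_op[OF cat] c] that
    by (simp add: op_cat_simps is_coproduct_op_model)
  ultimately show ?thesis
    using K cocomplete_copower[OF U cat cc] cocomplete_initial[OF U cat cc]
    unfolding model_category_def
    by (intro homotopical.intro homotopical_axioms.intro cat) auto
qed

text \<open>The cylinder inside \<open>left_homotopic\<close>, made a predicate of its own so that
  it can be fixed in advance and read in \<open>op_model K\<close>. There
  \<open>cylinder (op_model K) X Q \<pi> E q t\<close> is a path object: \<open>Q\<close> is the
  product of two copies of \<open>X\<close> with projections \<open>\<pi> b\<close>,
  \<open>q\<close> is a fibration from \<open>E\<close> to \<open>Q\<close>, and \<open>t\<close> is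
  a weak equivalence from \<open>X\<close> to \<open>E\<close> whose composite with \<open>q\<close>
  is the diagonal.\<close>

definition cylinder ::
  "('o, 'm, 'x) model_cat_scheme \<Rightarrow> 'o \<Rightarrow> 'o \<Rightarrow> (bool \<Rightarrow> 'm) \<Rightarrow> 'o \<Rightarrow> 'm \<Rightarrow> 'm \<Rightarrow> bool" where
  "cylinder K B P \<iota> Z i s \<longleftrightarrow> is_coproduct K (UNIV :: bool set) (\<lambda>_. B) P \<iota> \<and>
     i \<in> hom K P Z \<inter> cof K \<and> s \<in> hom K Z B \<inter> weq K \<and>
     (\<forall>b. Comp K (Comp K s i) (\<iota> b) = Ident K B)"

lemma left_homotopic_iff:
  "left_homotopic K f g \<longleftrightarrow>
     f \<in> Arr K \<and> g \<in> Arr K \<and> Dom K f = Dom K g \<and> Cod K f = Cod K g \<and>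
     (\<exists>P \<iota> Z i s H. cylinder K (Dom K f) P \<iota> Z i s \<and> H \<in> hom K Z (Cod K f) \<and>
        Comp K (Comp K H i) (\<iota> False) = f \<and> Comp K (Comp K H i) (\<iota> True) = g)"
  unfolding left_homotopic_def cylinder_def by (auto; blast)

lemma left_homotopicD:
  assumes "left_homotopic K f g"
  shows "f \<in> Arr K" "g \<in> Arr K" "Dom K g = Dom K f" "Cod K g = Cod K f"
  using assms by (auto simp: left_homotopic_def)

section \<open>Lifting, cofibrations and cofibrant objects\<close>

context homotopical
begin

text \<open>Identities are not assumed to be weak equivalences. Factoring the identity yields some
  weak equivalence \<open>i\<close> with domain \<open>X\<close>, and two-of-three applies to
  \<open>i\<close> composed with the identity.\<close>

lemma ident_weq:
  assumes "X \<in> Obj K" shows "Ident K X \<in> weq K"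
proof -
  obtain i where i: "i \<in> weq K" "Dom K i = X" "i \<in> Arr K"
    using factorizes_acyclic_cof ident_arr[OF assms] weq_arr unfolding factorizes_def
    by (metis IntD2 subsetD)
  then show ?thesis
    using two_of_three ident_arr[OF assms] comp_ident_right[of i X] unfolding two_of_three_def by metis
qed

lemma section_weq:
  assumes "s \<in> weq K" "f \<in> hom K X Y" "s \<in> hom K Y X" "Comp K s f = Ident K X"
  shows "f \<in> weq K"
  using assms two_of_three ident_weq[of X] hom_obj[OF assms(2)] unfolding two_of_three_def
  by (metis homD)

lemma lift_cof:
  assumes "i \<in> cof K" "p \<in> fib K" "i \<in> weq K \<or> p \<in> weq K"
    and "i \<in> hom K A B" "p \<in> hom K X Y" "u \<in> hom K A X" "v \<in> hom K B Y"
    and "Comp K p u = Comp K v i"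
  obtains d where "d \<in> hom K B X" "Comp K d i = u" "Comp K p d = v"
proof -
  have "lifts K i p" using assms lift_acyclic_cof lift_acyclic_fib by blast
  then show ?thesis using assms that unfolding lifts_def by (auto simp: homD)
qed

text \<open>The retract argument. Write \<open>f\<close> as a cofibration \<open>i\<close> followed
  by an acyclic fibration \<open>p\<close>; the lift in the square with \<open>i\<close> on top and
  the identity of \<open>B\<close> at the bottom makes \<open>f\<close> a retract of
  \<open>i\<close>.\<close>

lemma cofI:
  assumes f: "f \<in> hom K A B" and lift: "\<And>p X Y u v. p \<in> hom K X Y \<Longrightarrow> p \<in> fib K \<Longrightarrow> p \<in> weq K \<Longrightarrow>
    u \<in> hom K A X \<Longrightarrow> v \<in> hom K B Y \<Longrightarrow> Comp K p u = Comp K v f \<Longrightarrow>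
    \<exists>d \<in> hom K B X. Comp K d f = u \<and> Comp K p d = v"
  shows "f \<in> cof K"
proof -
  obtain i p where ip: "i \<in> cof K" "p \<in> fib K" "p \<in> weq K" "Dom K i = A" "Cod K i = Dom K p"
    "Cod K p = B" "Comp K p i = f"
    using factorizes_acyclic_fib homD[OF f] unfolding factorizes_def by (metis IntD1 IntD2)
  have i: "i \<in> hom K A (Dom K p)" and p: "p \<in> hom K (Dom K p) B"
    using ip cof_arr fib_arr by (auto simp: hom_def)
  obtain d where d: "d \<in> hom K B (Dom K p)" "Comp K d f = i" "Comp K p d = Ident K B"
    using lift[OF p ip(2,3) i ident] hom_obj[OF f] ip(7) ident_left[OF f] by metis
  have "is_retract K f i"
    unfolding is_retract_def homD[OF f] homD[OF i]
    using d p ident[OF hom_obj(1)[OF f]] ip(7) i f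
    by (intro bexI[of _ "Ident K A"] bexI[of _ d] bexI[of _ p])
       (simp_all add: ident_right ident_left)
  then show ?thesis
    using retract_cof ip(1) homD[OF f] unfolding retract_closed_def by blast
qed

text \<open>Closure under composition is not among the axioms; it follows from \<open>cofI\<close>
  by lifting first along \<open>f\<close> and then along \<open>g\<close>.\<close>

lemma comp_cof:
  assumes "f \<in> cof K" "g \<in> cof K" "f \<in> hom K A B" "g \<in> hom K B D"
  shows "Comp K g f \<in> cof K"
proof (rule cofI)
  show "Comp K g f \<in> hom K A D" using assms comp by blast
  fix p X Y u v
  assume p: "p \<in> hom K X Y" "p \<in> fib K" "p \<in> weq K" and u: "u \<in> hom K A X"
    and v: "v \<in> hom K D Y" and c: "Comp K p u = Comp K v (Comp K g f)"
  have "Comp K p u = Comp K (Comp K v g) f" using c assms v assoc by metis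
  then obtain d where d: "d \<in> hom K B X" "Comp K d f = u" "Comp K p d = Comp K v g"
    using lift_cof[of f p A B X Y u "Comp K v g"] assms p u v comp by metis
  then obtain e where e: "e \<in> hom K D X" "Comp K e g = d" "Comp K p e = v"
    using lift_cof[of g p B D X Y d v] assms p v by metis
  have "Comp K e (Comp K g f) = u" using e d assms assoc by metis
  then show "\<exists>d \<in> hom K D X. Comp K d (Comp K g f) = u \<and> Comp K p d = v" using e by blast
qed

text \<open>Squares over the initial object commute automatically, so no chosen initial object is
  left in this form. The converse direction is an instance of \<open>cofI\<close>.\<close>

lemma cofibrant_iff:
  "cofibrant K B \<longleftrightarrow> B \<in> Obj K \<and> (\<forall>p X Y v. p \<in> hom K X Y \<and> p \<in> fib K \<and> p \<in> weq K \<and> v \<in> hom K B Y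
    \<longrightarrow> (\<exists>d \<in> hom K B X. Comp K p d = v))" (is "_ \<longleftrightarrow> _ \<and> ?lift")
proof (intro iffI conjI)
  assume "cofibrant K B"
  then obtain Z f where Z: "initial K Z" and f: "f \<in> hom K Z B" "f \<in> cof K" and B: "B \<in> Obj K"
    by (auto simp: cofibrant_def)
  show "B \<in> Obj K" by (rule B)
  show ?lift
  proof (intro allI impI, elim conjE)
    fix p X Y v
    assume p: "p \<in> hom K X Y" "p \<in> fib K" "p \<in> weq K" and v: "v \<in> hom K B Y"
    obtain u where u: "u \<in> hom K Z X" using Z hom_obj(1)[OF p(1)] by (auto simp: initial_def)
    have "Comp K p u = Comp K v f"
      using Z hom_obj(2)[OF p(1)] comp[OF u p(1)] comp[OF f(1) v] unfolding initial_def by blast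
    then show "\<exists>d \<in> hom K B X. Comp K p d = v"
      using lift_cof[OF f(2) p(2) _ f(1) p(1) u v] p by blast
  qed
next
  assume B: "B \<in> Obj K \<and> ?lift"
  obtain Z where Z: "initial K Z" using ex_initial by blast
  obtain f where f: "f \<in> hom K Z B" using Z B by (auto simp: initial_def)
  have "f \<in> cof K"
  proof (rule cofI[OF f])
    fix p X Y u v
    assume p: "p \<in> hom K X Y" "p \<in> fib K" "p \<in> weq K" and u: "u \<in> hom K Z X" and v: "v \<in> hom K B Y"
    obtain d where d: "d \<in> hom K B X" "Comp K p d = v" using B p v by blast
    have "Comp K d f = u"
      using Z hom_obj(1)[OF p(1)] u comp[OF f d(1)] unfolding initial_def by blast
    then show "\<exists>d \<in> hom K B X. Comp K d f = u \<and> Comp K p d = v" using d by blast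
  qed
  then show "cofibrant K B" unfolding cofibrant_def using Z B f by blast
qed

lemma cofibrant_lift:
  assumes "cofibrant K B" "p \<in> fib K" "p \<in> weq K" "p \<in> hom K X Y" "v \<in> hom K B Y"
  obtains d where "d \<in> hom K B X" "Comp K p d = v"
  using assms cofibrant_iff by blast

lemma cofibrant_cod:
  assumes B: "cofibrant K B" and i: "i \<in> cof K" "i \<in> hom K B D"
  shows "cofibrant K D"
proof -
  obtain Z f where "initial K Z" "f \<in> hom K Z B" "f \<in> cof K"
    using B by (auto simp: cofibrant_def)
  then show ?thesis
    using comp_cof[of f i Z B D] i comp[of f Z B i D] hom_obj(2)[OF i(2)]
    unfolding cofibrant_def by blast
qed

text \<open>Lifts against an acyclic fibration are chosen on each summand and assembled by the
  universal property.\<close>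

lemma cofibrant_coproduct:
  assumes P: "is_coproduct K I X P \<iota>" and X: "\<And>i. i \<in> I \<Longrightarrow> cofibrant K (X i)"
  shows "cofibrant K P"
  unfolding cofibrant_iff
proof (intro conjI allI impI; (elim conjE)?)
  show "P \<in> Obj K" by (rule coproduct_obj[OF P])
  fix p E Y v
  assume p: "p \<in> hom K E Y" "p \<in> fib K" "p \<in> weq K" and v: "v \<in> hom K P Y"
  have "\<exists>d \<in> hom K (X i) E. Comp K p d = Comp K v (\<iota> i)" if "i \<in> I" for i
    using cofibrant_lift[OF X[OF that] p(2,3,1) comp[OF coproduct_inj[OF P that] v]] by blast
  then obtain d where d: "\<And>i. i \<in> I \<Longrightarrow> d i \<in> hom K (X i) E"
    "\<And>i. i \<in> I \<Longrightarrow> Comp K p (d i) = Comp K v (\<iota> i)" by metis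
  obtain h where h: "h \<in> hom K P E" "\<And>i. i \<in> I \<Longrightarrow> Comp K h (\<iota> i) = d i"
    using coproduct_desc[OF P hom_obj(1)[OF p(1)] d(1)] by metis
  have "Comp K p h = v"
    using h d
    by (intro coproduct_eq[OF P comp[OF h(1) p(1)] v])
      (simp add: assoc[OF coproduct_inj[OF P] h(1) p(1), symmetric])
  then show "\<exists>d \<in> hom K P E. Comp K p d = v" using h by blast
qed

section \<open>Cylinders, path objects and the homotopy relation\<close>

lemma cylinderD:
  assumes "cylinder K B P \<iota> Z i s"
  shows "is_coproduct K UNIV (\<lambda>_. B) P \<iota>" "\<iota> b \<in> hom K B P" "i \<in> hom K P Z" "i \<in> cof K"
    "s \<in> hom K Z B" "s \<in> weq K" "Comp K (Comp K s i) (\<iota> b) = Ident K B"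
  using assms coproduct_inj[of K UNIV "\<lambda>_. B" P \<iota>] by (auto simp: cylinder_def)

lemma ex_cylinder:
  assumes B: "B \<in> Obj K"
  shows "\<exists>P \<iota> Z i s. cylinder K B P \<iota> Z i s"
proof -
  obtain P \<iota> where P: "is_coproduct K (UNIV :: bool set) (\<lambda>_. B) P \<iota>" using ex_copower[OF B] by blast
  obtain n where n: "n \<in> hom K P B" "\<And>b. Comp K n (\<iota> b) = Ident K B"
    using coproduct_desc[OF P B, of "\<lambda>_. Ident K B"] ident[OF B] by auto
  obtain i p where ip: "i \<in> cof K" "p \<in> fib K" "p \<in> weq K" "Dom K i = P" "Cod K i = Dom K p"
    "Cod K p = B" "Comp K p i = n"
    using factorizes_acyclic_fib homD[OF n(1)] unfolding factorizes_def by (metis IntD1 IntD2)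
  then have "cylinder K B P \<iota> (Dom K p) i p"
    using P n cof_arr fib_arr unfolding cylinder_def by (auto simp: hom_def)
  then show ?thesis by blast
qed

text \<open>The end is a cofibration because \<open>\<iota> b\<close> is one: a lift from the
  coproduct uses the given arrow on the summand \<open>b\<close>, and on the other summand a lift
  supplied by cofibrancy of \<open>B\<close>. It is a weak equivalence because it is a section of
  \<open>s\<close>.\<close>

lemma cylinder_end:
  assumes B: "cofibrant K B" and c: "cylinder K B P \<iota> Z i s"
  shows "Comp K i (\<iota> b) \<in> cof K \<inter> weq K"
proof
  note cD = cylinderD[OF c]
  have "\<iota> b \<in> cof K"
  proof (rule cofI[OF cD(2)])
    fix p X Y u v
    assume p: "p \<in> hom K X Y" "p \<in> fib K" "p \<in> weq K" and u: "u \<in> hom K B X"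
      and v: "v \<in> hom K P Y" and e: "Comp K p u = Comp K v (\<iota> b)"
    obtain d where d: "d \<in> hom K B X" "Comp K p d = Comp K v (\<iota> (\<not> b))"
      using cofibrant_lift[OF B p(2,3,1) comp[OF cD(2) v]] by blast
    obtain h where h: "h \<in> hom K P X" "\<And>b'. Comp K h (\<iota> b') = (if b' = b then u else d)"
      using coproduct_desc[OF cD(1) hom_obj(1)[OF p(1)], of "\<lambda>b'. if b' = b then u else d"] u d
      by (metis UNIV_I)
    have "Comp K (Comp K p h) (\<iota> b') = Comp K v (\<iota> b')" for b'
      using h(2)[of b'] d(2) e by (cases b; cases b')
        (simp_all add: assoc[OF cD(2) h(1) p(1), symmetric])
    then have "Comp K p h = v"
      using coproduct_eq[OF cD(1) comp[OF h(1) p(1)] v] by blast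
    then show "\<exists>h \<in> hom K P X. Comp K h (\<iota> b) = u \<and> Comp K p h = v" using h by metis
  qed
  then show "Comp K i (\<iota> b) \<in> cof K" using cD comp_cof by metis
  show "Comp K i (\<iota> b) \<in> weq K"
    using section_weq[OF cD(6) comp[OF cD(2,3)] cD(5)] cD(7) assoc[OF cD(2,3,5)] by metis
qed

text \<open>The lift on which all comparisons of homotopies rest. The path object is given in
  advance and kept: the new homotopy \<open>G'\<close> lies in the same \<open>E\<close> as
  \<open>G\<close>, with its first endpoint moved along \<open>H\<close> and its last endpoint
  unchanged.\<close>

lemma path_homotopy_trans:
  assumes B: "cofibrant K B" and c: "cylinder K B P \<iota> Z i s"
    and p: "cylinder (op_model K) X Q \<pi> E q t"
    and H: "H \<in> hom K Z X" and G: "G \<in> hom K B E"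
    and HG: "Comp K (Comp K H i) (\<iota> True) = Comp K (\<pi> False) (Comp K q G)"
  shows "\<exists>G' \<in> hom K B E. Comp K (\<pi> False) (Comp K q G') = Comp K (Comp K H i) (\<iota> False) \<and>
    Comp K (\<pi> True) (Comp K q G') = Comp K (\<pi> True) (Comp K q G)"
proof -
  interpret op: homotopical "op_model K" by (rule homotopical_op) (rule homotopical_axioms)
  note cD = cylinderD[OF c] and pD = op.cylinderD[OF p, simplified]
  define k where "k = Comp K (\<pi> True) (Comp K q G)"
  define j where "j = Comp K i (\<iota> True)"
  have k: "k \<in> hom K B X" unfolding k_def using pD G comp by metis
  have j: "j \<in> hom K B Z" unfolding j_def using cD comp by metis
  have sij: "Comp K s (Comp K i (\<iota> b)) = Ident K B" for b
    using cD assoc by metis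
  have ks: "Comp K k s \<in> hom K Z X" using comp[OF cD(5) k] .
  \<comment> \<open>The bottom of the lifting square: over the whole cylinder the first coordinate
    is \<open>H\<close>, while the second stays constant at the last endpoint \<open>k\<close> of
    \<open>G\<close>.\<close>
  obtain w where w: "w \<in> hom K Z Q" "\<And>b. Comp K (\<pi> b) w = (if b then Comp K k s else H)"
  proof -
    have "(if b then Comp K k s else H) \<in> hom (op_model K) X Z" for b using ks H by simp
    from coproduct_desc[OF pD(1) _ this, of id] hom_obj(1)[OF H] show ?thesis using that by auto
  qed
  have qG: "Comp K q G \<in> hom K B Q" using G pD comp by metis
  have wj: "Comp K w j \<in> hom K B Q" using comp[OF j w(1)] .
  have "Comp K (\<pi> b) (Comp K q G) = Comp K (\<pi> b) (Comp K w j)" for b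
  proof (cases b)
    case True
    have "Comp K (\<pi> b) (Comp K w j) = Comp K (Comp K k s) j"
      using assoc[OF j w(1) pD(2)] w(2) True by simp
    also have "\<dots> = k" using assoc[OF j cD(5) k] sij k ident_right unfolding j_def by metis
    finally show ?thesis using True by (simp add: k_def)
  next
    case False
    have "Comp K (\<pi> b) (Comp K w j) = Comp K H j"
      using assoc[OF j w(1) pD(2)] w(2) False by simp
    then show ?thesis using False HG assoc[OF cD(2,3) H] by (simp add: j_def)
  qed
  then have "Comp K q G = Comp K w j"
    using op.coproduct_eq[OF pD(1), of "Comp K q G" B "Comp K w j"] qG wj by simp
  then obtain d where d: "d \<in> hom K Z E" "Comp K d j = G" "Comp K q d = w"
    using lift_cof[of j q B Z E Q G w] cylinder_end[OF B c, of True] pD(3,4) j G w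
    unfolding j_def by auto
  \<comment> \<open>The lift \<open>d\<close> restricts to \<open>G\<close> at the end
    \<open>True\<close>; its restriction to the end \<open>False\<close> is the combined
    homotopy.\<close>
  define G' where "G' = Comp K d (Comp K i (\<iota> False))"
  have e: "Comp K i (\<iota> False) \<in> hom K B Z" using cD comp by metis
  have G': "G' \<in> hom K B E" unfolding G'_def using comp[OF e d(1)] .
  have qG': "Comp K q G' = Comp K w (Comp K i (\<iota> False))"
    unfolding G'_def using assoc[OF e d(1) pD(3)] d(3) by simp
  have "Comp K (\<pi> False) (Comp K q G') = Comp K H (Comp K i (\<iota> False))"
    unfolding qG' using assoc[OF e w(1) pD(2)] w(2) by simp
  moreover have "Comp K (\<pi> True) (Comp K q G') = k"
    unfolding qG' using assoc[OF e w(1) pD(2)] w(2) sij assoc[OF e cD(5) k] ident_right[OF k] by simp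
  ultimately show ?thesis using G' assoc[OF cD(2,3) H] unfolding k_def by metis
qed

text \<open>The constant homotopy is \<open>f\<close> after the projection of any cylinder.\<close>

lemma left_homotopic_refl:
  assumes f: "f \<in> Arr K" shows "left_homotopic K f f"
proof -
  obtain P \<iota> Z i s where c: "cylinder K (Dom K f) P \<iota> Z i s" using ex_cylinder dom_obj[OF f] by blast
  note cD = cylinderD[OF c]
  have f': "f \<in> hom K (Dom K f) (Cod K f)" using f by (simp add: hom_def)
  have "Comp K (Comp K (Comp K f s) i) (\<iota> b) = f" for b
    using cD(7)[of b] homD[OF cD(2)[of b]] homD[OF cD(3)] homD[OF cD(5)] f
    by (simp add: cat_simps)
  then show ?thesis
    unfolding left_homotopic_iff using f c comp[OF cD(5) f'] by blast
qed

text \<open>The two ends are exchanged by reindexing the coproduct along \<open>Not\<close>; the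
  cylinder object and \<open>H\<close> stay the same.\<close>

lemma left_homotopic_sym:
  assumes "left_homotopic K f g" shows "left_homotopic K g f"
proof -
  obtain P \<iota> Z i s H where c: "cylinder K (Dom K f) P \<iota> Z i s" and H: "H \<in> hom K Z (Cod K f)"
    "Comp K (Comp K H i) (\<iota> False) = f" "Comp K (Comp K H i) (\<iota> True) = g"
    using assms unfolding left_homotopic_iff by auto
  have "bij_betw Not UNIV UNIV" by (auto simp: bij_betw_def inj_on_def)
  then have "cylinder K (Dom K f) P (\<iota> \<circ> Not) Z i s"
    using c coproduct_reindex unfolding cylinder_def by fastforce
  then show ?thesis
    using H left_homotopicD[OF assms] unfolding left_homotopic_iff[of K g f]
    by (intro conjI exI[of _ P] exI[of _ "\<iota> \<circ> Not"] exI[of _ Z] exI[of _ i] exI[of _ s] exI[of _ H]) simp_all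
qed

lemma left_homotopic_post:
  assumes fg: "left_homotopic K f g" and h: "h \<in> Arr K" "Dom K h = Cod K f"
  shows "left_homotopic K (Comp K h f) (Comp K h g)"
proof -
  obtain P \<iota> Z i s H where c: "cylinder K (Dom K f) P \<iota> Z i s" and H: "H \<in> hom K Z (Cod K f)"
    "Comp K (Comp K H i) (\<iota> False) = f" "Comp K (Comp K H i) (\<iota> True) = g"
    using fg unfolding left_homotopic_iff by auto
  note cD = cylinderD[OF c] and fgD = left_homotopicD[OF fg]
  have "Comp K (Comp K (Comp K h H) i) (\<iota> b) = Comp K h (Comp K (Comp K H i) (\<iota> b))" for b
    using homD[OF cD(2)[of b]] homD[OF cD(3)] homD[OF H(1)] h by (simp add: cat_simps)
  then show ?thesis
    unfolding left_homotopic_iff using h H c fgD comp[OF H(1), of h "Cod K h"]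
    by (intro conjI exI[of _ P] exI[of _ \<iota>] exI[of _ Z] exI[of _ i] exI[of _ s] exI[of _ "Comp K h H"])
      (simp_all add: cat_simps homI)
qed

text \<open>The constant right homotopy \<open>t g\<close> at \<open>g\<close>, taken in the
  prescribed path object, is combined with the left homotopy. That the path object can be prescribed
  matters when many homotopies have to land in a common one.\<close>

lemma left_homotopic_path:
  assumes fg: "left_homotopic K f g" and B: "cofibrant K (Dom K f)"
    and p: "cylinder (op_model K) (Cod K f) Q \<pi> E q t"
  shows "\<exists>G \<in> hom K (Dom K f) E. Comp K (\<pi> False) (Comp K q G) = f \<and> Comp K (\<pi> True) (Comp K q G) = g"
proof -
  interpret op: homotopical "op_model K" by (rule homotopical_op) (rule homotopical_axioms)
  note pD = op.cylinderD[OF p, simplified]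
  obtain P \<iota> Z i s H where c: "cylinder K (Dom K f) P \<iota> Z i s" and H: "H \<in> hom K Z (Cod K f)"
    "Comp K (Comp K H i) (\<iota> False) = f" "Comp K (Comp K H i) (\<iota> True) = g"
    using fg unfolding left_homotopic_iff by auto
  have g: "g \<in> hom K (Dom K f) (Cod K f)" using left_homotopicD[OF fg] by (simp add: hom_def)
  have tg: "Comp K t g \<in> hom K (Dom K f) E" using comp[OF g] pD by blast
  have "Comp K (\<pi> b) (Comp K q (Comp K t g)) = g" for b
    using pD(7)[of b] homD[OF pD(2)[of b]] homD[OF pD(3)] homD[OF pD(5)] homD[OF g]
    by (metis comp_arr comp_assoc comp_ident_left)
  then show ?thesis
    using path_homotopy_trans[OF B c p H(1) tg] H by metis
qed

lemma right_homotopic_iff: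
  "right_homotopic K f g \<longleftrightarrow>
     f \<in> Arr K \<and> g \<in> Arr K \<and> Dom K f = Dom K g \<and> Cod K f = Cod K g \<and>
     (\<exists>Q \<pi> E q t G. cylinder (op_model K) (Cod K f) Q \<pi> E q t \<and> G \<in> hom K (Dom K f) E \<and>
        Comp K (\<pi> False) (Comp K q G) = f \<and> Comp K (\<pi> True) (Comp K q G) = g)"
  unfolding right_homotopic_def left_homotopic_iff by (simp, blast)

lemma ex_path: "X \<in> Obj K \<Longrightarrow> \<exists>Q \<pi> E q t. cylinder (op_model K) X Q \<pi> E q t"
  using homotopical.ex_cylinder[OF homotopical_op[OF homotopical_axioms]] by simp

lemma left_imp_right_homotopic:
  assumes fg: "left_homotopic K f g" and B: "cofibrant K (Dom K f)"
  shows "right_homotopic K f g"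
  unfolding right_homotopic_iff
  using left_homotopic_path[OF fg B] left_homotopicD[OF fg] ex_path[OF cod_obj] by metis

lemma left_right_trans:
  assumes fg: "left_homotopic K f g" and gh: "right_homotopic K g h" and B: "cofibrant K (Dom K f)"
  shows "right_homotopic K f h"
proof -
  obtain P \<iota> Z i s H where c: "cylinder K (Dom K f) P \<iota> Z i s" and H: "H \<in> hom K Z (Cod K f)"
    "Comp K (Comp K H i) (\<iota> False) = f" "Comp K (Comp K H i) (\<iota> True) = g"
    using fg unfolding left_homotopic_iff by auto
  note fgD = left_homotopicD[OF fg]
  obtain Q \<pi> E q t G where "cylinder (op_model K) (Cod K g) Q \<pi> E q t" and
    "G \<in> hom K (Dom K g) E" "Comp K (\<pi> False) (Comp K q G) = g" "Comp K (\<pi> True) (Comp K q G) = h"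
    and h: "h \<in> Arr K" "Dom K g = Dom K h" "Cod K g = Cod K h"
    using gh unfolding right_homotopic_iff by blast
  then have p: "cylinder (op_model K) (Cod K f) Q \<pi> E q t" and
    G: "G \<in> hom K (Dom K f) E" "Comp K (\<pi> False) (Comp K q G) = g" "Comp K (\<pi> True) (Comp K q G) = h"
    unfolding fgD by blast+
  show ?thesis
    using path_homotopy_trans[OF B c p H(1) G(1)] H G h fgD p unfolding right_homotopic_iff by metis
qed

lemma right_imp_left_homotopic:
  assumes "right_homotopic K f g" "fibrant K (Cod K f)"
  shows "left_homotopic K f g"
  using homotopical.left_imp_right_homotopic[OF homotopical_op[OF homotopical_axioms], of f g] assms
  by (simp add: left_homotopic_op cofibrant_op)

lemma homotopic_left_iff:
  "cofibrant K (Dom K f) \<Longrightarrow> homotopic K f g \<longleftrightarrow> left_homotopic K f g"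
  using left_imp_right_homotopic unfolding homotopic_def by blast

lemma homotopic_right_iff:
  "fibrant K (Cod K f) \<Longrightarrow> homotopic K f g \<longleftrightarrow> right_homotopic K f g"
  using right_imp_left_homotopic unfolding homotopic_def by blast

lemma homotopicD:
  assumes "homotopic K f g"
  shows "f \<in> Arr K" "g \<in> Arr K" "Dom K g = Dom K f" "Cod K g = Cod K f"
  using assms left_homotopicD by (auto simp: homotopic_def)

lemma homotopic_refl: "f \<in> Arr K \<Longrightarrow> homotopic K f f"
  using left_homotopic_refl homotopical.left_homotopic_refl[OF homotopical_op[OF homotopical_axioms], of f]
  by (simp add: homotopic_def left_homotopic_op)

lemma homotopic_sym: "homotopic K f g \<Longrightarrow> homotopic K g f"
  using left_homotopic_sym homotopical.left_homotopic_sym[OF homotopical_op[OF homotopical_axioms], of f g]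
  by (simp add: homotopic_def left_homotopic_op)

text \<open>The left half of the first hypothesis is combined with the right half of the second;
  fibrancy of the codomain then gives back the left half of the conclusion.\<close>

lemma homotopic_trans:
  assumes "homotopic K f g" "homotopic K g h" "cofibrant K (Dom K f)" "fibrant K (Cod K f)"
  shows "homotopic K f h"
  using left_right_trans[of f g h] assms homotopic_right_iff[of f h] unfolding homotopic_def by blast

text \<open>A left homotopy can be followed by any \<open>h\<close>; cofibrancy of the source
  supplies the right homotopy. The next lemma is the dual.\<close>

lemma homotopic_post:
  assumes "homotopic K f g" "h \<in> Arr K" "Dom K h = Cod K f" "cofibrant K (Dom K f)"
  shows "homotopic K (Comp K h f) (Comp K h g)"
  using left_homotopic_post[of f g h] assms homotopicD[OF assms(1)]
  by (simp add: homotopic_left_iff comp_arr)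

lemma homotopic_pre:
  assumes "homotopic K f g" "h \<in> Arr K" "Cod K h = Dom K f" "fibrant K (Cod K f)"
  shows "homotopic K (Comp K f h) (Comp K g h)"
  using homotopical.homotopic_post[OF homotopical_op[OF homotopical_axioms], of f g h] assms
  by (simp add: homotopic_op cofibrant_op)

lemma fibrant_extend:
  assumes "fibrant K X" "i \<in> cof K" "i \<in> weq K" "i \<in> hom K A B" "u \<in> hom K A X"
  obtains d where "d \<in> hom K B X" "Comp K d i = u"
  using homotopical.cofibrant_lift[OF homotopical_op[OF homotopical_axioms], of X i B A u] assms
  by (auto simp: cofibrant_op)

lemma homotopic_path:
  assumes fg: "homotopic K f g" and B: "cofibrant K (Dom K f)"
    and p: "cylinder (op_model K) (Cod K f) Q \<pi> E q t"
  obtains G where "G \<in> hom K (Dom K f) E" "Comp K (\<pi> False) (Comp K q G) = f"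
    "Comp K (\<pi> True) (Comp K q G) = g"
  using left_homotopic_path[OF _ B p, of g] fg unfolding homotopic_def by blast

end

section \<open>The homotopy category\<close>

lemma Obj_Ho: "X \<in> Obj (Ho K) \<longleftrightarrow> cofibrant K X \<and> fibrant K X"
  by (simp add: Ho_def)

section \<open>Arrows of the homotopy category by representatives\<close>

context homotopical
begin

lemma Ho_obj: "X \<in> Obj (Ho K) \<Longrightarrow> X \<in> Obj K"
  by (simp add: Obj_Ho cofibrant_def)

lemma homotopy_class_eq_iff:
  assumes "f \<in> hom K X Y" "g \<in> hom K X Y" "cofibrant K X" "fibrant K Y"
  shows "homotopy_class K f = homotopy_class K g \<longleftrightarrow> homotopic K f g"
proof
  assume "homotopy_class K f = homotopy_class K g"
  then show "homotopic K f g"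
    using homotopic_refl[OF homD(1)[OF assms(2)]] by (auto simp: homotopy_class_def)
next
  assume "homotopic K f g"
  then show "homotopy_class K f = homotopy_class K g"
    using homotopic_trans[of f g] homotopic_trans[of g f] homotopic_sym[of f g] assms(3,4)
      homD[OF assms(1)] homD[OF assms(2)] unfolding homotopy_class_def by auto
qed

text \<open>The link to the definition of \<open>Ho\<close>, where domain, codomain and composition
  pick a representative by \<open>SOME\<close>.\<close>

lemma homotopic_some: "f \<in> Arr K \<Longrightarrow> homotopic K f (SOME g. g \<in> homotopy_class K f)"
  using someI[of "\<lambda>g. g \<in> homotopy_class K f" f] homotopic_refl[of f] by (simp add: homotopy_class_def)

lemma Dom_Ho: "f \<in> Arr K \<Longrightarrow> Dom (Ho K) (homotopy_class K f) = Dom K f"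
  and Cod_Ho: "f \<in> Arr K \<Longrightarrow> Cod (Ho K) (homotopy_class K f) = Cod K f"
  using homotopicD[OF homotopic_some[of f]] by (simp_all add: Ho_def)

lemma hom_HoI:
  assumes "f \<in> hom K X Y" "X \<in> Obj (Ho K)" "Y \<in> Obj (Ho K)"
  shows "homotopy_class K f \<in> hom (Ho K) X Y"
  using assms Dom_Ho[of f] Cod_Ho[of f] unfolding hom_def Obj_Ho by (auto simp: Ho_def)

lemma hom_HoE:
  assumes "F \<in> hom (Ho K) X Y"
  obtains f where "f \<in> hom K X Y" "F = homotopy_class K f" "X \<in> Obj (Ho K)" "Y \<in> Obj (Ho K)"
proof -
  have "F \<in> Arr (Ho K)" using assms by (rule homD)
  then obtain f where f: "F = homotopy_class K f" "f \<in> Arr K" "Dom K f \<in> Obj (Ho K)"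
    "Cod K f \<in> Obj (Ho K)"
    unfolding Obj_Ho by (auto simp: Ho_def)
  then have "Dom K f = X" "Cod K f = Y"
    using homD[OF assms] Dom_Ho[of f] Cod_Ho[of f] by auto
  with f that show ?thesis by (auto simp: hom_def)
qed

text \<open>The picked representatives are exchanged one at a time: \<open>f\<close> for
  \<open>f'\<close> under \<open>g\<close>, by cofibrancy of \<open>X\<close>, and then
  \<open>g\<close> for \<open>g'\<close>, by fibrancy of \<open>Z\<close>.\<close>

lemma Comp_Ho:
  assumes f: "f \<in> hom K X Y" and g: "g \<in> hom K Y Z"
    and o: "X \<in> Obj (Ho K)" "Y \<in> Obj (Ho K)" "Z \<in> Obj (Ho K)"
  shows "Comp (Ho K) (homotopy_class K g) (homotopy_class K f) = homotopy_class K (Comp K g f)"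
proof -
  define f' g' where "f' = (SOME h. h \<in> homotopy_class K f)" and "g' = (SOME h. h \<in> homotopy_class K g)"
  note fD = homD[OF f] and gD = homD[OF g]
  have ff: "homotopic K f f'" and gg: "homotopic K g g'"
    using homotopic_some fD(1) gD(1) by (auto simp: f'_def g'_def)
  have f': "f' \<in> hom K X Y" and g': "g' \<in> hom K Y Z"
    using homotopicD[OF ff] homotopicD[OF gg] fD gD by (auto simp: hom_def)
  have "homotopic K (Comp K g f) (Comp K g f')"
    using homotopic_post[OF ff, of g] fD gD o by (simp add: Obj_Ho)
  moreover have "homotopic K (Comp K g f') (Comp K g' f')"
    using homotopic_pre[OF gg, of f'] homD[OF f'] gD o by (simp add: Obj_Ho)
  ultimately have "homotopic K (Comp K g f) (Comp K g' f')"
    using homotopic_trans[of "Comp K g f"] homD[OF comp[OF f g]] o by (auto simp: Obj_Ho)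
  then have "homotopy_class K (Comp K g f) = homotopy_class K (Comp K g' f')"
    using homotopy_class_eq_iff[OF comp[OF f g] comp[OF f' g']] o by (simp add: Obj_Ho)
  then show ?thesis by (simp add: Ho_def f'_def g'_def)
qed

lemma Ident_Ho: "Ident (Ho K) X = homotopy_class K (Ident K X)"
  by (simp add: Ho_def)

lemma category_Ho: "category (Ho K)"
proof
  fix F assume F: "F \<in> Arr (Ho K)"
  then have "F \<in> hom (Ho K) (Dom (Ho K) F) (Cod (Ho K) F)" by (simp add: hom_def)
  then show "Dom (Ho K) F \<in> Obj (Ho K)" "Cod (Ho K) F \<in> Obj (Ho K)" using hom_HoE by blast+
next
  fix X assume "X \<in> Obj (Ho K)"
  then show "Ident (Ho K) X \<in> hom (Ho K) X X"
    unfolding Ident_Ho using hom_HoI ident Ho_obj by blast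
next
  fix F X Y assume "F \<in> hom (Ho K) X Y"
  then obtain f where f: "f \<in> hom K X Y" "F = homotopy_class K f" "X \<in> Obj (Ho K)" "Y \<in> Obj (Ho K)"
    by (rule hom_HoE)
  then show "Comp (Ho K) (Ident (Ho K) Y) F = F" "Comp (Ho K) F (Ident (Ho K) X) = F"
    unfolding Ident_Ho using Comp_Ho[OF f(1) ident f(3,4,4)] Comp_Ho[OF ident f(1) f(3,3,4)]
    by (simp_all add: ident_left ident_right Ho_obj)
next
  fix F X Y G Z assume "F \<in> hom (Ho K) X Y" "G \<in> hom (Ho K) Y Z"
  then show "Comp (Ho K) G F \<in> hom (Ho K) X Z"
    by (elim hom_HoE) (simp add: Comp_Ho hom_HoI comp)
next
  fix F X Y G Z H W assume "F \<in> hom (Ho K) X Y" "G \<in> hom (Ho K) Y Z" "H \<in> hom (Ho K) Z W"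
  then obtain f g h where "f \<in> hom K X Y" "F = homotopy_class K f" "X \<in> Obj (Ho K)" "Y \<in> Obj (Ho K)"
    "g \<in> hom K Y Z" "G = homotopy_class K g" "Z \<in> Obj (Ho K)"
    "h \<in> hom K Z W" "H = homotopy_class K h" "W \<in> Obj (Ho K)"
    by (elim hom_HoE)
  note fgh = this
  have gf: "Comp K g f \<in> hom K X Z" and hg: "Comp K h g \<in> hom K Y W"
    using comp fgh by blast+
  have "Comp (Ho K) H (Comp (Ho K) G F) = homotopy_class K (Comp K h (Comp K g f))"
    using Comp_Ho[OF fgh(1,5)] Comp_Ho[OF gf fgh(8)] fgh by simp
  also have "\<dots> = homotopy_class K (Comp K (Comp K h g) f)"
    using assoc[OF fgh(1,5,8)] by simp
  also have "\<dots> = Comp (Ho K) (Comp (Ho K) H G) F"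
    using Comp_Ho[OF fgh(5,8)] Comp_Ho[OF fgh(1) hg] fgh by simp
  finally show "Comp (Ho K) H (Comp (Ho K) G F) = Comp (Ho K) (Comp (Ho K) H G) F" .
qed

lemma locally_small_Ho:
  assumes "locally_small_category U K"
  shows "locally_small_category U (Ho K)"
  unfolding locally_small_category_def
proof (intro conjI ballI category_Ho)
  fix X Y assume X: "X \<in> Obj (Ho K)" and Y: "Y \<in> Obj (Ho K)"
  have "hom (Ho K) X Y \<subseteq> homotopy_class K ` hom K X Y" by (auto elim: hom_HoE)
  then have "|hom (Ho K) X Y| \<le>o |hom K X Y|"
    by (rule ordLeq_transitive[OF card_of_mono1 card_of_image])
  then show "small U (hom (Ho K) X Y)"
    using assms Ho_obj[OF X] Ho_obj[OF Y] 
    unfolding locally_small_category_def small_def by (auto intro: ordLeq_ordLess_trans)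
qed

text \<open>The arrow \<open>e\<close> stands for the inclusion of \<open>P\<close> into its fibrant
  replacement. It serves twice as an acyclic cofibration: arrows into a fibrant object extend along
  it, and so do right homotopies with prescribed endpoints.\<close>

lemma Ho_coproduct:
  assumes P: "is_coproduct K I X P \<iota>" and X: "\<And>i. i \<in> I \<Longrightarrow> X i \<in> Obj (Ho K)"
    and e: "e \<in> hom K P Q" "e \<in> cof K" "e \<in> weq K" and Q: "fibrant K Q"
  shows "is_coproduct (Ho K) I X Q (\<lambda>i. homotopy_class K (Comp K e (\<iota> i)))"
proof -
  interpret op: homotopical "op_model K" by (rule homotopical_op) (rule homotopical_axioms)
  have QH: "Q \<in> Obj (Ho K)"
    using cofibrant_cod[OF cofibrant_coproduct[OF P] e(2,1)] X Q by (simp add: Obj_Ho)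
  have e\<iota>: "Comp K e (\<iota> i) \<in> hom K (X i) Q" if "i \<in> I" for i
    using comp[OF coproduct_inj[OF P that] e(1)] .
  have ex: "\<exists>H. H \<in> hom (Ho K) Q Y \<and>
      (\<forall>i \<in> I. Comp (Ho K) H (homotopy_class K (Comp K e (\<iota> i))) = F i)"
    if Y: "Y \<in> Obj (Ho K)" and F: "\<And>i. i \<in> I \<Longrightarrow> F i \<in> hom (Ho K) (X i) Y" for Y F
  proof -
    have "\<exists>f. f \<in> hom K (X i) Y \<and> F i = homotopy_class K f" if "i \<in> I" for i
      using F[OF that] by (auto elim: hom_HoE)
    then obtain f where f: "\<And>i. i \<in> I \<Longrightarrow> f i \<in> hom K (X i) Y"
      "\<And>i. i \<in> I \<Longrightarrow> F i = homotopy_class K (f i)" by metis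
    obtain h where h: "h \<in> hom K P Y" "\<And>i. i \<in> I \<Longrightarrow> Comp K h (\<iota> i) = f i"
      using coproduct_desc[OF P Ho_obj[OF Y] f(1)] by metis
    obtain d where d: "d \<in> hom K Q Y" "Comp K d e = h"
      using fibrant_extend[of Y e P Q h] e h Y unfolding Obj_Ho by blast
    have "Comp (Ho K) (homotopy_class K d) (homotopy_class K (Comp K e (\<iota> i))) = F i"
      if "i \<in> I" for i
      using Comp_Ho[OF e\<iota>[OF that] d(1) X[OF that] QH Y] f(2)[OF that] h(2)[OF that] d(2)
        assoc[OF coproduct_inj[OF P that] e(1) d(1)] by simp
    then show ?thesis using hom_HoI[OF d(1) QH Y] by blast
  qed
  have uniq: "H = H'"
    if H: "H \<in> hom (Ho K) Q Y" and H': "H' \<in> hom (Ho K) Q Y"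
      and eq: "\<And>i. i \<in> I \<Longrightarrow> Comp (Ho K) H (homotopy_class K (Comp K e (\<iota> i))) =
        Comp (Ho K) H' (homotopy_class K (Comp K e (\<iota> i)))" for Y H H'
  proof -
    obtain h where h: "h \<in> hom K Q Y" "H = homotopy_class K h" and Y: "Y \<in> Obj (Ho K)"
      using H by (rule hom_HoE)
    obtain h' where h': "h' \<in> hom K Q Y" "H' = homotopy_class K h'" using H' by (rule hom_HoE)
    \<comment> \<open>One path object of \<open>Y\<close> is fixed before the summands are
      considered, so that the homotopies \<open>G i\<close> below all have codomain \<open>E\<close>
      and define a single arrow out of \<open>P\<close>.\<close>
    obtain Q2 \<pi> E q t where p: "cylinder (op_model K) Y Q2 \<pi> E q t"
      using ex_path[OF Ho_obj[OF Y]] by blast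
    note pD = op.cylinderD[OF p, simplified]
    have "\<exists>G. G \<in> hom K (X i) E \<and> Comp K (\<pi> False) (Comp K q G) = Comp K h (Comp K e (\<iota> i)) \<and>
        Comp K (\<pi> True) (Comp K q G) = Comp K h' (Comp K e (\<iota> i))" if i: "i \<in> I" for i
    proof -
      have 1: "Comp K h (Comp K e (\<iota> i)) \<in> hom K (X i) Y" "Comp K h' (Comp K e (\<iota> i)) \<in> hom K (X i) Y"
        using e\<iota>[OF i] h h' comp by blast+
      have "homotopy_class K (Comp K h (Comp K e (\<iota> i))) = homotopy_class K (Comp K h' (Comp K e (\<iota> i)))"
        using eq[OF i] Comp_Ho[OF e\<iota>[OF i] h(1) X[OF i] QH Y] Comp_Ho[OF e\<iota>[OF i] h'(1) X[OF i] QH Y]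
          h(2) h'(2) by simp
      then have "homotopic K (Comp K h (Comp K e (\<iota> i))) (Comp K h' (Comp K e (\<iota> i)))"
        using homotopy_class_eq_iff[OF 1] X[OF i] Y by (simp add: Obj_Ho)
      from homotopic_path[OF this] show ?thesis
        using homD[OF 1(1)] X[OF i] p unfolding Obj_Ho by metis
    qed
    then obtain G where G: "\<And>i. i \<in> I \<Longrightarrow> G i \<in> hom K (X i) E"
      "\<And>i. i \<in> I \<Longrightarrow> Comp K (\<pi> False) (Comp K q (G i)) = Comp K h (Comp K e (\<iota> i))"
      "\<And>i. i \<in> I \<Longrightarrow> Comp K (\<pi> True) (Comp K q (G i)) = Comp K h' (Comp K e (\<iota> i))" by metis
    obtain g where g: "g \<in> hom K P E" "\<And>i. i \<in> I \<Longrightarrow> Comp K g (\<iota> i) = G i"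
      using coproduct_desc[OF P hom_obj(2)[OF pD(5)] G(1)] by metis
    define hh where "hh b = (if b then h' else h)" for b
    have hh: "hh b \<in> hom K Q Y" for b using h(1) h'(1) by (simp add: hh_def)
    \<comment> \<open>\<open>w\<close> is the pair of \<open>h\<close> and \<open>h'\<close>. It is
      the bottom of a square from \<open>e\<close> to \<open>q\<close> whose top is the assembled
      homotopy \<open>g\<close>; the lift in that square is a right homotopy from \<open>h\<close>
      to \<open>h'\<close>.\<close>
    obtain w where w: "w \<in> hom K Q Q2" "\<And>b. Comp K (\<pi> b) w = hh b"
    proof -
      have "hh b \<in> hom (op_model K) Y Q" for b using hh by simp
      from coproduct_desc[OF pD(1) _ this, of id] Ho_obj[OF QH] show ?thesis using that by auto
    qed
    have qg: "Comp K q g \<in> hom K P Q2" and we: "Comp K w e \<in> hom K P Q2"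
      using comp g(1) pD(3) e(1) w(1) by blast+
    have "Comp K (\<pi> b) (Comp K q g) = Comp K (\<pi> b) (Comp K w e)" for b
    proof (rule coproduct_eq[OF P])
      show "Comp K (\<pi> b) (Comp K q g) \<in> hom K P Y" "Comp K (\<pi> b) (Comp K w e) \<in> hom K P Y"
        using comp qg we pD(2) by blast+
      fix i assume i: "i \<in> I"
      have "Comp K (Comp K (\<pi> b) (Comp K q g)) (\<iota> i) = Comp K (\<pi> b) (Comp K q (G i))"
        using assoc[OF coproduct_inj[OF P i] qg pD(2)] assoc[OF coproduct_inj[OF P i] g(1) pD(3)]
          g(2)[OF i] by simp
      also have "\<dots> = Comp K (hh b) (Comp K e (\<iota> i))" using G(2,3)[OF i] by (simp add: hh_def)
      also have "\<dots> = Comp K (Comp K (hh b) e) (\<iota> i)"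
        using assoc[OF coproduct_inj[OF P i] e(1) hh] .
      also have "Comp K (hh b) e = Comp K (\<pi> b) (Comp K w e)"
        using assoc[OF e(1) w(1) pD(2)] w(2) by simp
      finally show "Comp K (Comp K (\<pi> b) (Comp K q g)) (\<iota> i) = Comp K (Comp K (\<pi> b) (Comp K w e)) (\<iota> i)" .
    qed
    then have "Comp K q g = Comp K w e"
      using op.coproduct_eq[OF pD(1), of "Comp K q g" P "Comp K w e"] qg we by simp
    then obtain d where d: "d \<in> hom K Q E" "Comp K q d = w"
      using lift_cof[OF e(2) pD(4) _ e(1) pD(3) g(1) w(1)] e(3) by blast
    have "Comp K (\<pi> False) (Comp K q d) = h" "Comp K (\<pi> True) (Comp K q d) = h'"
      using d w(2) by (simp_all add: hh_def)
    then have "right_homotopic K h h'"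
      using d(1) p unfolding right_homotopic_iff homD[OF h(1)] homD[OF h'(1)]
      by (intro conjI homD[OF h(1)] homD[OF h'(1)] refl) blast
    then have "homotopic K h h'"
      using homotopic_right_iff homD[OF h(1)] Y by (simp add: Obj_Ho)
    then show ?thesis
      using homotopy_class_eq_iff[OF h(1) h'(1)] h(2) h'(2) QH Y by (simp add: Obj_Ho)
  qed
  show ?thesis
    unfolding is_coproduct_def
  proof (intro conjI ballI allI impI)
    show "Q \<in> Obj (Ho K)" by (rule QH)
    show "homotopy_class K (Comp K e (\<iota> i)) \<in> hom (Ho K) (X i) Q" if "i \<in> I" for i
      using hom_HoI[OF e\<iota> X QH] that by blast
    fix Y F assume "Y \<in> Obj (Ho K) \<and> (\<forall>i \<in> I. F i \<in> hom (Ho K) (X i) Y)"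
    then show "\<exists>!H. H \<in> hom (Ho K) Q Y \<and>
        (\<forall>i \<in> I. Comp (Ho K) H (homotopy_class K (Comp K e (\<iota> i))) = F i)"
      using ex[of Y F] uniq[of _ Y] by (intro ex_ex1I) auto
  qed
qed

end

text \<open>Serves to carry an arrow with codomain \<open>P\<close> over to another coproduct
  \<open>Q\<close> and back, for which one composite suffices.\<close>

lemma (in category) coproduct_iso:
  assumes P: "is_coproduct C I X P \<iota>" and Q: "is_coproduct C I X Q \<iota>'"
  obtains a b where "a \<in> hom C P Q" "b \<in> hom C Q P" "Comp C b a = Ident C P"
    "\<And>i. i \<in> I \<Longrightarrow> Comp C b (\<iota>' i) = \<iota> i"
proof -
  obtain a where a: "a \<in> hom C P Q" "\<And>i. i \<in> I \<Longrightarrow> Comp C a (\<iota> i) = \<iota>' i"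
    using coproduct_desc[OF P coproduct_obj[OF Q] coproduct_inj[OF Q]] by metis
  obtain b where b: "b \<in> hom C Q P" "\<And>i. i \<in> I \<Longrightarrow> Comp C b (\<iota>' i) = \<iota> i"
    using coproduct_desc[OF Q coproduct_obj[OF P] coproduct_inj[OF P]] by metis
  have "Comp C b a = Ident C P"
    using assoc[OF coproduct_inj[OF P] a(1) b(1)] a(2) b(2) ident_left[OF coproduct_inj[OF P]]
    by (intro coproduct_eq[OF P comp[OF a(1) b(1)] ident[OF coproduct_obj[OF P]]]) simp
  then show ?thesis using that a b by blast
qed

section \<open>Small sets\<close>

lemma small_subset: "small U B \<Longrightarrow> A \<subseteq> B \<Longrightarrow> small U A"
  unfolding small_def by (auto intro: ordLeq_ordLess_trans[OF card_of_mono1])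

lemma small_image: "small U A \<Longrightarrow> small U (f ` A)"
  unfolding small_def by (auto intro: ordLeq_ordLess_trans[OF card_of_image])

lemma small_inj: "inj_on f A \<Longrightarrow> small U (f ` A) \<Longrightarrow> small U A"
  unfolding small_def by (auto intro: ordLeq_ordLess_trans[OF card_of_ordLeqI[of f A "f ` A"]])

lemma small_embed:
  assumes "small TYPE('u) A"
  obtains e :: "'a \<Rightarrow> 'u" where "inj_on e (A :: 'a set)"
  using ordLess_imp_ordLeq[OF assms[unfolded small_def], folded card_of_ordLeq] by auto

text \<open>The universe axiom concerns subsets of the universe type; an embedding of
  \<open>A\<close> carries it over to sets on other types.\<close>

lemma small_Pow:
  assumes U: "inaccessible_universe TYPE('u)" and A: "small TYPE('u) A"
  shows "small TYPE('u) (Pow A)"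
proof -
  obtain e :: "'a \<Rightarrow> 'u" where e: "inj_on e A" using A by (rule small_embed)
  have "small TYPE('u) (Pow (e ` A))"
    using U small_image[OF A, of e] unfolding inaccessible_universe_def small_def by blast
  then have "small TYPE('u) (image e ` Pow A)"
    by (rule small_subset) blast
  then show ?thesis by (rule small_inj[OF inj_on_image_Pow[OF e]])
qed

lemma small_UN:
  assumes U: "inaccessible_universe TYPE('u)" and "small TYPE('u) I"
    and "\<And>i. i \<in> I \<Longrightarrow> small TYPE('u) (F i)"
  shows "small TYPE('u) (\<Union>i \<in> I. F i)"
  unfolding small_def
proof (rule card_of_UNION_ordLess_infinite_Field_regularCard)
  show "regularCard |UNIV :: 'u set|" using U by (simp add: inaccessible_universe_def)
  show "Cinfinite |UNIV :: 'u set|"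
    using inaccessible_infinite[OF U] by (simp add: cinfinite_def Field_card_of card_of_card_order_on)
qed (use assms in \<open>auto simp: small_def\<close>)

lemma small_Times:
  assumes U: "inaccessible_universe TYPE('u)" and A: "small TYPE('u) A" and B: "small TYPE('u) B"
  shows "small TYPE('u) (A \<times> B)"
proof -
  have "A \<times> B = (\<Union>x \<in> A. Pair x ` B)" by auto
  then show ?thesis using small_UN[OF U A small_image[OF B], of Pair] by simp
qed

text \<open>An extensional function is determined by its graph over \<open>I\<close>, a subset of
  the product of \<open>I\<close> with the union of the \<open>F i\<close>.\<close>

lemma small_PiE:
  assumes U: "inaccessible_universe TYPE('u)" and I: "small TYPE('u) I"
    and F: "\<And>i. i \<in> I \<Longrightarrow> small TYPE('u) (F i)"
  shows "small TYPE('u) (PiE I F)"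
proof -
  have "inj_on (\<lambda>f. (\<lambda>i. (i, f i)) ` I) (PiE I F)"
  proof (rule inj_onI)
    fix f g assume fg: "f \<in> PiE I F" "g \<in> PiE I F" and eq: "(\<lambda>i. (i, f i)) ` I = (\<lambda>i. (i, g i)) ` I"
    show "f = g"
    proof (rule PiE_ext[OF fg])
      fix i assume "i \<in> I"
      then have "(i, f i) \<in> (\<lambda>i. (i, g i)) ` I" unfolding eq[symmetric] by blast
      then show "f i = g i" by blast
    qed
  qed
  moreover have "small TYPE('u) ((\<lambda>f. (\<lambda>i. (i, f i)) ` I) ` PiE I F)"
    by (rule small_subset[OF small_Pow[OF U small_Times[OF U I small_UN[OF U I F]]]]) auto
  ultimately show ?thesis by (rule small_inj)
qed


section \<open>Filtered categories\<close>

text \<open>The conditions of \<open>filtered\<close> without smallness and with free index types: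
  the posets of subsets and the product categories below do not live on the universe type.\<close>

definition filtered_cat :: "'k rel \<Rightarrow> ('a, 'b) cat \<Rightarrow> bool" where
  "filtered_cat \<kappa> J \<longleftrightarrow> category J \<and> Obj J \<noteq> {} \<and>
     (\<forall>S. S \<subseteq> Obj J \<and> |S| <o \<kappa> \<longrightarrow> (\<exists>z \<in> Obj J. \<forall>x \<in> S. hom J x z \<noteq> {})) \<and>
     (\<forall>x \<in> Obj J. \<forall>y \<in> Obj J. \<forall>S. S \<subseteq> hom J x y \<and> |S| <o \<kappa> \<longrightarrow>
        (\<exists>z \<in> Obj J. \<exists>h \<in> hom J y z. \<forall>f \<in> S. \<forall>g \<in> S. Comp J h f = Comp J h g))"

lemma filtered_iff:
  fixes \<kappa> :: "'u rel"
  shows "filtered \<kappa> J \<longleftrightarrow> small TYPE('u) (Obj J) \<and> small TYPE('u) (Arr J) \<and> filtered_cat \<kappa> J"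
  unfolding filtered_def filtered_cat_def small_category_def by blast

lemma filtered_catD:
  assumes "filtered_cat \<kappa> J"
  shows "category J" "Obj J \<noteq> {}"
  using conjunct1[OF assms[unfolded filtered_cat_def]]
    conjunct1[OF conjunct2[OF assms[unfolded filtered_cat_def]]] .

lemma filtered_cat_bound:
  assumes "filtered_cat \<kappa> J" "S \<subseteq> Obj J" "|S| <o \<kappa>"
  obtains z where "z \<in> Obj J" "\<And>x. x \<in> S \<Longrightarrow> hom J x z \<noteq> {}"
proof -
  have "\<forall>S. S \<subseteq> Obj J \<and> |S| <o \<kappa> \<longrightarrow> (\<exists>z \<in> Obj J. \<forall>x \<in> S. hom J x z \<noteq> {})"
    using assms(1) unfolding filtered_cat_def by (elim conjE)
  from this[THEN spec, THEN mp, OF conjI[OF assms(2,3)]]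
  obtain z where "z \<in> Obj J" "\<forall>x \<in> S. hom J x z \<noteq> {}" by (rule bexE)
  then show ?thesis using that[of z] by simp
qed

lemma filtered_cat_coequalize:
  assumes J: "filtered_cat \<kappa> J" and S: "S \<subseteq> hom J x y" "|S| <o \<kappa>" and x: "x \<in> Obj J" and y: "y \<in> Obj J"
  obtains z h where "z \<in> Obj J" "h \<in> hom J y z"
    "\<And>f g. f \<in> S \<Longrightarrow> g \<in> S \<Longrightarrow> Comp J h f = Comp J h g"
proof -
  have "\<forall>x \<in> Obj J. \<forall>y \<in> Obj J. \<forall>S. S \<subseteq> hom J x y \<and> |S| <o \<kappa> \<longrightarrow>
      (\<exists>z \<in> Obj J. \<exists>h \<in> hom J y z. \<forall>f \<in> S. \<forall>g \<in> S. Comp J h f = Comp J h g)"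
    using J unfolding filtered_cat_def by (elim conjE)
  from this[THEN bspec, OF x, THEN bspec, OF y, THEN spec, THEN mp, OF conjI[OF S]]
  obtain z h where "z \<in> Obj J" "h \<in> hom J y z" "\<forall>f \<in> S. \<forall>g \<in> S. Comp J h f = Comp J h g"
    by (elim bexE)
  then show ?thesis by (intro that[of z h]) blast+
qed

definition map_cat :: "('a \<Rightarrow> 'c) \<Rightarrow> ('b \<Rightarrow> 'd) \<Rightarrow> ('a, 'b) cat \<Rightarrow> ('c, 'd) cat" where
  "map_cat e a J = \<lparr>Obj = e ` Obj J, Arr = a ` Arr J,
     Dom = (\<lambda>x. e (Dom J (inv_into (Arr J) a x))), Cod = (\<lambda>x. e (Cod J (inv_into (Arr J) a x))),
     Ident = (\<lambda>x. a (Ident J (inv_into (Obj J) e x))),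
     Comp = (\<lambda>g f. a (Comp J (inv_into (Arr J) a g) (inv_into (Arr J) a f)))\<rparr>"

lemma categoryI_arr:
  assumes "\<And>f. f \<in> Arr C \<Longrightarrow> Dom C f \<in> Obj C" "\<And>f. f \<in> Arr C \<Longrightarrow> Cod C f \<in> Obj C"
    and "\<And>X. X \<in> Obj C \<Longrightarrow> Ident C X \<in> Arr C" "\<And>X. X \<in> Obj C \<Longrightarrow> Dom C (Ident C X) = X"
      "\<And>X. X \<in> Obj C \<Longrightarrow> Cod C (Ident C X) = X"
    and "\<And>f g. f \<in> Arr C \<Longrightarrow> g \<in> Arr C \<Longrightarrow> Dom C g = Cod C f \<Longrightarrow> Comp C g f \<in> Arr C"
    and "\<And>f g. f \<in> Arr C \<Longrightarrow> g \<in> Arr C \<Longrightarrow> Dom C g = Cod C f \<Longrightarrow> Dom C (Comp C g f) = Dom C f"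
    and "\<And>f g. f \<in> Arr C \<Longrightarrow> g \<in> Arr C \<Longrightarrow> Dom C g = Cod C f \<Longrightarrow> Cod C (Comp C g f) = Cod C g"
    and "\<And>f. f \<in> Arr C \<Longrightarrow> Comp C (Ident C (Cod C f)) f = f"
    and "\<And>f. f \<in> Arr C \<Longrightarrow> Comp C f (Ident C (Dom C f)) = f"
    and "\<And>f g h. f \<in> Arr C \<Longrightarrow> g \<in> Arr C \<Longrightarrow> h \<in> Arr C \<Longrightarrow> Dom C g = Cod C f \<Longrightarrow> Dom C h = Cod C g \<Longrightarrow>
      Comp C h (Comp C g f) = Comp C (Comp C h g) f"
  shows "category C"
  using assms unfolding category_def hom_def by auto

locale cat_relabelling = category J for J :: "('a, 'b) cat" +
  fixes e :: "'a \<Rightarrow> 'c" and a :: "'b \<Rightarrow> 'd"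
  assumes inj_e: "inj_on e (Obj J)" and inj_a: "inj_on a (Arr J)"
begin

lemma map_simps:
  "Obj (map_cat e a J) = e ` Obj J" "Arr (map_cat e a J) = a ` Arr J"
  "f \<in> Arr J \<Longrightarrow> Dom (map_cat e a J) (a f) = e (Dom J f)"
  "f \<in> Arr J \<Longrightarrow> Cod (map_cat e a J) (a f) = e (Cod J f)"
  "x \<in> Obj J \<Longrightarrow> Ident (map_cat e a J) (e x) = a (Ident J x)"
  "f \<in> Arr J \<Longrightarrow> g \<in> Arr J \<Longrightarrow> Comp (map_cat e a J) (a g) (a f) = a (Comp J g f)"
  using inj_e inj_a by (simp_all add: map_cat_def)

lemma hom_map:
  assumes "x \<in> Obj J" "y \<in> Obj J"
  shows "hom (map_cat e a J) (e x) (e y) = a ` hom J x y"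
proof -
  have "e (Dom J f) = e x \<longleftrightarrow> Dom J f = x" "e (Cod J f) = e y \<longleftrightarrow> Cod J f = y" if "f \<in> Arr J" for f
    using inj_e assms dom_obj[OF that] cod_obj[OF that] by (auto simp: inj_on_def)
  then show ?thesis unfolding hom_def by (auto simp: map_simps image_iff)
qed

lemma e_eq_iff: "x \<in> Obj J \<Longrightarrow> y \<in> Obj J \<Longrightarrow> e x = e y \<longleftrightarrow> x = y"
  using inj_e by (rule inj_on_eq_iff)

lemma category_map: "category (map_cat e a J)"
proof (rule categoryI_arr, unfold map_simps(1,2))
  fix f assume "f \<in> a ` Arr J"
  then obtain f' where f': "f = a f'" "f' \<in> Arr J" by blast
  show "Dom (map_cat e a J) f \<in> e ` Obj J" "Cod (map_cat e a J) f \<in> e ` Obj J"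
    using f' dom_obj cod_obj by (simp_all add: map_simps)
  show "Comp (map_cat e a J) (Ident (map_cat e a J) (Cod (map_cat e a J) f)) f = f"
    "Comp (map_cat e a J) f (Ident (map_cat e a J) (Dom (map_cat e a J) f)) = f"
    using f' dom_obj cod_obj by (simp_all add: map_simps cat_simps)
next
  fix X assume "X \<in> e ` Obj J"
  then obtain X' where X': "X = e X'" "X' \<in> Obj J" by blast
  show "Ident (map_cat e a J) X \<in> a ` Arr J" "Dom (map_cat e a J) (Ident (map_cat e a J) X) = X"
    "Cod (map_cat e a J) (Ident (map_cat e a J) X) = X"
    using X' by (simp_all add: map_simps ident_arr)
next
  fix f g assume "f \<in> a ` Arr J" "g \<in> a ` Arr J" and d: "Dom (map_cat e a J) g = Cod (map_cat e a J) f"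
  then obtain f' g' where f': "f = a f'" "f' \<in> Arr J" and g': "g = a g'" "g' \<in> Arr J" by blast
  have d': "Dom J g' = Cod J f'" using d f' g' by (simp add: map_simps e_eq_iff dom_obj cod_obj)
  show "Comp (map_cat e a J) g f \<in> a ` Arr J"
    "Dom (map_cat e a J) (Comp (map_cat e a J) g f) = Dom (map_cat e a J) f"
    "Cod (map_cat e a J) (Comp (map_cat e a J) g f) = Cod (map_cat e a J) g"
    using comp_arr[OF f'(2) g'(2) d'] f' g' by (simp_all add: map_simps)
  fix h assume "h \<in> a ` Arr J" and d2: "Dom (map_cat e a J) h = Cod (map_cat e a J) g"
  then obtain h' where h': "h = a h'" "h' \<in> Arr J" by blast
  have d2': "Dom J h' = Cod J g'" using d2 h' g' by (simp add: map_simps e_eq_iff dom_obj cod_obj)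
  show "Comp (map_cat e a J) h (Comp (map_cat e a J) g f) = Comp (map_cat e a J) (Comp (map_cat e a J) h g) f"
    using comp_arr(1)[OF f'(2) g'(2) d'] comp_arr(1)[OF g'(2) h'(2) d2']
      comp_assoc[OF f'(2) g'(2) h'(2) d' d2'] f' g' h' by (simp add: map_simps)
qed

lemma filtered_map:
  assumes J: "filtered_cat \<kappa> J"
  shows "filtered_cat \<kappa> (map_cat e a J)"
  unfolding filtered_cat_def
proof (intro conjI allI impI ballI category_map; (elim conjE)?)
  show "Obj (map_cat e a J) \<noteq> {}" using J by (auto simp: filtered_cat_def map_simps)
next
  fix S assume S: "S \<subseteq> Obj (map_cat e a J)" "|S| <o \<kappa>"
  define S' where "S' = inv_into (Obj J) e ` S"
  have "S' \<subseteq> Obj J" using S(1) inv_into_into[of _ e "Obj J"] by (auto simp: S'_def map_simps)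
  moreover have "|S'| <o \<kappa>" unfolding S'_def by (rule ordLeq_ordLess_trans[OF card_of_image S(2)])
  ultimately obtain z where z: "z \<in> Obj J" "\<And>x. x \<in> S' \<Longrightarrow> hom J x z \<noteq> {}"
    using filtered_cat_bound[OF J] by metis
  have "hom (map_cat e a J) x (e z) \<noteq> {}" if xS: "x \<in> S" for x
  proof -
    obtain x' where x': "x = e x'" "x' \<in> Obj J" using S(1) xS unfolding map_simps by blast
    then have "x' \<in> S'" using xS inj_e by (force simp: S'_def)
    then show ?thesis using z x' by (simp add: hom_map)
  qed
  then show "\<exists>z \<in> Obj (map_cat e a J). \<forall>x \<in> S. hom (map_cat e a J) x z \<noteq> {}"
    using z(1) by (auto simp: map_simps)
next
  fix x y S assume x: "x \<in> Obj (map_cat e a J)" and y: "y \<in> Obj (map_cat e a J)"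
    and S: "S \<subseteq> hom (map_cat e a J) x y" "|S| <o \<kappa>"
  obtain x' y' where x': "x = e x'" "x' \<in> Obj J" and y': "y = e y'" "y' \<in> Obj J"
    using x y by (auto simp: map_simps)
  define S' where "S' = inv_into (Arr J) a ` S"
  have Sa: "S \<subseteq> a ` hom J x' y'" using S(1) x' y' by (simp add: hom_map)
  then have aS: "\<exists>f' \<in> S'. f' \<in> hom J x' y' \<and> f = a f'" if "f \<in> S" for f
    using that inj_a by (force simp: S'_def hom_def)
  have "S' \<subseteq> hom J x' y'" using Sa inj_a by (force simp: S'_def hom_def)
  moreover have "|S'| <o \<kappa>" unfolding S'_def by (rule ordLeq_ordLess_trans[OF card_of_image S(2)])
  ultimately obtain z h where z: "z \<in> Obj J" "h \<in> hom J y' z"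
    "\<And>f g. f \<in> S' \<Longrightarrow> g \<in> S' \<Longrightarrow> Comp J h f = Comp J h g"
    using filtered_cat_coequalize[OF J _ _ x'(2) y'(2)] by metis
  have "Comp (map_cat e a J) (a h) f = Comp (map_cat e a J) (a h) g" if fg: "f \<in> S" "g \<in> S" for f g
  proof -
    obtain f' g' where "f' \<in> S'" "f' \<in> hom J x' y'" "f = a f'" "g' \<in> S'" "g' \<in> hom J x' y'" "g = a g'"
      using aS fg by meson
    then show ?thesis using z(3)[of f' g'] homD[OF z(2)] by (simp add: homD map_simps)
  qed
  moreover have "a h \<in> hom (map_cat e a J) y (e z)" using z y' by (simp add: hom_map)
  ultimately show "\<exists>z \<in> Obj (map_cat e a J). \<exists>h \<in> hom (map_cat e a J) y z.
      \<forall>f \<in> S. \<forall>g \<in> S. Comp (map_cat e a J) h f = Comp (map_cat e a J) h g"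
    using z(1) by (auto simp: map_simps)
qed

definition map_diagram :: "('a, 'b, 'o, 'm) functor_data \<Rightarrow> ('c, 'd, 'o, 'm) functor_data" where
  "map_diagram D = \<lparr>fobj = fobj D \<circ> inv_into (Obj J) e, farr = farr D \<circ> inv_into (Arr J) a\<rparr>"

lemma map_diagram_simps:
  "x \<in> Obj J \<Longrightarrow> fobj (map_diagram D) (e x) = fobj D x"
  "f \<in> Arr J \<Longrightarrow> farr (map_diagram D) (a f) = farr D f"
  using inj_e inj_a by (simp_all add: map_diagram_def)

lemma is_functor_map:
  assumes "is_functor J C D"
  shows "is_functor (map_cat e a J) C (map_diagram D)"
  using assms category_map unfolding is_functor_def
  by (auto simp: map_simps map_diagram_simps cat_simps e_eq_iff)

text \<open>Precomposition with \<open>e\<close> turns cocones on the relabelled diagram into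
  cocones on \<open>D\<close>, so both diagrams have the same universal property.\<close>

lemma is_colimit_map:
  assumes D: "is_colimit C J D X c"
  shows "is_colimit C (map_cat e a J) (map_diagram D) X (c \<circ> inv_into (Obj J) e)"
proof -
  have cocone: "is_cocone C (map_cat e a J) (map_diagram D) Y d \<longleftrightarrow> is_cocone C J D Y (d \<circ> e)" for Y d
    by (auto simp: is_cocone_def map_simps map_diagram_simps)
  have X: "is_cocone C J D X (c \<circ> inv_into (Obj J) e \<circ> e) \<longleftrightarrow> is_cocone C J D X c"
    using inj_e by (auto simp: is_cocone_def dom_obj cod_obj)
  show ?thesis
    unfolding is_colimit_def cocone X
  proof (intro conjI allI impI)
    show "is_cocone C J D X c" using D by (simp add: is_colimit_def)
    fix Y d assume "is_cocone C J D Y (d \<circ> e)"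
    then have "\<exists>!h. h \<in> hom C X Y \<and> (\<forall>j \<in> Obj J. Comp C h (c j) = (d \<circ> e) j)"
      using D unfolding is_colimit_def by blast
    moreover have "(\<forall>j \<in> Obj (map_cat e a J). Comp C h ((c \<circ> inv_into (Obj J) e) j) = d j) \<longleftrightarrow>
        (\<forall>j \<in> Obj J. Comp C h (c j) = (d \<circ> e) j)" for h
      using inj_e by (auto simp: map_simps)
    ultimately show "\<exists>!h. h \<in> hom C X Y \<and>
        (\<forall>j \<in> Obj (map_cat e a J). Comp C h ((c \<circ> inv_into (Obj J) e) j) = d j)" by presburger
  qed
qed

end

section \<open>Arrows from presentable objects into filtered colimits\<close>

lemma ex1_unique: "\<exists>!x. P x \<Longrightarrow> P x \<Longrightarrow> P y \<Longrightarrow> x = y"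
  by blast

text \<open>Joint surjectivity is extracted from the universal property by testing with a
  two-element set. On \<open>hom C S X\<close>, the constant function \<open>a\<close> and the
  function that is \<open>a\<close> exactly on the arrows factoring through some \<open>c j\<close>
  agree after composition with the colimit cocone, so uniqueness makes them equal.\<close>

lemma presentable_factor:
  fixes \<kappa> :: "'u rel"
  assumes U: "inaccessible_universe TYPE('u)" and S: "presentable \<kappa> C S"
    and J: "filtered \<kappa> J" and D: "is_functor J C D" and X: "is_colimit C J D X c"
    and f: "f \<in> hom C S X"
  shows "\<exists>j \<in> Obj J. \<exists>g \<in> hom C S (fobj D j). f = Comp C (c j) g"
proof -
  obtain a b :: 'u where ab: "a \<noteq> b"
    using ex_new_if_finite[OF inaccessible_infinite[OF U], of "{undefined}"] by auto
  have T: "small TYPE('u) {a, b}" by (rule small_finite[OF U]) simp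
  define E where "E = {Comp C (c j) g | j g. j \<in> Obj J \<and> g \<in> hom C S (fobj D j)}"
  define h1 where "h1 = (\<lambda>x \<in> hom C S X. a)"
  define h2 where "h2 = (\<lambda>x \<in> hom C S X. if x \<in> E then a else b)"
  have "category C" using D by (simp add: is_functor_def)
  then interpret category C .
  have cg: "Comp C (c j) g \<in> hom C S X" if "j \<in> Obj J" "g \<in> hom C S (fobj D j)" for j g
    using X that comp unfolding is_colimit_def is_cocone_def by blast
  have "hom_preserves_colimit TYPE('u) C S J D X c"
    using S J D X unfolding presentable_def by blast
  then have ex1: "\<exists>!h. h \<in> hom C S X \<rightarrow>\<^sub>E {a, b} \<and>
      (\<forall>j \<in> Obj J. \<forall>g \<in> hom C S (fobj D j). h (Comp C (c j) g) = a)"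
    unfolding hom_preserves_colimit_def using T
    by (elim allE[of _ "{a, b}"] allE[of _ "\<lambda>_ _. a"]) auto
  have h: "h1 \<in> hom C S X \<rightarrow>\<^sub>E {a, b}" "h2 \<in> hom C S X \<rightarrow>\<^sub>E {a, b}"
    by (auto simp: h1_def h2_def)
  have ha: "h1 (Comp C (c j) g) = a" "h2 (Comp C (c j) g) = a"
    if "j \<in> Obj J" "g \<in> hom C S (fobj D j)" for j g
    using cg[OF that] that by (auto simp: h1_def h2_def E_def)
  have "h1 = h2"
    by (rule ex1_unique[OF ex1]) (use h ha in blast)+
  then have "h1 f = h2 f" by simp
  then have "f \<in> E" using f ab by (auto simp: h1_def h2_def split: if_splits)
  then show ?thesis by (auto simp: E_def)
qed

lemma is_functor_comp:
  assumes "is_functor A B F" "is_functor B C G"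
  shows "is_functor A C (functor_comp G F)"
  using assms unfolding is_functor_def functor_comp_def hom_def
  by (auto simp: category.dom_obj category.cod_obj)

text \<open>The form used below: the index category may live on any types, since it is relabelled on
  the universe type, and \<open>S\<close> maps into the image of the colimit under a functor
  preserving it.\<close>

lemma presentable_factor_filtered_colimit:
  fixes \<kappa> :: "'u rel" and J :: "('a, 'b) cat"
  assumes U: "inaccessible_universe TYPE('u)"
    and J: "filtered_cat \<kappa> J" "small TYPE('u) (Obj J)" "small TYPE('u) (Arr J)"
    and D: "is_functor J C D" and X: "is_colimit C J D X c"
    and R: "is_functor C B R" "preserves_filtered_colimits \<kappa> C B R"
    and S: "presentable \<kappa> B S" and f: "f \<in> hom B S (fobj R X)"
  shows "\<exists>j \<in> Obj J. \<exists>g \<in> hom B S (fobj R (fobj D j)). f = Comp B (farr R (c j)) g"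
proof -
  obtain e :: "'a \<Rightarrow> 'u" where e: "inj_on e (Obj J)" using J(2) by (rule small_embed)
  obtain a :: "'b \<Rightarrow> 'u" where a: "inj_on a (Arr J)" using J(3) by (rule small_embed)
  interpret cat_relabelling J e a
    using J(1) e a by (simp add: cat_relabelling_def cat_relabelling_axioms_def filtered_cat_def)
  have filt: "filtered \<kappa> (map_cat e a J)"
    unfolding filtered_iff using filtered_map[OF J(1)] small_image[OF J(2), of e] small_image[OF J(3), of a]
    by (simp add: map_simps)
  let ?c = "c \<circ> inv_into (Obj J) e"
  have "is_colimit B (map_cat e a J) (functor_comp R (map_diagram D)) (fobj R X) (\<lambda>j. farr R (?c j))"
    using R(2) filt is_functor_map[OF D] is_colimit_map[OF X]
    unfolding preserves_filtered_colimits_def by blast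
  from presentable_factor[OF U S filt is_functor_comp[OF is_functor_map[OF D] R(1)] this f]
  show ?thesis
    using inj_e by (auto simp: map_simps functor_comp_def map_diagram_simps)
qed

section \<open>Coproducts as filtered colimits\<close>

lemma colimitD:
  assumes "is_colimit C J D X c"
  shows "X \<in> Obj C" "j \<in> Obj J \<Longrightarrow> c j \<in> hom C (fobj D j) X"
    "a \<in> Arr J \<Longrightarrow> Comp C (c (Cod J a)) (farr D a) = c (Dom J a)"
  using assms by (auto simp: is_colimit_def is_cocone_def)

lemma colimit_ex1:
  assumes "is_colimit C J D X c" "is_cocone C J D Y d"
  shows "\<exists>!h. h \<in> hom C X Y \<and> (\<forall>j \<in> Obj J. Comp C h (c j) = d j)"
  using assms unfolding is_colimit_def by blast

lemma colimit_desc: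
  assumes "is_colimit C J D X c" "is_cocone C J D Y d"
  obtains h where "h \<in> hom C X Y" "\<And>j. j \<in> Obj J \<Longrightarrow> Comp C h (c j) = d j"
  using colimit_ex1[OF assms] by blast

lemma functorD:
  assumes "is_functor J C D"
  shows "category J" "category C" "j \<in> Obj J \<Longrightarrow> fobj D j \<in> Obj C"
    "j \<in> Obj J \<Longrightarrow> farr D (Ident J j) = Ident C (fobj D j)"
    "a \<in> hom J x y \<Longrightarrow> farr D a \<in> hom C (fobj D x) (fobj D y)"
    "a \<in> hom J x y \<Longrightarrow> b \<in> hom J y z \<Longrightarrow> farr D (Comp J b a) = Comp C (farr D b) (farr D a)"
  using assms by (auto simp: is_functor_def hom_def)

lemma (in category) colimit_eq:
  assumes X: "is_colimit C J D X c" and D: "is_functor J C D" and h: "h \<in> hom C X Y" "h' \<in> hom C X Y"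
    and eq: "\<And>j. j \<in> Obj J \<Longrightarrow> Comp C h (c j) = Comp C h' (c j)"
  shows "h = h'"
proof -
  interpret J: category J by (rule functorD[OF D])
  have cocone: "is_cocone C J D Y (\<lambda>j. Comp C h (c j))"
    unfolding is_cocone_def
  proof (intro conjI ballI)
    show "Y \<in> Obj C" using hom_obj h by blast
    show "Comp C h (c j) \<in> hom C (fobj D j) Y" if "j \<in> Obj J" for j
      using comp[OF colimitD(2)[OF X that] h(1)] .
    fix a assume a: "a \<in> Arr J"
    then have "farr D a \<in> hom C (fobj D (Dom J a)) (fobj D (Cod J a))"
      by (intro functorD(5)[OF D]) (simp add: hom_def)
    from assoc[OF this colimitD(2)[OF X J.cod_obj[OF a]] h(1)]
    show "Comp C (Comp C h (c (Cod J a))) (farr D a) = Comp C h (c (Dom J a))"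
      using colimitD(3)[OF X a] by simp
  qed
  show ?thesis
    by (rule ex1_unique[OF colimit_ex1[OF X cocone]]) (use h eq in auto)
qed

text \<open>The index set \<open>I j\<close> may grow with \<open>j\<close>. The diagram of
  subcoproducts has \<open>I A = A\<close> and identities for \<open>\<phi>\<close>; the diagram
  over a product category has a constant index set and takes \<open>\<phi>\<close> from the diagrams
  on the factors.\<close>

lemma (in category) coproduct_functor:
  assumes J: "category J"
    and P: "\<And>j. j \<in> Obj J \<Longrightarrow> is_coproduct C (I j) (X j) (P j) (\<iota> j)"
    and sub: "\<And>a. a \<in> Arr J \<Longrightarrow> I (Dom J a) \<subseteq> I (Cod J a)"
    and \<phi>: "\<And>a i. a \<in> Arr J \<Longrightarrow> i \<in> I (Dom J a) \<Longrightarrow> \<phi> a i \<in> hom C (X (Dom J a) i) (X (Cod J a) i)"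
    and \<phi>_ident: "\<And>j i. j \<in> Obj J \<Longrightarrow> i \<in> I j \<Longrightarrow> \<phi> (Ident J j) i = Ident C (X j i)"
    and \<phi>_comp: "\<And>a b i. a \<in> Arr J \<Longrightarrow> b \<in> Arr J \<Longrightarrow> Dom J b = Cod J a \<Longrightarrow> i \<in> I (Dom J a) \<Longrightarrow>
      \<phi> (Comp J b a) i = Comp C (\<phi> b i) (\<phi> a i)"
  obtains D where "is_functor J C D" "\<And>j. fobj D j = P j"
    "\<And>a i. a \<in> Arr J \<Longrightarrow> i \<in> I (Dom J a) \<Longrightarrow>
      Comp C (farr D a) (\<iota> (Dom J a) i) = Comp C (\<iota> (Cod J a) i) (\<phi> a i)"
proof -
  interpret J: category J by (rule J)
  have inj: "\<iota> j i \<in> hom C (X j i) (P j)" if "j \<in> Obj J" "i \<in> I j" for j i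
    using coproduct_inj[OF P[OF that(1)] that(2)] .
  have "\<exists>h. h \<in> hom C (P (Dom J a)) (P (Cod J a)) \<and>
      (\<forall>i \<in> I (Dom J a). Comp C h (\<iota> (Dom J a) i) = Comp C (\<iota> (Cod J a) i) (\<phi> a i))"
    if a: "a \<in> Arr J" for a
  proof (rule coproduct_desc[OF P[OF J.dom_obj[OF a]] coproduct_obj[OF P[OF J.cod_obj[OF a]]]])
    show "Comp C (\<iota> (Cod J a) i) (\<phi> a i) \<in> hom C (X (Dom J a) i) (P (Cod J a))"
      if "i \<in> I (Dom J a)" for i
      using comp[OF \<phi>[OF a that] inj[OF J.cod_obj[OF a]]] sub[OF a] that by blast
  qed blast
  then obtain F where F: "\<And>a. a \<in> Arr J \<Longrightarrow> F a \<in> hom C (P (Dom J a)) (P (Cod J a))"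
    "\<And>a i. a \<in> Arr J \<Longrightarrow> i \<in> I (Dom J a) \<Longrightarrow>
      Comp C (F a) (\<iota> (Dom J a) i) = Comp C (\<iota> (Cod J a) i) (\<phi> a i)" by metis
  define D where "D = \<lparr>fobj = P, farr = F\<rparr>"
  have "is_functor J C D"
    unfolding is_functor_def D_def functor_data.simps
  proof (intro conjI ballI impI J category_axioms F(1))
    fix j assume j: "j \<in> Obj J"
    show Pj: "P j \<in> Obj C" using coproduct_obj[OF P[OF j]] .
    show "F (Ident J j) = Ident C (P j)"
    proof (rule coproduct_eq[OF P[OF j]])
      show "F (Ident J j) \<in> hom C (P j) (P j)" "Ident C (P j) \<in> hom C (P j) (P j)"
        using F(1)[of "Ident J j"] J.ident_arr[OF j] ident[OF Pj] by simp_all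
      show "Comp C (F (Ident J j)) (\<iota> j i) = Comp C (Ident C (P j)) (\<iota> j i)" if "i \<in> I j" for i
        using F(2)[of "Ident J j" i] J.ident_arr[OF j] that \<phi>_ident[OF j that] inj[OF j that]
        by (simp add: ident_left ident_right)
    qed
  next
    fix a b assume a: "a \<in> Arr J" and b: "b \<in> Arr J" and ab: "Dom J b = Cod J a"
    note ba = J.comp_arr[OF a b ab]
    have Fa: "F a \<in> hom C (P (Dom J a)) (P (Cod J a))" and Fb: "F b \<in> hom C (P (Cod J a)) (P (Cod J b))"
      using F(1)[OF a] F(1)[OF b] ab by simp_all
    show "F (Comp J b a) = Comp C (F b) (F a)"
    proof (rule coproduct_eq[OF P[OF J.dom_obj[OF a]]])
      show "F (Comp J b a) \<in> hom C (P (Dom J a)) (P (Cod J b))" using F(1)[OF ba(1)] ba by simp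
      show "Comp C (F b) (F a) \<in> hom C (P (Dom J a)) (P (Cod J b))" using comp[OF Fa Fb] .
      fix i assume i: "i \<in> I (Dom J a)"
      then have i': "i \<in> I (Dom J b)" using sub[OF a] ab by auto
      then have i'': "i \<in> I (Cod J b)" using sub[OF b] by auto
      have \<phi>a: "\<phi> a i \<in> hom C (X (Dom J a) i) (X (Dom J b) i)" using \<phi>[OF a i] ab by simp
      have "Comp C (Comp C (F b) (F a)) (\<iota> (Dom J a) i) = Comp C (F b) (Comp C (\<iota> (Dom J b) i) (\<phi> a i))"
        using assoc[OF inj[OF J.dom_obj[OF a] i] Fa Fb] F(2)[OF a i] ab by simp
      also have "\<dots> = Comp C (Comp C (\<iota> (Cod J b) i) (\<phi> b i)) (\<phi> a i)"
        using assoc[OF \<phi>a inj[OF J.dom_obj[OF b] i'] F(1)[OF b]] F(2)[OF b i'] by simp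
      also have "\<dots> = Comp C (F (Comp J b a)) (\<iota> (Dom J a) i)"
        using assoc[OF \<phi>a \<phi>[OF b i'] inj[OF J.cod_obj[OF b] i'']] F(2)[OF ba(1)] i ba \<phi>_comp[OF a b ab i]
        by simp
      finally show "Comp C (F (Comp J b a)) (\<iota> (Dom J a) i) = Comp C (Comp C (F b) (F a)) (\<iota> (Dom J a) i)"
        by (rule sym)
    qed
  qed
  then show ?thesis using that[of D] F(2) by (simp add: D_def)
qed

section \<open>A coproduct as the colimit of its subcoproducts of size less than
  \<open>\<kappa>\<close>\<close>

lemma finite_ordLess_regular:
  assumes "regular_cardinal \<kappa>" "finite A" shows "|A| <o \<kappa>"
  using assms by (intro Cfinite_ordLess_Cinfinite)
    (simp_all add: regular_cardinal_def cfinite_def Field_card_of card_of_card_order_on)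

definition subset_cat :: "'k rel \<Rightarrow> 'i set \<Rightarrow> ('i set, 'i set \<times> 'i set) cat" where
  "subset_cat \<kappa> I = \<lparr>Obj = {A. A \<subseteq> I \<and> |A| <o \<kappa>},
     Arr = {(A, B). A \<subseteq> B \<and> B \<subseteq> I \<and> |A| <o \<kappa> \<and> |B| <o \<kappa>},
     Dom = fst, Cod = snd, Ident = (\<lambda>A. (A, A)), Comp = (\<lambda>g f. (fst f, snd g))\<rparr>"

text \<open>By regularity of \<open>\<kappa>\<close>, the union of fewer than
  \<open>\<kappa>\<close> subsets of size less than \<open>\<kappa>\<close> is again an object.
  Parallel arrows of a poset are equal, so an identity coequalizes them.\<close>

lemma filtered_subset_cat:
  assumes \<kappa>: "regular_cardinal \<kappa>"
  shows "filtered_cat \<kappa> (subset_cat \<kappa> I)"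
  unfolding filtered_cat_def
proof (intro conjI allI impI ballI; (elim conjE)?)
  show "category (subset_cat \<kappa> I)"
    by (rule categoryI_arr, auto simp: subset_cat_def) blast
  show "Obj (subset_cat \<kappa> I) \<noteq> {}"
    using finite_ordLess_regular[OF \<kappa>, of "{}"] by (auto simp: subset_cat_def)
next
  fix S assume S: "S \<subseteq> Obj (subset_cat \<kappa> I)" "|S| <o \<kappa>"
  have "|\<Union>A \<in> S. A| <o \<kappa>"
    using \<kappa> S by (intro card_of_UNION_ordLess_infinite_Field_regularCard)
      (auto simp: regular_cardinal_def subset_cat_def)
  then show "\<exists>z \<in> Obj (subset_cat \<kappa> I). \<forall>x \<in> S. hom (subset_cat \<kappa> I) x z \<noteq> {}"
    using S(1) by (intro bexI[of _ "\<Union>S"]) (auto simp: subset_cat_def hom_def)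
next
  fix x y S assume y: "y \<in> Obj (subset_cat \<kappa> I)" and S: "S \<subseteq> hom (subset_cat \<kappa> I) x y"
  have "fst f = x" if "f \<in> S" for f using S that by (auto simp: hom_def subset_cat_def)
  then have "\<forall>f \<in> S. \<forall>g \<in> S. Comp (subset_cat \<kappa> I) (y, y) f = Comp (subset_cat \<kappa> I) (y, y) g"
    by (simp add: subset_cat_def)
  moreover have "(y, y) \<in> hom (subset_cat \<kappa> I) y y" using y by (simp add: subset_cat_def hom_def)
  ultimately show "\<exists>z \<in> Obj (subset_cat \<kappa> I). \<exists>h \<in> hom (subset_cat \<kappa> I) y z.
      \<forall>f \<in> S. \<forall>g \<in> S. Comp (subset_cat \<kappa> I) h f = Comp (subset_cat \<kappa> I) h g"
    using y by blast
qed

lemma small_subset_cat: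
  assumes U: "inaccessible_universe TYPE('u)" and I: "small TYPE('u) I"
  shows "small TYPE('u) (Obj (subset_cat \<kappa> I))" "small TYPE('u) (Arr (subset_cat \<kappa> I))"
  using small_subset[OF small_Pow[OF U I], of "Obj (subset_cat \<kappa> I)"]
    small_subset[OF small_Times[OF U small_Pow[OF U I] small_Pow[OF U I]], of "Arr (subset_cat \<kappa> I)"]
  by (force simp: subset_cat_def)+

text \<open>A cocone is determined by its components at singletons, which belong to the diagram
  because \<open>\<kappa>\<close> is infinite.\<close>

lemma (in category) coproduct_subset_colimit:
  assumes \<kappa>: "regular_cardinal \<kappa>" and P: "is_coproduct C I X P \<iota>"
    and Q: "\<And>A. A \<subseteq> I \<Longrightarrow> |A| <o \<kappa> \<Longrightarrow> is_coproduct C A X (Q A) (\<theta> A)"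
  obtains D c where "is_functor (subset_cat \<kappa> I) C D" "is_colimit C (subset_cat \<kappa> I) D P c"
    "\<And>A. fobj D A = Q A"
    "\<And>A i. A \<subseteq> I \<Longrightarrow> |A| <o \<kappa> \<Longrightarrow> i \<in> A \<Longrightarrow> Comp C (c A) (\<theta> A i) = \<iota> i"
proof -
  let ?J = "subset_cat \<kappa> I"
  have catJ: "category ?J"
    using filtered_catD(1)[OF filtered_subset_cat[OF \<kappa>]] .
  have ObjJ: "A \<in> Obj ?J \<longleftrightarrow> A \<subseteq> I \<and> |A| <o \<kappa>" for A by (simp add: subset_cat_def)
  have X: "X i \<in> Obj C" if "i \<in> I" for i using hom_obj(1)[OF coproduct_inj[OF P that]] .
  have QJ: "is_coproduct C A X (Q A) (\<theta> A)" if "A \<in> Obj ?J" for A using Q that by (simp add: ObjJ)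
  have ArrJ: "Dom ?J a \<in> Obj ?J" "Cod ?J a \<in> Obj ?J" "Dom ?J a \<subseteq> Cod ?J a" if "a \<in> Arr ?J" for a
    using that by (auto simp: subset_cat_def)
  have dI: "i \<in> I" if "a \<in> Arr ?J" "i \<in> Dom ?J a" for a i using ArrJ(1)[OF that(1)] that(2) ObjJ by blast
  obtain D where D: "is_functor ?J C D" "\<And>A. fobj D A = Q A"
    and D\<theta>: "\<And>a i. a \<in> Arr ?J \<Longrightarrow> i \<in> Dom ?J a \<Longrightarrow>
      Comp C (farr D a) (\<theta> (Dom ?J a) i) = Comp C (\<theta> (Cod ?J a) i) (Ident C (X i))"
  proof (rule coproduct_functor[OF catJ, of "\<lambda>A. A" "\<lambda>_. X" Q \<theta> "\<lambda>_ i. Ident C (X i)"])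
  qed (use QJ ArrJ ident X dI ObjJ ident_left[OF ident[OF X]] that in \<open>auto\<close>)
  have "\<exists>h. h \<in> hom C (Q A) P \<and> (\<forall>i \<in> A. Comp C h (\<theta> A i) = \<iota> i)" if A: "A \<in> Obj ?J" for A
    by (rule coproduct_desc[OF QJ[OF A] coproduct_obj[OF P], of \<iota>])
      (use A coproduct_inj[OF P] ObjJ in blast)+
  then obtain c where c: "\<And>A. A \<in> Obj ?J \<Longrightarrow> c A \<in> hom C (Q A) P"
    "\<And>A i. A \<in> Obj ?J \<Longrightarrow> i \<in> A \<Longrightarrow> Comp C (c A) (\<theta> A i) = \<iota> i" by metis
  have inj: "\<theta> A i \<in> hom C (X i) (Q A)" if "A \<in> Obj ?J" "i \<in> A" for A i
    using coproduct_inj[OF QJ[OF that(1)] that(2)] .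
  have Da: "farr D a \<in> hom C (Q (Dom ?J a)) (Q (Cod ?J a))" if "a \<in> Arr ?J" for a
    using functorD(5)[OF D(1), of a "Dom ?J a" "Cod ?J a"] that D(2) by (simp add: hom_def)
  have D\<theta>': "Comp C (farr D a) (\<theta> (Dom ?J a) i) = \<theta> (Cod ?J a) i" if "a \<in> Arr ?J" "i \<in> Dom ?J a" for a i
    using D\<theta>[OF that] ident_right[OF inj[OF ArrJ(2)[OF that(1)], of i]] ArrJ(3)[OF that(1)] that(2) by auto
  have sing: "{i} \<in> Obj ?J" if "i \<in> I" for i
    using finite_ordLess_regular[OF \<kappa>, of "{i}"] that by (simp add: ObjJ)
  have "is_colimit C ?J D P c"
    unfolding is_colimit_def
  proof (intro conjI allI impI)
    show "is_cocone C ?J D P c"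
      unfolding is_cocone_def D(2)
    proof (intro conjI ballI)
      show "P \<in> Obj C" by (rule coproduct_obj[OF P])
      show "c A \<in> hom C (Q A) P" if "A \<in> Obj ?J" for A using c(1)[OF that] .
      fix a assume a: "a \<in> Arr ?J"
      note ca = c(1)[OF ArrJ(2)[OF a]]
      show "Comp C (c (Cod ?J a)) (farr D a) = c (Dom ?J a)"
      proof (rule coproduct_eq[OF QJ[OF ArrJ(1)[OF a]] comp[OF Da[OF a] ca] c(1)[OF ArrJ(1)[OF a]]])
        fix i assume i: "i \<in> Dom ?J a"
        show "Comp C (Comp C (c (Cod ?J a)) (farr D a)) (\<theta> (Dom ?J a) i) = Comp C (c (Dom ?J a)) (\<theta> (Dom ?J a) i)"
          using assoc[OF inj[OF ArrJ(1)[OF a] i] Da[OF a] ca] D\<theta>'[OF a i] c(2)[OF ArrJ(1)[OF a] i]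
            c(2)[OF ArrJ(2)[OF a], of i] ArrJ(3)[OF a] i by auto
      qed
    qed
    fix Y d assume "is_cocone C ?J D Y d"
    then have Y: "Y \<in> Obj C" and d: "\<And>A. A \<in> Obj ?J \<Longrightarrow> d A \<in> hom C (Q A) Y"
      and dc: "\<And>a. a \<in> Arr ?J \<Longrightarrow> Comp C (d (Cod ?J a)) (farr D a) = d (Dom ?J a)"
      unfolding is_cocone_def D(2) by auto
    \<comment> \<open>The inclusion of \<open>{i}\<close> into \<open>A\<close> is an arrow of the
      diagram, so on the summand \<open>i\<close> the component at \<open>A\<close> agrees with the
      component at \<open>{i}\<close>.\<close>
    have d\<theta>: "Comp C (d A) (\<theta> A i) = Comp C (d {i}) (\<theta> {i} i)" if A: "A \<in> Obj ?J" and i: "i \<in> A" for A i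
    proof -
      have iI: "i \<in> I" using A i ObjJ by blast
      have a: "({i}, A) \<in> Arr ?J" using A i sing[OF iI] by (auto simp: subset_cat_def)
      have [simp]: "Dom ?J ({i}, A) = {i}" "Cod ?J ({i}, A) = A" by (simp_all add: subset_cat_def)
      show ?thesis
        using assoc[OF inj[OF sing[OF iI], of i] Da[OF a, simplified] d[OF A]] dc[OF a] D\<theta>'[OF a, of i] by simp
    qed
    have di: "Comp C (d {i}) (\<theta> {i} i) \<in> hom C (X i) Y" if "i \<in> I" for i
      using comp[OF inj[OF sing[OF that]] d[OF sing[OF that]]] by simp
    obtain h where h: "h \<in> hom C P Y" "\<And>i. i \<in> I \<Longrightarrow> Comp C h (\<iota> i) = Comp C (d {i}) (\<theta> {i} i)"
      using coproduct_desc[OF P Y di] by metis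
    show "\<exists>!h. h \<in> hom C P Y \<and> (\<forall>A \<in> Obj ?J. Comp C h (c A) = d A)"
    proof (rule ex1I[of _ h], intro conjI ballI h(1))
      fix A assume A: "A \<in> Obj ?J"
      show "Comp C h (c A) = d A"
      proof (rule coproduct_eq[OF QJ[OF A] comp[OF c(1)[OF A] h(1)] d[OF A]])
        fix i assume i: "i \<in> A"
        then have "i \<in> I" using A ObjJ by blast
        then show "Comp C (Comp C h (c A)) (\<theta> A i) = Comp C (d A) (\<theta> A i)"
          using assoc[OF inj[OF A i] c(1)[OF A] h(1)] c(2)[OF A i] h(2)[of i] d\<theta>[OF A i] by simp
      qed
    next
      fix h' assume h': "h' \<in> hom C P Y \<and> (\<forall>A \<in> Obj ?J. Comp C h' (c A) = d A)"
      show "h' = h"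
      proof (rule coproduct_eq[OF P conjunct1[OF h'] h(1)])
        fix i assume i: "i \<in> I"
        show "Comp C h' (\<iota> i) = Comp C h (\<iota> i)"
          using assoc[OF inj[OF sing[OF i], of i] c(1)[OF sing[OF i]] conjunct1[OF h']]
            c(2)[OF sing[OF i], of i] h(2)[OF i] h' sing[OF i] by simp
      qed
    qed
  qed
  then show ?thesis using that D c(2) ObjJ by blast
qed

section \<open>Products of filtered categories, and coproducts of filtered colimits\<close>

definition prod_cat :: "'i set \<Rightarrow> ('i \<Rightarrow> ('a, 'b) cat) \<Rightarrow> ('i \<Rightarrow> 'a, 'i \<Rightarrow> 'b) cat" where
  "prod_cat I J = \<lparr>Obj = PiE I (\<lambda>i. Obj (J i)), Arr = PiE I (\<lambda>i. Arr (J i)),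
     Dom = (\<lambda>f. \<lambda>i \<in> I. Dom (J i) (f i)), Cod = (\<lambda>f. \<lambda>i \<in> I. Cod (J i) (f i)),
     Ident = (\<lambda>x. \<lambda>i \<in> I. Ident (J i) (x i)), Comp = (\<lambda>g f. \<lambda>i \<in> I. Comp (J i) (g i) (f i))\<rparr>"

lemma prod_cat_simps:
  "Obj (prod_cat I J) = PiE I (\<lambda>i. Obj (J i))" "Arr (prod_cat I J) = PiE I (\<lambda>i. Arr (J i))"
  "Dom (prod_cat I J) f = (\<lambda>i \<in> I. Dom (J i) (f i))" "Cod (prod_cat I J) f = (\<lambda>i \<in> I. Cod (J i) (f i))"
  "Ident (prod_cat I J) x = (\<lambda>i \<in> I. Ident (J i) (x i))"
  "Comp (prod_cat I J) g f = (\<lambda>i \<in> I. Comp (J i) (g i) (f i))"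
  by (simp_all add: prod_cat_def)

lemma hom_prod_cat:
  assumes "x \<in> PiE I (\<lambda>i. Obj (J i))" "y \<in> PiE I (\<lambda>i. Obj (J i))"
  shows "hom (prod_cat I J) x y = PiE I (\<lambda>i. hom (J i) (x i) (y i))"
proof -
  have "(\<lambda>i \<in> I. u i) = z \<longleftrightarrow> (\<forall>i \<in> I. u i = z i)" if "z \<in> PiE I (\<lambda>i. Obj (J i))" for u z
    using that by (auto simp: PiE_def extensional_def fun_eq_iff restrict_def)
  note r = this[OF assms(1)] this[OF assms(2)]
  show ?thesis unfolding hom_def prod_cat_simps r by (auto simp: PiE_iff intro: extensional_arb)
qed

lemma category_prod_cat:
  assumes "\<And>i. i \<in> I \<Longrightarrow> category (J i)"
  shows "category (prod_cat I J)"
proof -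
  have eqI: "Dom (J i) (g i) = Cod (J i) (f i)"
    if "(\<lambda>i \<in> I. Dom (J i) (g i)) = (\<lambda>i \<in> I. Cod (J i) (f i))" "i \<in> I" for f g i
    using fun_cong[OF that(1), of i] that(2) by simp
  note J = category.comp_arr[OF assms] category.ident_arr[OF assms] category.dom_obj[OF assms]
    category.cod_obj[OF assms] category.comp_assoc[OF assms] category.comp_ident_left[OF assms]
    category.comp_ident_right[OF assms]
  show ?thesis
  proof (rule categoryI_arr, unfold prod_cat_simps)
    fix f g h assume fgh: "f \<in> (\<Pi>\<^sub>E i\<in>I. Arr (J i))" "g \<in> (\<Pi>\<^sub>E i\<in>I. Arr (J i))" "h \<in> (\<Pi>\<^sub>E i\<in>I. Arr (J i))"
      and e: "(\<lambda>i\<in>I. Dom (J i) (g i)) = (\<lambda>i\<in>I. Cod (J i) (f i))" "(\<lambda>i\<in>I. Dom (J i) (h i)) = (\<lambda>i\<in>I. Cod (J i) (g i))"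
    show "(\<lambda>i\<in>I. Comp (J i) (h i) ((\<lambda>i\<in>I. Comp (J i) (g i) (f i)) i)) =
      (\<lambda>i\<in>I. Comp (J i) ((\<lambda>i\<in>I. Comp (J i) (h i) (g i)) i) (f i))"
      using fgh[THEN PiE_mem] eqI[OF e(1)] eqI[OF e(2)] by (auto intro!: restrict_ext simp: J)
  next
    fix f g assume fg: "f \<in> (\<Pi>\<^sub>E i\<in>I. Arr (J i))" "g \<in> (\<Pi>\<^sub>E i\<in>I. Arr (J i))"
      and e: "(\<lambda>i\<in>I. Dom (J i) (g i)) = (\<lambda>i\<in>I. Cod (J i) (f i))"
    show "(\<lambda>i\<in>I. Comp (J i) (g i) (f i)) \<in> (\<Pi>\<^sub>E i\<in>I. Arr (J i))"
      "(\<lambda>i\<in>I. Dom (J i) ((\<lambda>i\<in>I. Comp (J i) (g i) (f i)) i)) = (\<lambda>i\<in>I. Dom (J i) (f i))"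
      "(\<lambda>i\<in>I. Cod (J i) ((\<lambda>i\<in>I. Comp (J i) (g i) (f i)) i)) = (\<lambda>i\<in>I. Cod (J i) (g i))"
      using fg[THEN PiE_mem] eqI[OF e] by (auto intro!: restrict_ext simp: J)
  next
    fix f assume f: "f \<in> (\<Pi>\<^sub>E i\<in>I. Arr (J i))"
    have fr: "(\<lambda>i\<in>I. f i) = f" using f by (rule PiE_restrict)
    show "(\<lambda>i\<in>I. Comp (J i) ((\<lambda>i\<in>I. Ident (J i) ((\<lambda>i\<in>I. Cod (J i) (f i)) i)) i) (f i)) = f"
      "(\<lambda>i\<in>I. Comp (J i) (f i) ((\<lambda>i\<in>I. Ident (J i) ((\<lambda>i\<in>I. Dom (J i) (f i)) i)) i)) = f"
      by (rule trans[OF restrict_ext fr], use f[THEN PiE_mem] in \<open>simp add: J\<close>)+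
  next
    fix x assume x: "x \<in> (\<Pi>\<^sub>E i\<in>I. Obj (J i))"
    have xr: "(\<lambda>i\<in>I. x i) = x" using x by (rule PiE_restrict)
    show "(\<lambda>i\<in>I. Dom (J i) ((\<lambda>i\<in>I. Ident (J i) (x i)) i)) = x"
      "(\<lambda>i\<in>I. Cod (J i) ((\<lambda>i\<in>I. Ident (J i) (x i)) i)) = x"
      by (rule trans[OF restrict_ext xr], use x[THEN PiE_mem] in \<open>simp add: J\<close>)+
  qed (auto intro: category.dom_obj[OF assms] category.cod_obj[OF assms]
      category.ident_arr(1)[OF assms] dest: PiE_mem)
qed

text \<open>Upper bounds and coequalizing arrows are chosen in each coordinate, because the
  \<open>i\<close>-th projection of a set of size less than \<open>\<kappa>\<close> has size less
  than \<open>\<kappa>\<close>.\<close>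

lemma filtered_prod_cat:
  assumes J: "\<And>i. i \<in> I \<Longrightarrow> filtered_cat \<kappa> (J i)"
  shows "filtered_cat \<kappa> (prod_cat I J)"
  unfolding filtered_cat_def
proof (intro conjI allI impI ballI; (elim conjE)?)
  show "category (prod_cat I J)" using J by (intro category_prod_cat) (simp add: filtered_cat_def)
  show "Obj (prod_cat I J) \<noteq> {}"
    using J by (auto simp: prod_cat_simps PiE_eq_empty_iff filtered_cat_def)
next
  fix S assume S: "S \<subseteq> Obj (prod_cat I J)" "|S| <o \<kappa>"
  have "\<exists>z. z \<in> Obj (J i) \<and> (\<forall>x \<in> S. hom (J i) (x i) z \<noteq> {})" if i: "i \<in> I" for i
  proof (rule filtered_cat_bound[OF J[OF i]])
    show "(\<lambda>x. x i) ` S \<subseteq> Obj (J i)" using S(1) i by (auto simp: prod_cat_simps)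
    show "|(\<lambda>x. x i) ` S| <o \<kappa>" by (rule ordLeq_ordLess_trans[OF card_of_image S(2)])
  qed blast
  then obtain z where z: "\<And>i. i \<in> I \<Longrightarrow> z i \<in> Obj (J i)"
    "\<And>i x. i \<in> I \<Longrightarrow> x \<in> S \<Longrightarrow> hom (J i) (x i) (z i) \<noteq> {}" by metis
  have zI: "restrict z I \<in> PiE I (\<lambda>i. Obj (J i))" using z(1) by auto
  moreover have "hom (prod_cat I J) x (restrict z I) \<noteq> {}" if "x \<in> S" for x
    using S(1) that z(2) by (subst hom_prod_cat[OF _ zI]) (auto simp: prod_cat_simps PiE_eq_empty_iff)
  ultimately show "\<exists>z \<in> Obj (prod_cat I J). \<forall>x \<in> S. hom (prod_cat I J) x z \<noteq> {}"
    by (intro bexI[of _ "restrict z I"]) (auto simp: prod_cat_simps)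
next
  fix x y S assume x: "x \<in> Obj (prod_cat I J)" and y: "y \<in> Obj (prod_cat I J)"
    and S: "S \<subseteq> hom (prod_cat I J) x y" "|S| <o \<kappa>"
  have x': "x \<in> PiE I (\<lambda>i. Obj (J i))" and y': "y \<in> PiE I (\<lambda>i. Obj (J i))"
    using x y by (simp_all add: prod_cat_simps)
  have SP: "S \<subseteq> PiE I (\<lambda>i. hom (J i) (x i) (y i))" using S(1) hom_prod_cat[OF x' y'] by simp
  have "\<exists>z h. z \<in> Obj (J i) \<and> h \<in> hom (J i) (y i) z \<and>
      (\<forall>f \<in> S. \<forall>g \<in> S. Comp (J i) h (f i) = Comp (J i) h (g i))" if i: "i \<in> I" for i
  proof (rule filtered_cat_coequalize[OF J[OF i]])
    show "(\<lambda>f. f i) ` S \<subseteq> hom (J i) (x i) (y i)" using SP i by (auto dest: PiE_mem)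
    show "|(\<lambda>f. f i) ` S| <o \<kappa>" by (rule ordLeq_ordLess_trans[OF card_of_image S(2)])
    show "x i \<in> Obj (J i)" "y i \<in> Obj (J i)" using PiE_mem[OF x' i] PiE_mem[OF y' i] .
  qed blast
  then obtain z h where z: "\<And>i. i \<in> I \<Longrightarrow> z i \<in> Obj (J i)" "\<And>i. i \<in> I \<Longrightarrow> h i \<in> hom (J i) (y i) (z i)"
    and c: "\<And>i. i \<in> I \<Longrightarrow> \<forall>f \<in> S. \<forall>g \<in> S. Comp (J i) (h i) (f i) = Comp (J i) (h i) (g i)" by metis
  have zI: "restrict z I \<in> PiE I (\<lambda>i. Obj (J i))" using z(1) by auto
  have hI: "restrict h I \<in> hom (prod_cat I J) y (restrict z I)"
    using z(2) by (subst hom_prod_cat[OF y' zI]) auto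
  have "Comp (prod_cat I J) (restrict h I) f = Comp (prod_cat I J) (restrict h I) g"
    if fg: "f \<in> S" "g \<in> S" for f g
    unfolding prod_cat_simps
  proof (rule restrict_ext)
    fix i assume i: "i \<in> I"
    show "Comp (J i) (restrict h I i) (f i) = Comp (J i) (restrict h I i) (g i)"
      using c[OF i, THEN bspec, OF fg(1), THEN bspec, OF fg(2)] i by (simp only: restrict_apply if_True)
  qed
  then show "\<exists>z \<in> Obj (prod_cat I J). \<exists>h \<in> hom (prod_cat I J) y z.
      \<forall>f \<in> S. \<forall>g \<in> S. Comp (prod_cat I J) h f = Comp (prod_cat I J) h g"
    using zI hI unfolding prod_cat_simps(1) by blast
qed

text \<open>Objects and arrows of \<open>prod_cat\<close> are extensional functions, so that they
  form products of small sets with no freedom outside \<open>I\<close>.\<close>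

lemma small_prod_cat:
  assumes U: "inaccessible_universe TYPE('u)" and I: "small TYPE('u) I"
    and "\<And>i. i \<in> I \<Longrightarrow> small TYPE('u) (Obj (J i))" "\<And>i. i \<in> I \<Longrightarrow> small TYPE('u) (Arr (J i))"
  shows "small TYPE('u) (Obj (prod_cat I J))" "small TYPE('u) (Arr (prod_cat I J))"
  using small_PiE[OF U I assms(3)] small_PiE[OF U I assms(4)] by (simp_all add: prod_cat_simps)

text \<open>A cocone on the product diagram amounts to one cocone on each \<open>D i\<close>,
  because its component on the summand \<open>i\<close> depends on the \<open>i\<close>-th
  coordinate alone. These cocones induce arrows out of the \<open>X i\<close>, hence one out of
  \<open>P\<close>.\<close>

lemma (in category) product_coproduct_colimit:
  assumes \<kappa>: "regular_cardinal \<kappa>"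
    and J: "\<And>i. i \<in> I \<Longrightarrow> filtered_cat \<kappa> (J i)"
    and D: "\<And>i. i \<in> I \<Longrightarrow> is_functor (J i) C (D i)"
    and c: "\<And>i. i \<in> I \<Longrightarrow> is_colimit C (J i) (D i) (X i) (c i)"
    and P: "is_coproduct C I X P \<iota>"
    and Q: "\<And>x. x \<in> PiE I (\<lambda>i. Obj (J i)) \<Longrightarrow>
      is_coproduct C I (\<lambda>i. fobj (D i) (x i)) (Q x) (\<theta> x)"
  obtains F d where "is_functor (prod_cat I J) C F" "is_colimit C (prod_cat I J) F P d"
    "\<And>x. fobj F x = Q x"
    "\<And>x i. x \<in> PiE I (\<lambda>i. Obj (J i)) \<Longrightarrow> i \<in> I \<Longrightarrow>
      Comp C (d x) (\<theta> x i) = Comp C (\<iota> i) (c i (x i))"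
proof -
  let ?J = "prod_cat I J"
  let ?O = "PiE I (\<lambda>i. Obj (J i))"
  have filt: "filtered_cat \<kappa> ?J" by (rule filtered_prod_cat) (rule J)
  have catJ: "category ?J" and ne: "Obj ?J \<noteq> {}" using filtered_catD[OF filt] by simp_all
  interpret JJ: category ?J by (rule catJ)
  have Ji: "category (J i)" if "i \<in> I" for i using functorD(1)[OF D[OF that]] .
  have ArrI: "a i \<in> hom (J i) (Dom ?J a i) (Cod ?J a i)" if "a \<in> Arr ?J" "i \<in> I" for a i
    using PiE_mem[OF that(1)[unfolded prod_cat_simps] that(2)] that(2) by (simp add: hom_def prod_cat_simps)
  have QO: "is_coproduct C I (\<lambda>i. fobj (D i) (x i)) (Q x) (\<theta> x)" if "x \<in> Obj ?J" for x
    using Q that by (simp add: prod_cat_simps)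
  have OI: "x i \<in> Obj (J i)" if "x \<in> Obj ?J" "i \<in> I" for x i
    using PiE_mem[OF that(1)[unfolded prod_cat_simps] that(2)] .
  have inj: "\<theta> x i \<in> hom C (fobj (D i) (x i)) (Q x)" if "x \<in> Obj ?J" "i \<in> I" for x i
    using coproduct_inj[OF QO[OF that(1)] that(2)] .
  obtain F where F: "is_functor ?J C F" "\<And>x. fobj F x = Q x"
    and F\<theta>: "\<And>a i. a \<in> Arr ?J \<Longrightarrow> i \<in> I \<Longrightarrow>
      Comp C (farr F a) (\<theta> (Dom ?J a) i) = Comp C (\<theta> (Cod ?J a) i) (farr (D i) (a i))"
  proof (rule coproduct_functor[OF catJ, of "\<lambda>_. I" "\<lambda>x i. fobj (D i) (x i)" Q \<theta> "\<lambda>a i. farr (D i) (a i)"])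
    show "is_coproduct C I (\<lambda>i. fobj (D i) (x i)) (Q x) (\<theta> x)" if "x \<in> Obj ?J" for x using QO[OF that] .
    show "farr (D i) (a i) \<in> hom C (fobj (D i) (Dom ?J a i)) (fobj (D i) (Cod ?J a i))"
      if "a \<in> Arr ?J" "i \<in> I" for a i
      using functorD(5)[OF D[OF that(2)] ArrI[OF that]] .
    show "farr (D i) (Ident ?J x i) = Ident C (fobj (D i) (x i))" if "x \<in> Obj ?J" "i \<in> I" for x i
      using functorD(4)[OF D[OF that(2)] OI[OF that]] that(2) by (simp add: prod_cat_simps)
    show "farr (D i) (Comp ?J b a i) = Comp C (farr (D i) (b i)) (farr (D i) (a i))"
      if "a \<in> Arr ?J" "b \<in> Arr ?J" "Dom ?J b = Cod ?J a" "i \<in> I" for a b i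
      using functorD(6)[OF D[OF that(4)] ArrI[OF that(1,4)] ArrI[OF that(2,4), unfolded that(3)]] that(4)
      by (simp add: prod_cat_simps)
  qed (use that in auto)
  have ci: "c i j \<in> hom C (fobj (D i) j) (X i)" if "i \<in> I" "j \<in> Obj (J i)" for i j
    using colimitD(2)[OF c[OF that(1)] that(2)] .
  have \<iota>c: "Comp C (\<iota> i) (c i (x i)) \<in> hom C (fobj (D i) (x i)) P" if "x \<in> Obj ?J" "i \<in> I" for x i
    using comp[OF ci[OF that(2) OI[OF that]] coproduct_inj[OF P that(2)]] .
  have "\<exists>h. h \<in> hom C (Q x) P \<and> (\<forall>i \<in> I. Comp C h (\<theta> x i) = Comp C (\<iota> i) (c i (x i)))"
    if x: "x \<in> Obj ?J" for x
    by (rule coproduct_desc[OF QO[OF x] coproduct_obj[OF P] \<iota>c[OF x]]) blast+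
  then obtain d where d: "\<And>x. x \<in> Obj ?J \<Longrightarrow> d x \<in> hom C (Q x) P"
    "\<And>x i. x \<in> Obj ?J \<Longrightarrow> i \<in> I \<Longrightarrow> Comp C (d x) (\<theta> x i) = Comp C (\<iota> i) (c i (x i))" by metis
  have Fa: "farr F a \<in> hom C (Q x) (Q y)" if "a \<in> hom ?J x y" for a x y
    using functorD(5)[OF F(1) that] F(2) by simp
  have "is_colimit C ?J F P d"
    unfolding is_colimit_def
  proof (intro conjI allI impI)
    show "is_cocone C ?J F P d"
      unfolding is_cocone_def F(2)
    proof (intro conjI ballI)
      show "P \<in> Obj C" by (rule coproduct_obj[OF P])
      show "d x \<in> hom C (Q x) P" if "x \<in> Obj ?J" for x using d(1)[OF that] .
      fix a assume a: "a \<in> Arr ?J"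
      let ?x = "Dom ?J a" and ?y = "Cod ?J a"
      have ah: "a \<in> hom ?J ?x ?y" using a by (simp add: hom_def)
      have x: "?x \<in> Obj ?J" and y: "?y \<in> Obj ?J" using JJ.dom_obj[OF a] JJ.cod_obj[OF a] .
      show "Comp C (d ?y) (farr F a) = d ?x"
      proof (rule coproduct_eq[OF QO[OF x] comp[OF Fa[OF ah] d(1)[OF y]] d(1)[OF x]])
        fix i assume i: "i \<in> I"
        have Da: "farr (D i) (a i) \<in> hom C (fobj (D i) (?x i)) (fobj (D i) (?y i))"
          using functorD(5)[OF D[OF i] ArrI[OF a i]] .
        have "Comp C (Comp C (d ?y) (farr F a)) (\<theta> ?x i) = Comp C (d ?y) (Comp C (\<theta> ?y i) (farr (D i) (a i)))"
          using assoc[OF inj[OF x i] Fa[OF ah] d(1)[OF y]] F\<theta>[OF a i] by simp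
        also have "\<dots> = Comp C (Comp C (\<iota> i) (c i (?y i))) (farr (D i) (a i))"
          using assoc[OF Da inj[OF y i] d(1)[OF y]] d(2)[OF y i] by simp
        also have "\<dots> = Comp C (\<iota> i) (Comp C (c i (?y i)) (farr (D i) (a i)))"
          using assoc[OF Da ci[OF i OI[OF y i]] coproduct_inj[OF P i]] by simp
        also have "Comp C (c i (?y i)) (farr (D i) (a i)) = c i (?x i)"
          using colimitD(3)[OF c[OF i] homD(1)[OF ArrI[OF a i]]] homD[OF ArrI[OF a i]] by simp
        finally show "Comp C (Comp C (d ?y) (farr F a)) (\<theta> ?x i) = Comp C (d ?x) (\<theta> ?x i)"
          using d(2)[OF x i] by simp
      qed
    qed
    fix Y s assume "is_cocone C ?J F Y s"
    then have Y: "Y \<in> Obj C" and s: "\<And>x. x \<in> Obj ?J \<Longrightarrow> s x \<in> hom C (Q x) Y"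
      and sF: "\<And>a. a \<in> Arr ?J \<Longrightarrow> Comp C (s (Cod ?J a)) (farr F a) = s (Dom ?J a)"
      unfolding is_cocone_def F(2) by auto
    have s\<theta>: "Comp C (s x) (\<theta> x i) \<in> hom C (fobj (D i) (x i)) Y" if "x \<in> Obj ?J" "i \<in> I" for x i
      using comp[OF inj[OF that] s[OF that(1)]] .
    \<comment> \<open>Naturality of the cocone seen on the summand \<open>i\<close>: only the
      \<open>i\<close>-th component of \<open>f\<close> enters.\<close>
    have nat: "Comp C (s x) (\<theta> x i) = Comp C (Comp C (s z) (\<theta> z i)) (farr (D i) (f i))"
      if f: "f \<in> hom ?J x z" and i: "i \<in> I" for x z f i
    proof -
      note fD = homD[OF f] and o = JJ.hom_obj[OF f]
      have Da: "farr (D i) (f i) \<in> hom C (fobj (D i) (x i)) (fobj (D i) (z i))"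
        using functorD(5)[OF D[OF i] ArrI[OF fD(1) i]] fD by simp
      have "Comp C (s x) (\<theta> x i) = Comp C (Comp C (s z) (farr F f)) (\<theta> x i)"
        using sF[OF fD(1)] fD by simp
      also have "\<dots> = Comp C (s z) (Comp C (\<theta> z i) (farr (D i) (f i)))"
        using assoc[OF inj[OF o(1) i] Fa[OF f] s[OF o(2)]] F\<theta>[OF fD(1) i] fD by simp
      finally show ?thesis using assoc[OF Da inj[OF o(2) i] s[OF o(2)]] by simp
    qed
    text \<open>
      The \<open>i\<close>-th component of a cocone depends only on the \<open>i\<close>-th coordinate: two indices that agree
      there have an upper bound whose \<open>i\<close>-th coordinate can be moved on so as to coequalize the two
      structure maps.
    \<close>
    have indep: "Comp C (s x) (\<theta> x i) = Comp C (s y) (\<theta> y i)"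
      if x: "x \<in> Obj ?J" and y: "y \<in> Obj ?J" and i: "i \<in> I" and xy: "x i = y i" for x y i
    proof -
      obtain z where z: "z \<in> Obj ?J" "\<And>w. w \<in> {x, y} \<Longrightarrow> hom ?J w z \<noteq> {}"
        using filtered_cat_bound[OF filt, of "{x, y}"] x y
          finite_ordLess_regular[OF \<kappa>, of "{x, y}"] by (metis empty_subsetI finite.emptyI finite_insert insert_subset)
      obtain f g where f: "f \<in> hom ?J x z" and g: "g \<in> hom ?J y z" using z(2) by blast
      have fi: "f i \<in> hom (J i) (x i) (z i)" and gi: "g i \<in> hom (J i) (x i) (z i)"
        using ArrI[OF homD(1)[OF f] i] ArrI[OF homD(1)[OF g] i] homD[OF f] homD[OF g] xy by simp_all
      obtain w h where w: "w \<in> Obj (J i)" and h: "h \<in> hom (J i) (z i) w"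
        and hfg: "\<And>u v. u \<in> {f i, g i} \<Longrightarrow> v \<in> {f i, g i} \<Longrightarrow> Comp (J i) h u = Comp (J i) h v"
        using filtered_cat_coequalize[OF J[OF i], of "{f i, g i}" "x i" "z i"] fi gi OI[OF x i] OI[OF z(1) i]
          finite_ordLess_regular[OF \<kappa>, of "{f i, g i}"]
        by (metis empty_subsetI finite.emptyI finite_insert insert_subset)
      \<comment> \<open>Only the \<open>i\<close>-th coordinate of \<open>z\<close> is changed.
        \<open>k\<close> is \<open>h\<close> there and an identity elsewhere, so its composites with
        \<open>f\<close> and with \<open>g\<close> have the same \<open>i\<close>-th
        component.\<close>
      define z' where "z' = z(i := w)"
      define k where "k = (Ident ?J z)(i := h)"
      have z': "z' \<in> Obj ?J" using z(1) w i by (auto simp: z'_def prod_cat_simps PiE_iff extensional_def)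
      have k: "k \<in> hom ?J z z'"
        unfolding hom_prod_cat[OF z(1)[unfolded prod_cat_simps] z'[unfolded prod_cat_simps]]
        using OI[OF z(1)] h i category.ident[OF Ji]
        by (auto simp: k_def z'_def prod_cat_simps PiE_iff extensional_def)
      have kf: "Comp ?J k f i = Comp (J i) h (f i)" "Comp ?J k g i = Comp (J i) h (g i)"
        using i by (simp_all add: prod_cat_simps k_def)
      have "Comp (J i) h (f i) = Comp (J i) h (g i)" by (rule hfg) simp_all
      then show ?thesis
        using nat[OF JJ.comp[OF f k] i] nat[OF JJ.comp[OF g k] i] kf by simp
    qed
    \<comment> \<open>A base index: an object \<open>j\<close> of \<open>J i\<close> is represented
      by \<open>x0(i := j)\<close>. By \<open>indep\<close> any index with \<open>i\<close>-th
      coordinate \<open>j\<close> gives the same arrow \<open>t i j\<close>.\<close>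
    obtain x0 where x0: "x0 \<in> Obj ?J" using ne by blast
    have upd: "x0(i := j) \<in> Obj ?J" if "i \<in> I" "j \<in> Obj (J i)" for i j
      using x0 that by (auto simp: prod_cat_simps PiE_iff extensional_def)
    define t where "t i j = Comp C (s (x0(i := j))) (\<theta> (x0(i := j)) i)" for i j
    have st: "Comp C (s x) (\<theta> x i) = t i (x i)" if "x \<in> Obj ?J" "i \<in> I" for x i
      unfolding t_def using indep[OF that(1) upd[OF that(2) OI[OF that]] that(2)] by simp
    have t: "t i j \<in> hom C (fobj (D i) j) Y" if "i \<in> I" "j \<in> Obj (J i)" for i j
      unfolding t_def using s\<theta>[OF upd[OF that] that(1)] by simp
    have cocone: "is_cocone C (J i) (D i) Y (t i)" if i: "i \<in> I" for i
      unfolding is_cocone_def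
    proof (intro conjI ballI Y t i)
      fix a assume a: "a \<in> Arr (J i)"
      interpret Jii: category "J i" by (rule Ji[OF i])
      note o = upd[OF i Jii.dom_obj[OF a]] upd[OF i Jii.cod_obj[OF a]]
      \<comment> \<open>An arrow of \<open>J i\<close> becomes an arrow of the product by identities
        in the other coordinates.\<close>
      define b where "b = (Ident ?J x0)(i := a)"
      have b: "b \<in> hom ?J (x0(i := Dom (J i) a)) (x0(i := Cod (J i) a))"
        unfolding hom_prod_cat[OF o[unfolded prod_cat_simps]]
        using OI[OF x0] a i category.ident[OF Ji]
        by (auto simp: b_def prod_cat_simps PiE_iff extensional_def hom_def)
      show "Comp C (t i (Cod (J i) a)) (farr (D i) a) = t i (Dom (J i) a)"
        using nat[OF b i] by (simp add: t_def b_def)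
    qed
    have "\<exists>h. h \<in> hom C (X i) Y \<and> (\<forall>j \<in> Obj (J i). Comp C h (c i j) = t i j)" if "i \<in> I" for i
      using colimit_desc[OF c[OF that] cocone[OF that]] by metis
    then obtain h where h: "\<And>i. i \<in> I \<Longrightarrow> h i \<in> hom C (X i) Y"
      "\<And>i j. i \<in> I \<Longrightarrow> j \<in> Obj (J i) \<Longrightarrow> Comp C (h i) (c i j) = t i j" by metis
    obtain H where H: "H \<in> hom C P Y" "\<And>i. i \<in> I \<Longrightarrow> Comp C H (\<iota> i) = h i"
      using coproduct_desc[OF P Y h(1)] by metis
    show "\<exists>!h. h \<in> hom C P Y \<and> (\<forall>x \<in> Obj ?J. Comp C h (d x) = s x)"
    proof (rule ex1I[of _ H], intro conjI ballI H(1))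
      fix x assume x: "x \<in> Obj ?J"
      show "Comp C H (d x) = s x"
      proof (rule coproduct_eq[OF QO[OF x] comp[OF d(1)[OF x] H(1)] s[OF x]])
        fix i assume i: "i \<in> I"
        have "Comp C (Comp C H (d x)) (\<theta> x i) = Comp C H (Comp C (\<iota> i) (c i (x i)))"
          using assoc[OF inj[OF x i] d(1)[OF x] H(1)] d(2)[OF x i] by simp
        also have "\<dots> = Comp C (h i) (c i (x i))"
          using assoc[OF ci[OF i OI[OF x i]] coproduct_inj[OF P i] H(1)] H(2)[OF i] by simp
        also have "\<dots> = Comp C (s x) (\<theta> x i)" using h(2)[OF i OI[OF x i]] st[OF x i] by simp
        finally show "Comp C (Comp C H (d x)) (\<theta> x i) = Comp C (s x) (\<theta> x i)" .
      qed
    next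
      fix H' assume "H' \<in> hom C P Y \<and> (\<forall>x \<in> Obj ?J. Comp C H' (d x) = s x)"
      then have H': "H' \<in> hom C P Y" and H's: "\<And>x. x \<in> Obj ?J \<Longrightarrow> Comp C H' (d x) = s x" by auto
      show "H' = H"
      proof (rule coproduct_eq[OF P H' H(1)])
        fix i assume i: "i \<in> I"
        note \<iota>i = coproduct_inj[OF P i]
        show "Comp C H' (\<iota> i) = Comp C H (\<iota> i)"
        proof (rule colimit_eq[OF c[OF i] D[OF i] comp[OF \<iota>i H'] comp[OF \<iota>i H(1)]])
          fix j assume j: "j \<in> Obj (J i)"
          \<comment> \<open>Arrows out of \<open>X i\<close> are compared on its colimit cocone, and
            each \<open>j\<close> occurs as the \<open>i\<close>-th coordinate of an index of the
            product.\<close>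
          define x where "x = x0(i := j)"
          have x: "x \<in> Obj ?J" "x i = j" using upd[OF i j] by (simp_all add: x_def)
          have "Comp C (Comp C H' (\<iota> i)) (c i j) = Comp C H' (Comp C (d x) (\<theta> x i))"
            using assoc[OF ci[OF i j] \<iota>i H'] d(2)[OF x(1) i] x(2) by simp
          also have "\<dots> = t i j"
            using assoc[OF inj[OF x(1) i] d(1)[OF x(1)] H'] H's[OF x(1)] st[OF x(1) i] x(2) by simp
          finally show "Comp C (Comp C H' (\<iota> i)) (c i j) = Comp C (Comp C H (\<iota> i)) (c i j)"
            using h(2)[OF i j] H(2)[OF i] by simp
        qed
      qed
    qed
  qed
  then show ?thesis using that F d(2) unfolding prod_cat_simps(1) by blast
qed

section \<open>Compact objects of the homotopy category\<close>

locale functorial_fibrant_replacement = homotopical K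
  for K :: "('o, 'm, 'x) model_cat_scheme" +
  fixes R :: "('o, 'm, 'o, 'm) functor_data" and \<eta> :: "'o \<Rightarrow> 'm"
  assumes R: "is_functor K K R" and R_fibrant: "X \<in> Obj K \<Longrightarrow> fibrant K (fobj R X)"
    and unit: "X \<in> Obj K \<Longrightarrow> \<eta> X \<in> hom K X (fobj R X) \<inter> cof K \<inter> weq K"
    and unit_natural: "f \<in> hom K X Y \<Longrightarrow> Comp K (farr R f) (\<eta> X) = Comp K (\<eta> Y) f"
begin

lemma unitD:
  assumes "X \<in> Obj K"
  shows "\<eta> X \<in> hom K X (fobj R X)" "\<eta> X \<in> cof K" "\<eta> X \<in> weq K"
  using unit[OF assms] by simp_all

lemma Ho_coproduct_replacement:
  assumes P: "is_coproduct K I X P \<iota>" and X: "\<And>i. i \<in> I \<Longrightarrow> X i \<in> Obj (Ho K)"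
  shows "is_coproduct (Ho K) I X (fobj R P) (\<lambda>i. homotopy_class K (Comp K (\<eta> P) (\<iota> i)))"
  using Ho_coproduct[OF P X unitD R_fibrant] coproduct_obj[OF P] by blast

lemma has_coproducts_Ho:
  assumes copr: "\<And>(I :: 'u set) X. small TYPE('u) I \<Longrightarrow> (\<And>i. i \<in> I \<Longrightarrow> X i \<in> Obj K) \<Longrightarrow>
    \<exists>P \<iota>. is_coproduct K I X P \<iota>"
  shows "has_coproducts TYPE('u) (Ho K)"
  unfolding has_coproducts_def
proof (intro allI impI, elim conjE)
  fix I :: "'u set" and X assume I: "small TYPE('u) I" and X: "\<forall>i \<in> I. X i \<in> Obj (Ho K)"
  obtain P \<iota> where "is_coproduct K I X P \<iota>" using copr[OF I] X Ho_obj by meson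
  then show "\<exists>P \<iota>. is_coproduct (Ho K) I X P \<iota>" using Ho_coproduct_replacement X by blast
qed

text \<open>\<open>small_object\<close> and \<open>compact_class\<close> quantify over every
  coproduct in \<open>Ho K\<close>, while the computation takes place in
  \<open>fobj R P\<^sub>0\<close>. The arrow \<open>b\<close> leads from there to \<open>P\<close>,
  and \<open>f\<^sub>0\<close> is an arrow of \<open>K\<close> whose class becomes \<open>f\<close>
  under it.\<close>

lemma Ho_coproduct_representative:
  assumes P0: "is_coproduct K I X P\<^sub>0 \<iota>\<^sub>0" and X: "\<And>i. i \<in> I \<Longrightarrow> X i \<in> Obj (Ho K)"
    and P: "is_coproduct (Ho K) I X P \<iota>" and f: "f \<in> hom (Ho K) S P"
  obtains f\<^sub>0 b where "f\<^sub>0 \<in> hom K S (fobj R P\<^sub>0)" "b \<in> hom (Ho K) (fobj R P\<^sub>0) P"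
    "\<And>i. i \<in> I \<Longrightarrow> Comp (Ho K) b (homotopy_class K (Comp K (\<eta> P\<^sub>0) (\<iota>\<^sub>0 i))) = \<iota> i"
    "Comp (Ho K) b (homotopy_class K f\<^sub>0) = f"
proof -
  interpret H: category "Ho K" by (rule category_Ho)
  obtain a b where ab: "a \<in> hom (Ho K) P (fobj R P\<^sub>0)" "b \<in> hom (Ho K) (fobj R P\<^sub>0) P"
    "Comp (Ho K) b a = Ident (Ho K) P"
    "\<And>i. i \<in> I \<Longrightarrow> Comp (Ho K) b (homotopy_class K (Comp K (\<eta> P\<^sub>0) (\<iota>\<^sub>0 i))) = \<iota> i"
    by (rule H.coproduct_iso[OF P Ho_coproduct_replacement[OF P0 X]]) auto
  obtain f\<^sub>0 where f0: "f\<^sub>0 \<in> hom K S (fobj R P\<^sub>0)" "Comp (Ho K) a f = homotopy_class K f\<^sub>0"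
    using H.comp[OF f ab(1)] by (elim hom_HoE) auto
  have "Comp (Ho K) b (homotopy_class K f\<^sub>0) = f"
    using H.assoc[OF f ab(1,2)] ab(3) H.ident_left[OF f] f0(2) by simp
  then show ?thesis using that f0(1) ab(2,4) by blast
qed

text \<open>The passage from \<open>K\<close> to \<open>Ho K\<close> shared by both conditions on
  compact objects. For smallness, \<open>A\<close> is a subset of size less than
  \<open>\<kappa>\<close> and the \<open>g i\<close> are identities; for the second condition,
  \<open>A\<close> is all of \<open>I\<close> and the \<open>T i\<close> are new objects.\<close>

lemma Ho_coproduct_factorization:
  assumes P0: "is_coproduct K I X P\<^sub>0 \<iota>\<^sub>0" and X: "\<And>i. i \<in> I \<Longrightarrow> X i \<in> Obj (Ho K)"
    and Q: "is_coproduct K A T Q \<theta>" and AI: "A \<subseteq> I" and T: "\<And>i. i \<in> A \<Longrightarrow> T i \<in> Obj (Ho K)"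
    and g: "\<And>i. i \<in> A \<Longrightarrow> g i \<in> hom K (T i) (X i)"
    and u: "u \<in> hom K Q P\<^sub>0" "\<And>i. i \<in> A \<Longrightarrow> Comp K u (\<theta> i) = Comp K (\<iota>\<^sub>0 i) (g i)"
    and k: "k \<in> hom K S (fobj R Q)" and S: "S \<in> Obj (Ho K)"
    and P: "is_coproduct (Ho K) I X P \<iota>"
    and b: "b \<in> hom (Ho K) (fobj R P\<^sub>0) P"
      "\<And>i. i \<in> I \<Longrightarrow> Comp (Ho K) b (homotopy_class K (Comp K (\<eta> P\<^sub>0) (\<iota>\<^sub>0 i))) = \<iota> i"
    and f: "f = Comp (Ho K) b (homotopy_class K (Comp K (farr R u) k))"
  shows "\<exists>Q \<theta> m h. is_coproduct (Ho K) A T Q \<theta> \<and> m \<in> hom (Ho K) Q P \<and>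
    (\<forall>i \<in> A. Comp (Ho K) m (\<theta> i) = Comp (Ho K) (\<iota> i) (homotopy_class K (g i))) \<and>
    h \<in> hom (Ho K) S Q \<and> f = Comp (Ho K) m h"
proof -
  interpret H: category "Ho K" by (rule category_Ho)
  have Qo: "Q \<in> Obj K" and P0o: "P\<^sub>0 \<in> Obj K" using coproduct_obj[OF Q] coproduct_obj[OF P0] .
  have QH: "is_coproduct (Ho K) A T (fobj R Q) (\<lambda>i. homotopy_class K (Comp K (\<eta> Q) (\<theta> i)))"
    by (rule Ho_coproduct_replacement[OF Q T])
  have PH: "is_coproduct (Ho K) I X (fobj R P\<^sub>0) (\<lambda>i. homotopy_class K (Comp K (\<eta> P\<^sub>0) (\<iota>\<^sub>0 i)))"
    by (rule Ho_coproduct_replacement[OF P0 X])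
  have RQ: "fobj R Q \<in> Obj (Ho K)" and RP: "fobj R P\<^sub>0 \<in> Obj (Ho K)"
    using coproduct_obj[OF QH] coproduct_obj[OF PH] .
  have Ru: "farr R u \<in> hom K (fobj R Q) (fobj R P\<^sub>0)" using functorD(5)[OF R u(1)] .
  note cRu = hom_HoI[OF Ru RQ RP] and ck = hom_HoI[OF k S RQ]
  define m where "m = Comp (Ho K) b (homotopy_class K (farr R u))"
  have m: "m \<in> hom (Ho K) (fobj R Q) P" unfolding m_def using H.comp[OF cRu b(1)] .
  have "Comp (Ho K) m (homotopy_class K (Comp K (\<eta> Q) (\<theta> i))) = Comp (Ho K) (\<iota> i) (homotopy_class K (g i))"
    if i: "i \<in> A" for i
  proof -
    have iI: "i \<in> I" using i AI by blast
    note \<theta>i = coproduct_inj[OF Q i] and \<iota>i = coproduct_inj[OF P0 iI]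
    have \<eta>\<theta>: "Comp K (\<eta> Q) (\<theta> i) \<in> hom K (T i) (fobj R Q)" using comp[OF \<theta>i unitD(1)[OF Qo]] .
    have \<eta>\<iota>: "Comp K (\<eta> P\<^sub>0) (\<iota>\<^sub>0 i) \<in> hom K (X i) (fobj R P\<^sub>0)" using comp[OF \<iota>i unitD(1)[OF P0o]] .
    \<comment> \<open>Naturality of the unit gives the compatibility with the injections already in
      \<open>K\<close>, before homotopy classes are taken.\<close>
    have "Comp K (farr R u) (Comp K (\<eta> Q) (\<theta> i)) = Comp K (Comp K (\<eta> P\<^sub>0) u) (\<theta> i)"
      using assoc[OF \<theta>i unitD(1)[OF Qo] Ru] unit_natural[OF u(1)] by simp
    also have "\<dots> = Comp K (\<eta> P\<^sub>0) (Comp K (\<iota>\<^sub>0 i) (g i))"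
      using assoc[OF \<theta>i u(1) unitD(1)[OF P0o]] u(2)[OF i] by simp
    also have "\<dots> = Comp K (Comp K (\<eta> P\<^sub>0) (\<iota>\<^sub>0 i)) (g i)"
      using assoc[OF g[OF i] \<iota>i unitD(1)[OF P0o]] .
    finally have strict: "Comp K (farr R u) (Comp K (\<eta> Q) (\<theta> i)) = Comp K (Comp K (\<eta> P\<^sub>0) (\<iota>\<^sub>0 i)) (g i)" .
    have "Comp (Ho K) m (homotopy_class K (Comp K (\<eta> Q) (\<theta> i))) =
        Comp (Ho K) b (homotopy_class K (Comp K (farr R u) (Comp K (\<eta> Q) (\<theta> i))))"
      unfolding m_def using H.assoc[OF hom_HoI[OF \<eta>\<theta> T[OF i] RQ] cRu b(1)] Comp_Ho[OF \<eta>\<theta> Ru T[OF i] RQ RP]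
      by simp
    also have "\<dots> = Comp (Ho K) (\<iota> i) (homotopy_class K (g i))"
      unfolding strict
      using H.assoc[OF hom_HoI[OF g[OF i] T[OF i] X[OF iI]] hom_HoI[OF \<eta>\<iota> X[OF iI] RP] b(1)]
        Comp_Ho[OF g[OF i] \<eta>\<iota> T[OF i] X[OF iI] RP] b(2)[OF iI] by simp
    finally show ?thesis .
  qed
  moreover have "f = Comp (Ho K) m (homotopy_class K k)"
    unfolding m_def f using H.assoc[OF ck cRu b(1)] Comp_Ho[OF k Ru S RQ RP] by simp
  ultimately show ?thesis using QH m ck by blast
qed

lemma small_object_Ho:
  fixes \<kappa> :: "'u rel"
  assumes U: "inaccessible_universe TYPE('u)" and \<kappa>: "regular_cardinal \<kappa>"
    and copr: "\<And>(I :: 'u set) X. small TYPE('u) I \<Longrightarrow> (\<And>i. i \<in> I \<Longrightarrow> X i \<in> Obj K) \<Longrightarrow>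
      \<exists>P \<iota>. is_coproduct K I X P \<iota>"
    and pres: "preserves_filtered_colimits \<kappa> K K R"
    and S: "S \<in> Obj (Ho K)" "presentable \<kappa> K S"
  shows "small_object \<kappa> (Ho K) S"
  unfolding small_object_def
proof (intro conjI S(1) allI impI; elim conjE)
  interpret H: category "Ho K" by (rule category_Ho)
  fix I :: "'u set" and X P \<iota> f
  assume I: "small TYPE('u) I" and X': "\<forall>i \<in> I. X i \<in> Obj (Ho K)"
    and P: "is_coproduct (Ho K) I X P \<iota>" and f: "f \<in> hom (Ho K) S P"
  have X: "X i \<in> Obj (Ho K)" if "i \<in> I" for i using X' that by blast
  obtain P0 \<iota>0 where P0: "is_coproduct K I X P0 \<iota>0" using copr[OF I, of X] Ho_obj[OF X] by blast
  obtain f0 b where f0: "f0 \<in> hom K S (fobj R P0)" and b: "b \<in> hom (Ho K) (fobj R P0) P"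
    "\<And>i. i \<in> I \<Longrightarrow> Comp (Ho K) b (homotopy_class K (Comp K (\<eta> P0) (\<iota>0 i))) = \<iota> i"
    and bf: "Comp (Ho K) b (homotopy_class K f0) = f"
    by (rule Ho_coproduct_representative[OF P0 X P f], assumption, rule that)
  have "\<exists>Q \<theta>. is_coproduct K A X Q \<theta>" if "A \<subseteq> I" for A
    using copr[OF small_subset[OF I that]] Ho_obj X that by blast
  then obtain Q \<theta> where Q: "\<And>A. A \<subseteq> I \<Longrightarrow> is_coproduct K A X (Q A) (\<theta> A)" by metis
  obtain D c where D: "is_functor (subset_cat \<kappa> I) K D" and c: "is_colimit K (subset_cat \<kappa> I) D P0 c"
    and DQ: "\<And>A. fobj D A = Q A"
    and c\<theta>: "\<And>A i. A \<subseteq> I \<Longrightarrow> |A| <o \<kappa> \<Longrightarrow> i \<in> A \<Longrightarrow> Comp K (c A) (\<theta> A i) = \<iota>0 i"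
    by (rule coproduct_subset_colimit[OF \<kappa> P0 Q]) auto
  \<comment> \<open>Presentability of \<open>S\<close> is applied to the image under
    \<open>R\<close> of the diagram of subcoproducts, whose colimit is
    \<open>fobj R P0\<close>.\<close>
  obtain A k where A: "A \<in> Obj (subset_cat \<kappa> I)" and k: "k \<in> hom K S (fobj R (Q A))"
    and fk: "f0 = Comp K (farr R (c A)) k"
    using presentable_factor_filtered_colimit[OF U filtered_subset_cat[OF \<kappa>] small_subset_cat[OF U I]
        D c R pres S(2) f0] DQ by auto
  have AI: "A \<subseteq> I" and A\<kappa>: "|A| <o \<kappa>" using A by (simp_all add: subset_cat_def)
  have cA: "c A \<in> hom K (Q A) P0" using colimitD(2)[OF c A] DQ by simp
  have XA: "X i \<in> Obj (Ho K)" if "i \<in> A" for i using X AI that by blast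
  have "\<exists>Q \<theta> m h. is_coproduct (Ho K) A X Q \<theta> \<and> m \<in> hom (Ho K) Q P \<and>
    (\<forall>i \<in> A. Comp (Ho K) m (\<theta> i) = Comp (Ho K) (\<iota> i) (homotopy_class K (Ident K (X i)))) \<and>
    h \<in> hom (Ho K) S Q \<and> f = Comp (Ho K) m h"
  proof (rule Ho_coproduct_factorization[OF P0 X Q[OF AI] AI XA _ cA _ k S(1) P b])
    show "Ident K (X i) \<in> hom K (X i) (X i)" if "i \<in> A" for i using ident[OF Ho_obj[OF XA[OF that]]] .
    show "Comp K (c A) (\<theta> A i) = Comp K (\<iota>0 i) (Ident K (X i))" if "i \<in> A" for i
      using c\<theta>[OF AI A\<kappa> that] ident_right[OF coproduct_inj[OF P0]] AI that by auto
    show "f = Comp (Ho K) b (homotopy_class K (Comp K (farr R (c A)) k))" using bf fk by simp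
  qed
  moreover have "Comp (Ho K) (\<iota> i) (homotopy_class K (Ident K (X i))) = \<iota> i" if "i \<in> A" for i
    using H.ident_right[OF coproduct_inj[OF P]] AI that by (auto simp: Ident_Ho[symmetric])
  ultimately show "\<exists>J \<subseteq> I. |J| <o \<kappa> \<and> (\<exists>Q \<iota>' s g. is_coproduct (Ho K) J X Q \<iota>' \<and>
      s \<in> hom (Ho K) Q P \<and> (\<forall>j \<in> J. Comp (Ho K) s (\<iota>' j) = \<iota> j) \<and>
      g \<in> hom (Ho K) S Q \<and> f = Comp (Ho K) s g)"
    using AI A\<kappa> by (intro exI[of _ A] conjI) auto
qed

text \<open>
  Since \<open>X i\<close> is cofibrant, the cofibrant replacement \<open>\<epsilon> i\<close> has a section, so that the map into the
  coproduct of the \<open>X i\<close> can be moved strictly to the coproduct of their cofibrant replacements,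
  which is a filtered colimit of coproducts of cofibrant presentable objects.
\<close>

lemma compact_factorization_Ho:
  fixes \<kappa> :: "'u rel" and I :: "'u set"
  assumes U: "inaccessible_universe TYPE('u)" and \<kappa>: "regular_cardinal \<kappa>"
    and copr: "\<And>(I :: 'u set) X. small TYPE('u) I \<Longrightarrow> (\<And>i. i \<in> I \<Longrightarrow> X i \<in> Obj K) \<Longrightarrow>
      \<exists>P \<iota>. is_coproduct K I X P \<iota>"
    and pres: "preserves_filtered_colimits \<kappa> K K R"
    and R': "is_functor K K R'" "\<And>X. X \<in> Obj K \<Longrightarrow> cofibrant K (fobj R' X)"
    and \<epsilon>: "\<And>X. X \<in> Obj K \<Longrightarrow> \<epsilon> X \<in> hom K (fobj R' X) X \<inter> fib K \<inter> weq K"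
    and pres': "preserves_filtered_colimits \<kappa> K K R'"
    and dense: "\<And>X. X \<in> Obj K \<Longrightarrow> \<exists>(J :: ('u, 'u) cat) D c.
      filtered \<kappa> J \<and> is_functor J K D \<and> (\<forall>j \<in> Obj J. presentable \<kappa> K (fobj D j)) \<and> is_colimit K J D X c"
    and pres_obj: "\<And>A. presentable \<kappa> K A \<Longrightarrow> presentable \<kappa> K (fobj R A)"
      "\<And>A. presentable \<kappa> K A \<Longrightarrow> presentable \<kappa> K (fobj R' A)"
    and S: "S \<in> Obj (Ho K)" "presentable \<kappa> K S"
    and I: "small TYPE('u) I" and X: "\<And>i. i \<in> I \<Longrightarrow> X i \<in> Obj (Ho K)"
    and P: "is_coproduct (Ho K) I X P \<iota>" and f: "f \<in> hom (Ho K) S P"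
  shows "\<exists>T g. (\<forall>i \<in> I. T i \<in> Obj (Ho K) \<and> presentable \<kappa> K (T i) \<and> g i \<in> hom (Ho K) (T i) (X i)) \<and>
    (\<exists>Q \<iota>' m h. is_coproduct (Ho K) I T Q \<iota>' \<and> m \<in> hom (Ho K) Q P \<and>
      (\<forall>i \<in> I. Comp (Ho K) m (\<iota>' i) = Comp (Ho K) (\<iota> i) (g i)) \<and>
      h \<in> hom (Ho K) S Q \<and> f = Comp (Ho K) m h)"
proof -
  have Xo: "X i \<in> Obj K" and Xc: "cofibrant K (X i)" and Xf: "fibrant K (X i)" if "i \<in> I" for i
    using Ho_obj[OF X[OF that]] X[OF that] by (simp_all add: Obj_Ho)
  obtain P0 \<iota>0 where P0: "is_coproduct K I X P0 \<iota>0" using copr[OF I, of X] Xo by blast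
  note \<iota>0 = coproduct_inj[OF P0]
  obtain f0 b where f0: "f0 \<in> hom K S (fobj R P0)" and b: "b \<in> hom (Ho K) (fobj R P0) P"
    "\<And>i. i \<in> I \<Longrightarrow> Comp (Ho K) b (homotopy_class K (Comp K (\<eta> P0) (\<iota>0 i))) = \<iota> i"
    and bf: "Comp (Ho K) b (homotopy_class K f0) = f"
    by (rule Ho_coproduct_representative[OF P0 X P f], assumption, rule that)
  define C where "C i = fobj R' (X i)" for i
  have \<epsilon>X: "\<epsilon> (X i) \<in> hom K (C i) (X i)" "\<epsilon> (X i) \<in> fib K" "\<epsilon> (X i) \<in> weq K" if "i \<in> I" for i
    using \<epsilon>[OF Xo[OF that]] by (simp_all add: C_def)
  have "\<exists>\<sigma>. \<sigma> \<in> hom K (X i) (C i) \<and> Comp K (\<epsilon> (X i)) \<sigma> = Ident K (X i)" if i: "i \<in> I" for i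
    using cofibrant_lift[OF Xc[OF i] \<epsilon>X(2,3,1)[OF i] ident[OF Xo[OF i]]] by blast
  then obtain \<sigma> where \<sigma>: "\<And>i. i \<in> I \<Longrightarrow> \<sigma> i \<in> hom K (X i) (C i)"
    "\<And>i. i \<in> I \<Longrightarrow> Comp K (\<epsilon> (X i)) (\<sigma> i) = Ident K (X i)" by metis
  have Co: "C i \<in> Obj K" if "i \<in> I" for i using hom_obj(1)[OF \<epsilon>X(1)[OF that]] .
  obtain PC \<gamma> where PC: "is_coproduct K I C PC \<gamma>" using copr[OF I, of C] Co by blast
  note \<gamma> = coproduct_inj[OF PC]
  obtain v where v: "v \<in> hom K P0 PC" "\<And>i. i \<in> I \<Longrightarrow> Comp K v (\<iota>0 i) = Comp K (\<gamma> i) (\<sigma> i)"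
    using coproduct_desc[OF P0 coproduct_obj[OF PC] comp[OF \<sigma>(1) \<gamma>]] by metis
  obtain w where w: "w \<in> hom K PC P0" "\<And>i. i \<in> I \<Longrightarrow> Comp K w (\<gamma> i) = Comp K (\<iota>0 i) (\<epsilon> (X i))"
    using coproduct_desc[OF PC coproduct_obj[OF P0] comp[OF \<epsilon>X(1) \<iota>0]] by metis
  \<comment> \<open>The sections make the coproduct of the \<open>X i\<close> a strict retract of
    the coproduct of the \<open>C i\<close>, so that \<open>f0\<close> can be recovered from its
    composite with \<open>farr R v\<close>.\<close>
  have wv: "Comp K w v = Ident K P0"
  proof (rule coproduct_eq[OF P0 comp[OF v(1) w(1)] ident[OF coproduct_obj[OF P0]]])
    fix i assume i: "i \<in> I"
    have "Comp K (Comp K w v) (\<iota>0 i) = Comp K w (Comp K (\<gamma> i) (\<sigma> i))"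
      using assoc[OF \<iota>0[OF i] v(1) w(1)] v(2)[OF i] by simp
    also have "\<dots> = Comp K (Comp K (\<iota>0 i) (\<epsilon> (X i))) (\<sigma> i)"
      using assoc[OF \<sigma>(1)[OF i] \<gamma>[OF i] w(1)] w(2)[OF i] by simp
    also have "\<dots> = \<iota>0 i"
      using assoc[OF \<sigma>(1)[OF i] \<epsilon>X(1)[OF i] \<iota>0[OF i]] \<sigma>(2)[OF i] ident_right[OF \<iota>0[OF i]] by simp
    finally show "Comp K (Comp K w v) (\<iota>0 i) = Comp K (Ident K P0) (\<iota>0 i)"
      using ident_left[OF \<iota>0[OF i]] by simp
  qed
  have "\<forall>i. \<exists>(J :: ('u, 'u) cat) D c. i \<in> I \<longrightarrow> filtered \<kappa> J \<and> is_functor J K D \<and>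
      (\<forall>j \<in> Obj J. presentable \<kappa> K (fobj D j)) \<and> is_colimit K J D (X i) c"
    using dense[OF Xo] by blast
  then obtain J :: "'u \<Rightarrow> ('u, 'u) cat" and D c where
    J: "\<And>i. i \<in> I \<Longrightarrow> filtered \<kappa> (J i)" and D: "\<And>i. i \<in> I \<Longrightarrow> is_functor (J i) K (D i)"
    and Dp: "\<And>i j. i \<in> I \<Longrightarrow> j \<in> Obj (J i) \<Longrightarrow> presentable \<kappa> K (fobj (D i) j)"
    and c: "\<And>i. i \<in> I \<Longrightarrow> is_colimit K (J i) (D i) (X i) (c i)"
    by metis
  define E where "E i = functor_comp R' (D i)" for i
  have E: "is_functor (J i) K (E i)" if "i \<in> I" for i
    unfolding E_def using is_functor_comp[OF D[OF that] R'(1)] .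
  have Eo: "fobj (E i) j = fobj R' (fobj (D i) j)" for i j by (simp add: E_def functor_comp_def)
  \<comment> \<open>Since \<open>R'\<close> preserves the filtered colimit \<open>X i\<close>, its
    value \<open>C i\<close> is a filtered colimit of objects that are both cofibrant and
    presentable.\<close>
  have cE: "is_colimit K (J i) (E i) (C i) (\<lambda>j. farr R' (c i j))" if "i \<in> I" for i
    using pres' J[OF that] D[OF that] c[OF that] unfolding preserves_filtered_colimits_def E_def C_def by blast
  let ?O = "PiE I (\<lambda>i. Obj (J i))"
  have Dxo: "fobj (D i) (x i) \<in> Obj K" and Exo: "fobj (E i) (x i) \<in> Obj K"
    if "x \<in> ?O" "i \<in> I" for x i
    using functorD(3)[OF D[OF that(2)] PiE_mem[OF that]] functorD(3)[OF E[OF that(2)] PiE_mem[OF that]] .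
  have "\<exists>Q \<theta>. is_coproduct K I (\<lambda>i. fobj (E i) (x i)) Q \<theta>" if "x \<in> ?O" for x
    using copr[OF I, of "\<lambda>i. fobj (E i) (x i)"] Exo[OF that] by blast
  then obtain Q \<theta> where Q: "\<And>x. x \<in> ?O \<Longrightarrow> is_coproduct K I (\<lambda>i. fobj (E i) (x i)) (Q x) (\<theta> x)"
    by metis
  have J': "filtered_cat \<kappa> (J i)" "small TYPE('u) (Obj (J i))" "small TYPE('u) (Arr (J i))" if "i \<in> I" for i
    using J[OF that] by (simp_all add: filtered_iff)
  obtain F d where F: "is_functor (prod_cat I J) K F" and d: "is_colimit K (prod_cat I J) F PC d"
    and FQ: "\<And>x. fobj F x = Q x"
    and d\<theta>: "\<And>x i. x \<in> ?O \<Longrightarrow> i \<in> I \<Longrightarrow> Comp K (d x) (\<theta> x i) = Comp K (\<gamma> i) (farr R' (c i (x i)))"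
    by (rule product_coproduct_colimit[OF \<kappa> J'(1) E cE PC Q]) auto
  have Rvf: "Comp K (farr R v) f0 \<in> hom K S (fobj R PC)"
    using comp[OF f0 functorD(5)[OF R v(1)]] .
  obtain x k where x: "x \<in> Obj (prod_cat I J)" and k: "k \<in> hom K S (fobj R (Q x))"
    and fk: "Comp K (farr R v) f0 = Comp K (farr R (d x)) k"
    using presentable_factor_filtered_colimit[OF U filtered_prod_cat[OF J'(1)]
        small_prod_cat[OF U I J'(2,3)] F d R pres S(2) Rvf] FQ by auto
  have xO: "x \<in> ?O" using x by (simp add: prod_cat_simps)
  have xi: "x i \<in> Obj (J i)" if "i \<in> I" for i using PiE_mem[OF xO that] .
  have dx: "d x \<in> hom K (Q x) PC" using colimitD(2)[OF d x] FQ by simp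
  note \<theta> = coproduct_inj[OF Q[OF xO]]
  define B where "B i = fobj (E i) (x i)" for i
  \<comment> \<open>\<open>B i\<close> is cofibrant and presentable but may fail to be fibrant;
    \<open>R\<close> makes it bifibrant and keeps it presentable.\<close>
  define T where "T i = fobj R (B i)" for i
  have Bo: "B i \<in> Obj K" and Bc: "cofibrant K (B i)" and Bp: "presentable \<kappa> K (B i)" if "i \<in> I" for i
    using Exo[OF xO that] R'(2)[OF Dxo[OF xO that]] pres_obj(2)[OF Dp[OF that xi[OF that]]]
    by (simp_all add: B_def Eo)
  have TH: "T i \<in> Obj (Ho K)" if "i \<in> I" for i
    using cofibrant_cod[OF Bc[OF that] unitD(2,1)[OF Bo[OF that]]] R_fibrant[OF Bo[OF that]]
    by (simp add: Obj_Ho T_def)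
  have Tp: "presentable \<kappa> K (T i)" if "i \<in> I" for i
    unfolding T_def using pres_obj(1)[OF Bp[OF that]] .
  define e where "e i = farr R' (c i (x i))" for i
  have e: "e i \<in> hom K (B i) (C i)" if "i \<in> I" for i
    unfolding e_def B_def using colimitD(2)[OF cE[OF that] xi[OF that]] .
  \<comment> \<open>As \<open>X i\<close> is fibrant, the arrow from \<open>B i\<close> to
    \<open>X i\<close> extends along the acyclic cofibration from \<open>B i\<close> to
    \<open>T i\<close>.\<close>
  have "\<exists>t. t \<in> hom K (T i) (X i) \<and> Comp K t (\<eta> (B i)) = Comp K (\<epsilon> (X i)) (e i)" if i: "i \<in> I" for i
    using fibrant_extend[OF Xf[OF i] unitD(2,3,1)[OF Bo[OF i]] comp[OF e[OF i] \<epsilon>X(1)[OF i]]]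
    unfolding T_def by blast
  then obtain t where t: "\<And>i. i \<in> I \<Longrightarrow> t i \<in> hom K (T i) (X i)"
    "\<And>i. i \<in> I \<Longrightarrow> Comp K (t i) (\<eta> (B i)) = Comp K (\<epsilon> (X i)) (e i)" by metis
  obtain N \<tau> where N: "is_coproduct K I T N \<tau>" using copr[OF I, of T] Ho_obj[OF TH] by blast
  note \<tau> = coproduct_inj[OF N]
  have \<eta>B: "\<eta> (B i) \<in> hom K (B i) (T i)" if "i \<in> I" for i
    unfolding T_def using unitD(1)[OF Bo[OF that]] .
  have \<theta>B: "\<theta> x i \<in> hom K (B i) (Q x)" if "i \<in> I" for i using \<theta>[OF that] by (simp add: B_def)
  have "Comp K (\<tau> i) (\<eta> (B i)) \<in> hom K (fobj (E i) (x i)) N" if "i \<in> I" for i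
    using comp[OF \<eta>B[OF that] \<tau>[OF that]] by (simp add: B_def)
  \<comment> \<open>The arrow \<open>k\<close> ends in \<open>fobj R (Q x)\<close>, where
    \<open>Q x\<close> is the coproduct of the \<open>B i\<close>; \<open>n\<close> leads on to the
    coproduct \<open>N\<close> of the \<open>T i\<close>.\<close>
  from coproduct_desc[OF Q[OF xO] coproduct_obj[OF N] this]
  obtain n where n: "n \<in> hom K (Q x) N" "\<And>i. i \<in> I \<Longrightarrow> Comp K n (\<theta> x i) = Comp K (\<tau> i) (\<eta> (B i))"
    by metis
  obtain u where u: "u \<in> hom K N P0" "\<And>i. i \<in> I \<Longrightarrow> Comp K u (\<tau> i) = Comp K (\<iota>0 i) (t i)"
    using coproduct_desc[OF N coproduct_obj[OF P0] comp[OF t(1) \<iota>0]] by metis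
  \<comment> \<open>On each summand both composites are the arrow from \<open>B i\<close> through
    \<open>C i\<close> to \<open>X i\<close>, followed by the injection into \<open>P0\<close>; so
    the two routes agree in \<open>K\<close>, not just up to homotopy.\<close>
  have un: "Comp K u n = Comp K w (d x)"
  proof (rule coproduct_eq[OF Q[OF xO] comp[OF n(1) u(1)] comp[OF dx w(1)]])
    fix i assume i: "i \<in> I"
    have "Comp K (Comp K u n) (\<theta> x i) = Comp K u (Comp K (\<tau> i) (\<eta> (B i)))"
      using assoc[OF \<theta>B[OF i] n(1) u(1)] n(2)[OF i] by simp
    also have "\<dots> = Comp K (\<iota>0 i) (Comp K (\<epsilon> (X i)) (e i))"
      using assoc[OF \<eta>B[OF i] \<tau>[OF i] u(1)] u(2)[OF i] assoc[OF \<eta>B[OF i] t(1)[OF i] \<iota>0[OF i]] t(2)[OF i]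
      by simp
    also have "\<dots> = Comp K w (Comp K (\<gamma> i) (e i))"
      using assoc[OF e[OF i] \<epsilon>X(1)[OF i] \<iota>0[OF i]] w(2)[OF i] assoc[OF e[OF i] \<gamma>[OF i] w(1)] by simp
    also have "\<dots> = Comp K (Comp K w (d x)) (\<theta> x i)"
      using assoc[OF \<theta>B[OF i] dx w(1)] d\<theta>[OF xO i] by (simp add: e_def)
    finally show "Comp K (Comp K u n) (\<theta> x i) = Comp K (Comp K w (d x)) (\<theta> x i)" .
  qed
  note Rv = functorD(5)[OF R v(1)] and Rw = functorD(5)[OF R w(1)] and Ru = functorD(5)[OF R u(1)]
    and Rn = functorD(5)[OF R n(1)] and Rd = functorD(5)[OF R dx]
  \<comment> \<open>Insert the retraction, replace \<open>farr R v\<close> after \<open>f0\<close>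
    by its factorization through \<open>d x\<close>, and exchange \<open>w\<close> after
    \<open>d x\<close> for \<open>u\<close> after \<open>n\<close>.\<close>
  have "f0 = Comp K (farr R (Comp K w v)) f0"
    using ident_left[OF f0] functorD(4)[OF R coproduct_obj[OF P0]] wv by simp
  also have "\<dots> = Comp K (farr R w) (Comp K (farr R (d x)) k)"
    using functorD(6)[OF R v(1) w(1)] assoc[OF f0 Rv Rw] fk by simp
  also have "\<dots> = Comp K (farr R (Comp K w (d x))) k"
    using functorD(6)[OF R dx w(1)] assoc[OF k Rd Rw] by simp
  also have "\<dots> = Comp K (farr R u) (Comp K (farr R n) k)"
    using un functorD(6)[OF R n(1) u(1)] assoc[OF k Rn Ru] by simp
  finally have f0': "f0 = Comp K (farr R u) (Comp K (farr R n) k)" .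
  have "\<exists>Q \<iota>' m h. is_coproduct (Ho K) I T Q \<iota>' \<and> m \<in> hom (Ho K) Q P \<and>
      (\<forall>i \<in> I. Comp (Ho K) m (\<iota>' i) = Comp (Ho K) (\<iota> i) (homotopy_class K (t i))) \<and>
      h \<in> hom (Ho K) S Q \<and> f = Comp (Ho K) m h"
    by (rule Ho_coproduct_factorization[OF P0 X N subset_refl TH t(1) u comp[OF k Rn] S(1) P b])
      (use bf f0' in simp_all)
  then show ?thesis
    using TH Tp hom_HoI[OF t(1) TH X] by (intro exI[of _ T] exI[of _ "\<lambda>i. homotopy_class K (t i)"]) auto
qed

end

theorem theorem3p9:
  fixes \<kappa> :: "'u rel" and K :: "('o, 'm) model_cat"
  assumes "inaccessible_universe TYPE('u)"
    and "regular_cardinal \<kappa>"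
    and "strongly_combinatorial \<kappa> K"
  shows "well_generated \<kappa> (Ho K)"
proof -
  note U = assms(1) and \<kappa> = assms(2) and K = assms(3)[unfolded strongly_combinatorial_def]
  have model: "model_category TYPE('u) K" and lp: "locally_presentable_at \<kappa> K"
    using K by (auto simp: combinatorial_def)
  obtain \<A> where \<A>: "weak_generator TYPE('u) (Ho K) \<A>" "\<forall>A \<in> \<A>. presentable \<kappa> K A"
    using K by blast
  obtain R R' where R: "fibrant_replacement K R" and R': "cofibrant_replacement K R'"
    and pres: "preserves_filtered_colimits \<kappa> K K R" "preserves_filtered_colimits \<kappa> K K R'"
    and pres_obj: "\<And>A. presentable \<kappa> K A \<Longrightarrow> presentable \<kappa> K (fobj R A)"
      "\<And>A. presentable \<kappa> K A \<Longrightarrow> presentable \<kappa> K (fobj R' A)"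
    using K by blast
  obtain \<eta> where \<eta>: "\<And>X. X \<in> Obj K \<Longrightarrow> \<eta> X \<in> hom K X (fobj R X) \<inter> cof K \<inter> weq K"
    "\<And>f. f \<in> Arr K \<Longrightarrow> Comp K (farr R f) (\<eta> (Dom K f)) = Comp K (\<eta> (Cod K f)) f"
    using R unfolding fibrant_replacement_def by blast
  obtain \<epsilon> where \<epsilon>: "\<And>X. X \<in> Obj K \<Longrightarrow> \<epsilon> X \<in> hom K (fobj R' X) X \<inter> fib K \<inter> weq K"
    using R' unfolding cofibrant_replacement_def by blast
  interpret homotopical K by (rule model_category_homotopical[OF U model])
  interpret functorial_fibrant_replacement K R \<eta>
    using R \<eta> unfolding fibrant_replacement_def by unfold_locales (auto simp: hom_def)
  have loc: "locally_small_category TYPE('u) K" and cc: "cocomplete TYPE('u) K"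
    using model by (auto simp: model_category_def)
  note copr = cocomplete_coproduct[OF category_axioms cc]
  obtain \<B> where \<B>: "\<forall>A \<in> \<B>. presentable \<kappa> K A"
    "\<forall>X \<in> Obj K. \<exists>(J :: ('u, 'u) cat) D c. filtered \<kappa> J \<and> is_functor J K D \<and> fobj D ` Obj J \<subseteq> \<B> \<and>
      is_colimit K J D X c"
    using lp unfolding locally_presentable_at_def by blast
  have dense: "\<exists>(J :: ('u, 'u) cat) D c. filtered \<kappa> J \<and> is_functor J K D \<and>
      (\<forall>j \<in> Obj J. presentable \<kappa> K (fobj D j)) \<and> is_colimit K J D X c" if X: "X \<in> Obj K" for X
  proof -
    obtain J :: "('u, 'u) cat" and D c where "filtered \<kappa> J" "is_functor J K D"
      "fobj D ` Obj J \<subseteq> \<B>" "is_colimit K J D X c"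
      using bspec[OF \<B>(2) X] by (elim exE conjE)
    moreover from this have "\<forall>j \<in> Obj J. presentable \<kappa> K (fobj D j)" using \<B>(1) by blast
    ultimately show ?thesis by (intro exI conjI)
  qed
  have R'_cof: "cofibrant K (fobj R' X)" if "X \<in> Obj K" for X
    using R' that by (simp add: cofibrant_replacement_def)
  have R'_functor: "is_functor K K R'" using R' by (simp add: cofibrant_replacement_def)
  \<comment> \<open>Presentability is taken in \<open>K\<close>, which is what the hypothesis on the
    weak generator provides; its members are bifibrant as objects of \<open>Ho K\<close>.\<close>
  let ?S = "{S \<in> Obj (Ho K). presentable \<kappa> K S}"
  have "compact_class \<kappa> (Ho K) ?S"
    unfolding compact_class_def
  proof (intro conjI ballI allI impI; (elim conjE)?)
    fix S assume "S \<in> ?S"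
    then show "small_object \<kappa> (Ho K) S" using small_object_Ho[OF U \<kappa> copr pres(1)] by blast
  next
    fix S X P \<iota> f and I :: "'u set"
    assume S: "S \<in> ?S" and I: "small TYPE('u) I" and X: "\<forall>i \<in> I. X i \<in> Obj (Ho K)"
      and P: "is_coproduct (Ho K) I X P \<iota>" and f: "f \<in> hom (Ho K) S P"
    have X': "X i \<in> Obj (Ho K)" if "i \<in> I" for i using X that by blast
    have S': "S \<in> Obj (Ho K)" "presentable \<kappa> K S" using S by simp_all
    show "\<exists>T g. (\<forall>i \<in> I. T i \<in> ?S \<and> g i \<in> hom (Ho K) (T i) (X i)) \<and>
      (\<exists>Q \<iota>' m h. is_coproduct (Ho K) I T Q \<iota>' \<and> m \<in> hom (Ho K) Q P \<and>
        (\<forall>i \<in> I. Comp (Ho K) m (\<iota>' i) = Comp (Ho K) (\<iota> i) (g i)) \<and>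
        h \<in> hom (Ho K) S Q \<and> f = Comp (Ho K) m h)"
      using compact_factorization_Ho[OF U \<kappa> copr pres(1) R'_functor R'_cof \<epsilon> pres(2) dense pres_obj
          S' I X' P f] by simp
  qed
  then have "?S \<subseteq> compact_objects \<kappa> (Ho K)" by (rule compact_objects_greatest)
  moreover have "\<A> \<subseteq> ?S" using \<A> by (auto simp: weak_generator_def)
  ultimately show ?thesis
    using \<A>(1) locally_small_Ho[OF loc] has_coproducts_Ho[OF copr] unfolding well_generated_def by blast
qed

end
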